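(* Let $n\ge2$, let $F_n$ be the free group with free basis $A=\{a_1,\ldots,a_n\}$, and let $s\in F_n$ be such that the quotient graph $\mathrm{Cay}(F_n;\{s^{\pm1}\})/{\sim_1}$ is a cycle. Then $\mathrm{Cay}(F_n;A^{\pm1}\cup\{s^{\pm1}\})$ is outerplanar.
   Context: For symmetric $T\subseteq G$, $\mathrm{Cay}(G;T)$ has vertex set $G$, with $x$ adjacent to $y$ iff $x^{-1}y\in T$. The equivalence relation $\sim_1$ on $F_n$ declares two elements equivalent iff their reduced words have the same first letter (the identity is equivalent only to itself). The quotient graph $\mathrm{Cay}(F_n;T)/{\sim_1}$ is obtained by identifying all vertices in the same class, keeping multiple edges but deleting loops. For a connected locally finite graph $X$, $|X|$ is its Freudenthal compactification (add one point per end), and a hamiltonian circle is a subspace of $|X|$ homeomorphic to $S^1$ containing all vertices. $X$ is outerplanar if there is an embedding of $|X|$ into a closed disk such that some hamiltonian circle of $|X|$ is mapped onto the boundary of the disk. *)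

theory Defs
  imports "HOL-Analysis.Analysis" "HOL-Algebra.Group"
begin

section \<open>Free groups\<close>

text \<open>A letter is a pair of a generator and a sign: \<open>(a, True)\<close> stands for \<open>a\<close> and
  \<open>(a, False)\<close> for its inverse. The free group is realised on the reduced words.\<close>

type_synonym 'a letter = "'a \<times> bool"

fun inv_letter :: "'a letter \<Rightarrow> 'a letter" where
  "inv_letter (a, b) = (a, \<not> b)"

definition reduced_word :: "'a letter list \<Rightarrow> bool" where
  "reduced_word w \<longleftrightarrow> successively (\<lambda>x y. y \<noteq> inv_letter x) w"

text \<open>Left multiplication of a reduced word by one letter.\<close>

fun lmult :: "'a letter \<Rightarrow> 'a letter list \<Rightarrow> 'a letter list" where
  "lmult x [] = [x]"
| "lmult x (y # w) = (if y = inv_letter x then w else x # y # w)"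

definition free_group :: "'a set \<Rightarrow> 'a letter list monoid" where
  "free_group A =
     \<lparr>carrier = {w. reduced_word w \<and> set w \<subseteq> A \<times> UNIV},
      monoid.mult = foldr lmult,
      one = []\<rparr>"

definition free_basis :: "'a set \<Rightarrow> 'a letter list set" where
  "free_basis A = (\<lambda>a. [(a, True)]) ` A"

lemma inv_letter_inv_letter [simp]: "inv_letter (inv_letter x) = x"
  by (cases x) auto

lemma inv_letter_neq [simp]: "inv_letter x \<noteq> x" "x \<noteq> inv_letter x"
  by (cases x; auto)+

lemma reduced_Nil [simp]: "reduced_word []"
  by (simp add: reduced_word_def)

lemma reduced_ConsD: "reduced_word (x # w) \<Longrightarrow> reduced_word w"
  by (cases w) (auto simp: reduced_word_def)

lemma reduced_lmult: "reduced_word w \<Longrightarrow> reduced_word (lmult x w)"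
  by (cases w) (auto simp: reduced_word_def successively_Cons)

lemma lmult_reduced: "reduced_word (x # w) \<Longrightarrow> lmult x w = x # w"
  by (cases w) (auto simp: reduced_word_def)

lemma lmult_inv [simp]: "reduced_word w \<Longrightarrow> lmult x (lmult (inv_letter x) w) = w"
  by (cases w) (auto simp: lmult_reduced)

lemma lmult_inv' [simp]: "reduced_word w \<Longrightarrow> lmult (inv_letter x) (lmult x w) = w"
  using lmult_inv[of w "inv_letter x"] by simp

lemma reduced_foldr: "reduced_word v \<Longrightarrow> reduced_word (foldr lmult u v)"
  by (induction u) (auto simp: reduced_lmult)

lemma foldr_lmult_lmult:
  assumes "reduced_word u" "reduced_word w"
  shows "foldr lmult (lmult x u) w = lmult x (foldr lmult u w)"
  using assms by (cases u) (auto simp: reduced_foldr)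

lemma foldr_lmult_assoc:
  assumes "reduced_word u" "reduced_word v" "reduced_word w"
  shows "foldr lmult (foldr lmult u v) w = foldr lmult u (foldr lmult v w)"
  using assms(1)
  by (induction u) (auto simp: foldr_lmult_lmult reduced_foldr assms dest: reduced_ConsD)

lemma set_lmult: "set (lmult x w) \<subseteq> insert x (set w)"
  by (cases w) auto

lemma set_foldr_lmult: "set (foldr lmult u v) \<subseteq> set u \<union> set v"
  by (induction u) (use set_lmult in fastforce)+

lemma foldr_lmult_Nil: "reduced_word u \<Longrightarrow> foldr lmult u [] = u"
proof (induction u)
  case (Cons x u)
  then show ?case using reduced_ConsD[of x u] lmult_reduced[of x u] by simp
qed simp

lemma foldr_lmult_inverse: "reduced_word v \<Longrightarrow> foldr lmult (rev (map inv_letter u)) (foldr lmult u v) = v"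
  by (induction u arbitrary: v) (auto simp: reduced_foldr)

lemma reduced_inverse: "reduced_word u \<Longrightarrow> reduced_word (rev (map inv_letter u))"
  by (induction u rule: induct_list012)
     (auto simp: reduced_word_def successively_append_iff)

lemma group_free_group: "group (free_group A)"
proof (rule groupI)
  fix u assume u: "u \<in> carrier (free_group A)"
  have "rev (map inv_letter u) \<in> carrier (free_group A)"
    using u reduced_inverse[of u] by (auto simp: free_group_def)
  moreover have "rev (map inv_letter u) \<otimes>\<^bsub>free_group A\<^esub> u = \<one>\<^bsub>free_group A\<^esub>"
    using u foldr_lmult_inverse[of "[]" u] by (auto simp: free_group_def foldr_lmult_Nil)
  ultimately show "\<exists>v\<in>carrier (free_group A). v \<otimes>\<^bsub>free_group A\<^esub> u = \<one>\<^bsub>free_group A\<^esub>"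
    by blast
next
  fix u v assume "u \<in> carrier (free_group A)" "v \<in> carrier (free_group A)"
  then show "u \<otimes>\<^bsub>free_group A\<^esub> v \<in> carrier (free_group A)"
    using set_foldr_lmult[of u v] by (auto simp: free_group_def reduced_foldr)
qed (auto simp: free_group_def foldr_lmult_assoc)

text \<open>The relation \<open>\<sim>\<^sub>1\<close> on the free group.\<close>

definition same_first_letter :: "'a set \<Rightarrow> ('a letter list \<times> 'a letter list) set" where
  "same_first_letter A = {(x, y). x \<in> carrier (free_group A) \<and> y \<in> carrier (free_group A) \<and>
     (x = [] \<and> y = [] \<or> x \<noteq> [] \<and> y \<noteq> [] \<and> hd x = hd y)}"

lemma equiv_same_first_letter: "equiv (carrier (free_group A)) (same_first_letter A)"
  by (auto simp: equiv_def refl_on_def sym_def trans_def same_first_letter_def)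


section \<open>Graphs, Cayley graphs and quotients\<close>

record 'v graph =
  verts :: "'v set"
  edges :: "'v set set"

text \<open>Cayley graphs are simple graphs: a unit in \<open>T\<close> contributes no edge.\<close>

definition Cay :: "('g, 'm) monoid_scheme \<Rightarrow> 'g set \<Rightarrow> 'g graph" where
  "Cay G T =
     \<lparr>verts = carrier G,
      edges = {{x, y} | x y. x \<in> carrier G \<and> y \<in> carrier G \<and> x \<noteq> y \<and>
                 inv\<^bsub>G\<^esub> x \<otimes>\<^bsub>G\<^esub> y \<in> T}\<rparr>"

text \<open>In a multigraph the edges are abstract objects, each with a set of one (for a loop) or
  two end vertices.\<close>

record ('v, 'e) multigraph =
  mverts :: "'v set"
  medges :: "'e set"
  endpoints :: "'e \<Rightarrow> 'v set"

text \<open>Identifying the vertices in each class of \<open>R\<close>: parallel edges stay distinct, since the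
  edges of the quotient are those of \<open>X\<close>; those whose ends fall into one class are deleted.\<close>

definition quotient_graph :: "'v graph \<Rightarrow> ('v \<times> 'v) set \<Rightarrow> ('v set, 'v set) multigraph" where
  "quotient_graph X R =
     \<lparr>mverts = verts X // R,
      medges = {e \<in> edges X. card ((\<lambda>x. R `` {x}) ` e) = 2},
      endpoints = (\<lambda>e. (\<lambda>x. R `` {x}) ` e)\<rparr>"

definition is_cycle :: "('v, 'e) multigraph \<Rightarrow> bool" where
  "is_cycle M \<longleftrightarrow> (\<exists>vs es.
     vs \<noteq> [] \<and> length es = length vs \<and> distinct vs \<and> distinct es \<and>
     set vs = mverts M \<and> set es = medges M \<and>
     (\<forall>i<length vs. endpoints M (es ! i) = {vs ! i, vs ! (Suc i mod length vs)}))"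


section \<open>The Freudenthal compactification of a graph\<close>

text \<open>\<open>joined X S x y\<close>: \<open>x\<close> and \<open>y\<close> lie in the same component of \<open>X - S\<close>.\<close>

definition joined :: "'v graph \<Rightarrow> 'v set \<Rightarrow> 'v \<Rightarrow> 'v \<Rightarrow> bool" where
  "joined X S x y \<longleftrightarrow> x \<in> verts X - S \<and> y \<in> verts X - S \<and>
     (x, y) \<in> {(a, b). a \<in> verts X - S \<and> b \<in> verts X - S \<and> {a, b} \<in> edges X}\<^sup>*"

definition connected_graph :: "'v graph \<Rightarrow> bool" where
  "connected_graph X \<longleftrightarrow> verts X \<noteq> {} \<and> (\<forall>x\<in>verts X. \<forall>y\<in>verts X. joined X {} x y)"

definition locally_finite_graph :: "'v graph \<Rightarrow> bool" where
  "locally_finite_graph X \<longleftrightarrow> (\<forall>v\<in>verts X. finite {e \<in> edges X. v \<in> e})"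

definition ray :: "'v graph \<Rightarrow> (nat \<Rightarrow> 'v) \<Rightarrow> bool" where
  "ray X r \<longleftrightarrow> inj r \<and> range r \<subseteq> verts X \<and> (\<forall>i. {r i, r (Suc i)} \<in> edges X)"

text \<open>Two rays are equivalent if, for every finite set \<open>S\<close> of vertices, they have tails in the
  same component of \<open>X - S\<close>.\<close>

definition ray_equiv :: "'v graph \<Rightarrow> ((nat \<Rightarrow> 'v) \<times> (nat \<Rightarrow> 'v)) set" where
  "ray_equiv X = {(r, r'). ray X r \<and> ray X r' \<and>
     (\<forall>S. finite S \<and> S \<subseteq> verts X \<longrightarrow> (\<exists>N. \<forall>i\<ge>N. \<forall>j\<ge>N. joined X S (r i) (r' j)))}"

definition graph_ends :: "'v graph \<Rightarrow> (nat \<Rightarrow> 'v) set set" where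
  "graph_ends X = {r. ray X r} // ray_equiv X"

text \<open>The component of \<open>X - S\<close> in which the end \<open>\<omega>\<close> lives.\<close>

definition end_component :: "'v graph \<Rightarrow> 'v set \<Rightarrow> (nat \<Rightarrow> 'v) set \<Rightarrow> 'v set" where
  "end_component X S \<omega> = {v. \<exists>r\<in>\<omega>. \<exists>N. \<forall>i\<ge>N. joined X S v (r i)}"

text \<open>Points of the 1-complex of a graph are given by their barycentric coordinates:
  \<open>bary u v t\<close> is the point dividing the edge \<open>uv\<close> in the ratio \<open>t : 1 - t\<close>, and
  \<open>bary v v t\<close> is the vertex \<open>v\<close>.\<close>

definition bary :: "'v \<Rightarrow> 'v \<Rightarrow> real \<Rightarrow> 'v \<Rightarrow> real" where
  "bary u v t = (\<lambda>w. (1 - t) * of_bool (w = u) + t * of_bool (w = v))"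

definition complex_points :: "'v graph \<Rightarrow> ('v \<Rightarrow> real) set" where
  "complex_points X = {bary v v 0 | v. v \<in> verts X} \<union>
     {bary u v t | u v t. {u, v} \<in> edges X \<and> t \<in> {0..1}}"

datatype 'v fpoint = Pt "'v \<Rightarrow> real" | End "(nat \<Rightarrow> 'v) set"

definition vertex_point :: "'v \<Rightarrow> 'v fpoint" where
  "vertex_point v = Pt (bary v v 0)"

definition fpoints :: "'v graph \<Rightarrow> 'v fpoint set" where
  "fpoints X = Pt ` complex_points X \<union> End ` graph_ends X"

text \<open>The basic neighbourhood of \<open>\<omega>\<close> given by \<open>S\<close>: the component \<open>C\<close> of \<open>X - S\<close> in which \<open>\<omega>\<close>
  lives, the interiors of the edges between \<open>C\<close> and \<open>S\<close>, and all ends that live in \<open>C\<close>.\<close>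

definition end_nbhd :: "'v graph \<Rightarrow> 'v set \<Rightarrow> (nat \<Rightarrow> 'v) set \<Rightarrow> 'v fpoint set" where
  "end_nbhd X S \<omega> =
     {Pt p | p. p \<in> complex_points X \<and> (\<exists>v \<in> end_component X S \<omega>. p v > 0)} \<union>
     {End \<eta> | \<eta>. \<eta> \<in> graph_ends X \<and> (\<exists>r\<in>\<eta>. \<exists>N. \<forall>i\<ge>N. r i \<in> end_component X S \<omega>)}"

text \<open>A set is open if it meets the 1-complex in an open set (of the weak topology, tested on each
  closed edge) and contains a basic neighbourhood of each of its ends. For a locally finite graph,
  letting the basic neighbourhoods contain the edges between \<open>C\<close> and \<open>S\<close> only partially
  gives the same topology: enlarge \<open>S\<close> by its neighbours.\<close>

definition fopen :: "'v graph \<Rightarrow> 'v fpoint set \<Rightarrow> bool" where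
  "fopen X U \<longleftrightarrow> U \<subseteq> fpoints X \<and>
     (\<forall>u v. {u, v} \<in> edges X \<longrightarrow>
        openin (top_of_set {0..1}) {t \<in> {0..1}. Pt (bary u v t) \<in> U}) \<and>
     (\<forall>\<omega>. End \<omega> \<in> U \<longrightarrow> (\<exists>S. finite S \<and> S \<subseteq> verts X \<and> end_nbhd X S \<omega> \<subseteq> U))"

definition freudenthal :: "'v graph \<Rightarrow> 'v fpoint topology" where
  "freudenthal X = topology (fopen X)"

lemma joined_sym: "joined X S x y \<Longrightarrow> joined X S y x"
proof -
  assume "joined X S x y"
  moreover have "sym {(a, b). a \<in> verts X - S \<and> b \<in> verts X - S \<and> {a, b} \<in> edges X}"
    by (auto simp: sym_def insert_commute)
  ultimately show ?thesis
    unfolding joined_def by (metis (lifting) sym_rtrancl symD)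
qed

lemma joined_trans: "joined X S x y \<Longrightarrow> joined X S y z \<Longrightarrow> joined X S x z"
  unfolding joined_def by (meson rtrancl_trans)

lemma ray_tail_joined:
  assumes "ray X r" "finite S"
  shows "\<exists>N. \<forall>i\<ge>N. \<forall>j\<ge>N. joined X S (r i) (r j)"
proof -
  have "finite (r -` S)"
    using assms by (auto simp: ray_def intro: finite_vimageI)
  then obtain N where "\<forall>i\<in>r -` S. i < N"
    using finite_nat_set_iff_bounded by blast
  then have "r i \<notin> S" if "i \<ge> N" for i
    using that by (meson leD vimageI)
  then have N: "r i \<in> verts X - S" if "i \<ge> N" for i
    using assms(1) that unfolding ray_def by blast
  have up: "joined X S (r i) (r (i + k))" if "i \<ge> N" for i k
  proof (induction k)
    case 0
    then show ?case using N[OF that] by (simp add: joined_def)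
  next
    case (Suc k)
    have "{r (i + k), r (i + Suc k)} \<in> edges X"
      using assms(1) by (simp add: ray_def)
    then have "joined X S (r (i + k)) (r (i + Suc k))"
      using N[of "i + k"] N[of "i + Suc k"] that
      unfolding joined_def by (simp add: r_into_rtrancl)
    with Suc show ?case by (rule joined_trans)
  qed
  have "joined X S (r i) (r j)" if "i \<ge> N" "j \<ge> N" for i j
    using up[of i "j - i"] up[of j "i - j"] that
    by (cases "i \<le> j") (simp_all add: joined_sym)
  then show ?thesis by blast
qed

lemma ray_equivI:
  assumes "ray X r" "ray X r'"
    and "\<And>S. finite S \<Longrightarrow> S \<subseteq> verts X \<Longrightarrow> \<exists>N. \<forall>i\<ge>N. \<forall>j\<ge>N. joined X S (r i) (r' j)"
  shows "(r, r') \<in> ray_equiv X"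
  using assms by (simp add: ray_equiv_def)

lemma ray_equivD:
  assumes "(r, r') \<in> ray_equiv X"
  shows "ray X r" "ray X r'"
    and "finite S \<Longrightarrow> S \<subseteq> verts X \<Longrightarrow> \<exists>N. \<forall>i\<ge>N. \<forall>j\<ge>N. joined X S (r i) (r' j)"
  using assms by (simp_all add: ray_equiv_def)

lemma equiv_ray_equiv: "equiv {r. ray X r} (ray_equiv X)"
proof (rule equivI)
  show "ray_equiv X \<subseteq> {r. ray X r} \<times> {r. ray X r}"
    by (auto simp: ray_equiv_def)
  show "refl_on {r. ray X r} (ray_equiv X)"
    by (simp add: refl_on_def ray_equivI ray_tail_joined)
  show "sym (ray_equiv X)"
  proof (rule symI)
    fix p q assume pq: "(p, q) \<in> ray_equiv X"
    have "\<exists>N. \<forall>i\<ge>N. \<forall>j\<ge>N. joined X S (q i) (p j)" if S: "finite S" "S \<subseteq> verts X" for S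
    proof -
      obtain N where "\<forall>i\<ge>N. \<forall>j\<ge>N. joined X S (p i) (q j)"
        using ray_equivD(3)[OF pq S] by blast
      then show ?thesis by (intro exI[of _ N]) (simp add: joined_sym)
    qed
    with ray_equivD(2,1)[OF pq] show "(q, p) \<in> ray_equiv X"
      by (rule ray_equivI)
  qed
  show "trans (ray_equiv X)"
  proof (rule transI)
    fix p q r assume pq: "(p, q) \<in> ray_equiv X" and qr: "(q, r) \<in> ray_equiv X"
    have "\<exists>N. \<forall>i\<ge>N. \<forall>j\<ge>N. joined X S (p i) (r j)" if S: "finite S" "S \<subseteq> verts X" for S
    proof -
      obtain N where N: "\<forall>i\<ge>N. \<forall>j\<ge>N. joined X S (p i) (q j)"
        using ray_equivD(3)[OF pq S] by blast
      obtain M where M: "\<forall>i\<ge>M. \<forall>j\<ge>M. joined X S (q i) (r j)"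
        using ray_equivD(3)[OF qr S] by blast
      have "joined X S (p i) (r j)" if "i \<ge> max M N" "j \<ge> max M N" for i j
        using N M that joined_trans[of X S "p i" "q (max M N)" "r j"] by auto
      then show ?thesis by blast
    qed
    with ray_equivD(1)[OF pq] ray_equivD(2)[OF qr] show "(p, r) \<in> ray_equiv X"
      by (rule ray_equivI)
  qed
qed

lemma joined_mono: "joined X S' x y \<Longrightarrow> S \<subseteq> S' \<Longrightarrow> joined X S x y"
proof -
  assume "joined X S' x y" and S: "S \<subseteq> S'"
  moreover have "{(a, b). a \<in> verts X - S' \<and> b \<in> verts X - S' \<and> {a, b} \<in> edges X}\<^sup>* \<subseteq>
      {(a, b). a \<in> verts X - S \<and> b \<in> verts X - S \<and> {a, b} \<in> edges X}\<^sup>*"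
    by (rule rtrancl_mono) (use S in blast)
  ultimately show "joined X S x y"
    unfolding joined_def by blast
qed

lemma end_component_mono: "S \<subseteq> S' \<Longrightarrow> end_component X S' \<omega> \<subseteq> end_component X S \<omega>"
  unfolding end_component_def by (blast intro: joined_mono)

lemma end_nbhd_mono: "S \<subseteq> S' \<Longrightarrow> end_nbhd X S' \<omega> \<subseteq> end_nbhd X S \<omega>"
proof -
  assume "S \<subseteq> S'"
  then have C: "end_component X S' \<omega> \<subseteq> end_component X S \<omega>"
    by (rule end_component_mono)
  then have p: "(\<exists>v\<in>end_component X S' \<omega>. p v > 0) \<Longrightarrow> (\<exists>v\<in>end_component X S \<omega>. p v > 0)" for p :: "_ \<Rightarrow> real"
    by (meson subsetD)
  have e: "(\<exists>r\<in>\<eta>. \<exists>N. \<forall>i\<ge>N. r i \<in> end_component X S' \<omega>) \<Longrightarrow>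
      (\<exists>r\<in>\<eta>. \<exists>N. \<forall>i\<ge>N. r i \<in> end_component X S \<omega>)" for \<eta>
    using C by (meson subsetD)
  show ?thesis
    unfolding end_nbhd_def
    by (intro Un_mono Collect_mono impI; elim exE conjE; intro exI conjI; (assumption | erule p | erule e))
qed

lemma fopenI:
  assumes "U \<subseteq> fpoints X"
    and "\<And>u v. {u, v} \<in> edges X \<Longrightarrow>
      openin (top_of_set {0..1}) {t \<in> {0..1}. Pt (bary u v t) \<in> U}"
    and "\<And>\<omega>. End \<omega> \<in> U \<Longrightarrow> \<exists>S. finite S \<and> S \<subseteq> verts X \<and> end_nbhd X S \<omega> \<subseteq> U"
  shows "fopen X U"
  unfolding fopen_def by (intro conjI allI impI assms)

lemma fopenD:
  assumes "fopen X U"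
  shows "U \<subseteq> fpoints X"
    and "{u, v} \<in> edges X \<Longrightarrow>
      openin (top_of_set {0..1}) {t \<in> {0..1}. Pt (bary u v t) \<in> U}"
    and "End \<omega> \<in> U \<Longrightarrow> \<exists>S. finite S \<and> S \<subseteq> verts X \<and> end_nbhd X S \<omega> \<subseteq> U"
  using assms[unfolded fopen_def] by simp_all

lemma istopology_fopen: "istopology (fopen X)"
  unfolding istopology_def
proof (intro conjI allI impI)
  fix U V assume U: "fopen X U" and V: "fopen X V"
  show "fopen X (U \<inter> V)"
  proof (rule fopenI)
    show "U \<inter> V \<subseteq> fpoints X" using fopenD(1)[OF U] by blast
  next
    fix u v assume e: "{u, v} \<in> edges X"
    have "{t \<in> {0..1}. Pt (bary u v t) \<in> U \<inter> V} =
        {t \<in> {0..1}. Pt (bary u v t) \<in> U} \<inter> {t \<in> {0..1}. Pt (bary u v t) \<in> V}"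
      by blast
    then show "openin (top_of_set {0..1}) {t \<in> {0..1}. Pt (bary u v t) \<in> U \<inter> V}"
      by (simp only: openin_Int fopenD(2)[OF U e] fopenD(2)[OF V e])
  next
    fix \<omega> assume "End \<omega> \<in> U \<inter> V"
    then have \<omega>: "End \<omega> \<in> U" "End \<omega> \<in> V" by blast+
    obtain S where S: "finite S" "S \<subseteq> verts X" "end_nbhd X S \<omega> \<subseteq> U"
      using fopenD(3)[OF U \<omega>(1)] by blast
    obtain S' where S': "finite S'" "S' \<subseteq> verts X" "end_nbhd X S' \<omega> \<subseteq> V"
      using fopenD(3)[OF V \<omega>(2)] by blast
    have "end_nbhd X (S \<union> S') \<omega> \<subseteq> U \<inter> V"
      using S(3) S'(3) end_nbhd_mono[of S "S \<union> S'" X \<omega>] end_nbhd_mono[of S' "S \<union> S'" X \<omega>]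
      by blast
    then show "\<exists>T. finite T \<and> T \<subseteq> verts X \<and> end_nbhd X T \<omega> \<subseteq> U \<inter> V"
      using S(1,2) S'(1,2) by (intro exI[of _ "S \<union> S'"]) simp
  qed
next
  fix \<K> assume K: "\<forall>K\<in>\<K>. fopen X K"
  show "fopen X (\<Union>\<K>)"
  proof (rule fopenI)
    show "\<Union>\<K> \<subseteq> fpoints X" by (rule Union_least) (rule fopenD(1)[OF K[rule_format]])
  next
    fix u v assume e: "{u, v} \<in> edges X"
    have "{t \<in> {0..1}. Pt (bary u v t) \<in> \<Union>\<K>} =
        (\<Union>U\<in>\<K>. {t \<in> {0..1}. Pt (bary u v t) \<in> U})"
      by blast
    moreover have "openin (top_of_set {0..1}) (\<Union>U\<in>\<K>. {t \<in> {0..1}. Pt (bary u v t) \<in> U})"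
      by (rule openin_Union) (use K fopenD(2)[OF _ e] in fast)
    ultimately show "openin (top_of_set {0..1}) {t \<in> {0..1}. Pt (bary u v t) \<in> \<Union>\<K>}"
      by (simp only:)
  next
    fix \<omega> assume "End \<omega> \<in> \<Union>\<K>"
    then obtain U where U: "U \<in> \<K>" "End \<omega> \<in> U" by blast
    then obtain S where "finite S" "S \<subseteq> verts X" "end_nbhd X S \<omega> \<subseteq> U"
      using K fopenD(3)[of X U \<omega>] by blast
    then show "\<exists>S. finite S \<and> S \<subseteq> verts X \<and> end_nbhd X S \<omega> \<subseteq> \<Union>\<K>"
      using U(1) by blast
  qed
qed

lemma openin_freudenthal: "openin (freudenthal X) U \<longleftrightarrow> fopen X U"
  by (simp add: freudenthal_def topology_inverse'[OF istopology_fopen])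

lemma topspace_freudenthal: "topspace (freudenthal X) = fpoints X"
proof -
  have "fopen X (fpoints X)"
  proof (rule fopenI)
    fix u v assume e: "{u, v} \<in> edges X"
    have "Pt (bary u v t) \<in> fpoints X" if "t \<in> {0..1}" for t
      using e that unfolding fpoints_def complex_points_def by blast
    then have "{t \<in> {0..1}. Pt (bary u v t) \<in> fpoints X} = {0..1}"
      by blast
    then show "openin (top_of_set {0..1}) {t \<in> {0..1}. Pt (bary u v t) \<in> fpoints X}"
      by (simp only: openin_subtopology_self)
  next
    fix \<omega>
    have "end_nbhd X {} \<omega> \<subseteq> fpoints X"
      unfolding fpoints_def end_nbhd_def by blast
    then show "\<exists>S. finite S \<and> S \<subseteq> verts X \<and> end_nbhd X S \<omega> \<subseteq> fpoints X"
      by (intro exI[of _ "{}"]) simp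
  qed simp
  then show ?thesis
    using fopenD(1) unfolding topspace_def openin_freudenthal by blast
qed


section \<open>Hamiltonian circles and outerplanarity\<close>

definition hamiltonian_circle :: "'v graph \<Rightarrow> 'v fpoint set \<Rightarrow> bool" where
  "hamiltonian_circle X C \<longleftrightarrow> C \<subseteq> topspace (freudenthal X) \<and>
     subtopology (freudenthal X) C homeomorphic_space top_of_set (sphere (0::complex) 1) \<and>
     vertex_point ` verts X \<subseteq> C"

text \<open>Only connected locally finite graphs have a Freudenthal compactification in the intended
  sense, so the first two conjuncts delimit the domain of the notion.\<close>

definition outerplanar :: "'v graph \<Rightarrow> bool" where
  "outerplanar X \<longleftrightarrow> connected_graph X \<and> locally_finite_graph X \<and>
     (\<exists>f C. embedding_map (freudenthal X) (top_of_set (cball (0::complex) 1)) f \<and>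
        hamiltonian_circle X C \<and> f ` C = sphere 0 1)"

end

theory Submission imports Defs begin

text \<open>
  The edges of \<open>Cay(F\<^sub>n; {s\<^sup>\<plusminus>\<^sup>1})\<close> that join different classes of \<open>\<sim>\<^sub>1\<close> arrange the identity and the
  \<open>2n\<close> letters in a cyclic order. Translating it, every vertex of the tree \<open>Cay(F\<^sub>n; A\<^sup>\<plusminus>\<^sup>1)\<close> gets a cyclic
  order of its neighbours and itself; at the two ends of a tree edge these orders fit together, up to a reflection,
  since the two \<open>s\<close>-edges leaving the cone of a letter are consecutive on both sides. This yields nested
  arcs of the unit circle, one for each cone of the tree, such that the gaps between neighbouring arcs
  are exactly the \<open>s\<close>-edges and the limit points are the ends. Sending \<open>s\<close>-edges to the gaps and tree edges to
  chords defines a continuous injection of the compact space \<open>|X|\<close> into the disk, and the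
  preimage of the unit circle is the hamiltonian circle.
\<close>

section \<open>Words\<close>

text \<open>The delicate point is that gaps and vertices fit together on the circle. An s-edge is
  assigned to the longest common prefix \<open>w\<close> of its ends; translated by the inverse of
  \<open>w\<close>, it becomes an edge of the cycle. Its ends may however lie deep in the cones of
  two children of \<open>w\<close>, while the gap assigned to it is the one between the arcs of
  these children. The two match because an edge that leaves a cone is, seen from the apex of the
  cone, one of the two edges at the class of the parent. Its end therefore lies in the first or the
  last slot there, and by induction it is an extreme point of every arc that the edge leaves. Which
  of the two extremes it is depends on all reflections along the way, so the children have no
  globally fixed left-to-right order. Hence every vertex carries a coordinate of its own, and
  positions on the circle arise by composing affine maps. A vertex is itself one of the 2n+1 classes
  around it and takes a slot like a child. A child fills only half of its slot, so that every gap
  has positive length and an s-edge can be mapped into it injectively.\<close>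

lemma in_free_group: "w \<in> carrier (free_group A) \<longleftrightarrow> reduced_word w \<and> set w \<subseteq> A \<times> UNIV"
  and mult_free_group: "x \<otimes>\<^bsub>free_group A\<^esub> y = foldr lmult x y"
  and one_free_group: "\<one>\<^bsub>free_group A\<^esub> = []"
  by (simp_all add: free_group_def)

lemma reduced_append:
  "reduced_word (u @ v) \<longleftrightarrow>
     reduced_word u \<and> reduced_word v \<and> (u = [] \<or> v = [] \<or> hd v \<noteq> inv_letter (last u))"
  by (auto simp: reduced_word_def successively_append_iff)

lemma foldr_lmult_append: "reduced_word (u @ v) \<Longrightarrow> foldr lmult u v = u @ v"
proof (induction u)
  case (Cons x u)
  then show ?case using reduced_ConsD[of x "u @ v"] by (simp add: lmult_reduced)
qed simp

definition cls :: "'a letter list \<Rightarrow> 'a letter option" where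
  "cls x = (if x = [] then None else Some (hd x))"

text \<open>Translation by the inverse of a nonempty \<open>w\<close> sends everything outside the
  cone of \<open>w\<close> to words that begin with this letter: it is the class of the parent. At
  the root the value is the class of the identity.\<close>

definition out :: "'a letter list \<Rightarrow> 'a letter option" where
  "out w = (if w = [] then None else Some (inv_letter (last w)))"

lemma cls_simps [simp]: "cls [] = None" "cls (l # x) = Some l"
  by (simp_all add: cls_def)

lemma cls_None_iff [simp]: "cls x = None \<longleftrightarrow> x = []"
  by (simp add: cls_def)

lemma cls_SomeD: "cls x = Some l \<Longrightarrow> \<exists>y. x = l # y"
  by (cases x) auto

lemma out_simps [simp]: "out [] = None" "out (w @ [l]) = Some (inv_letter l)"
  by (simp_all add: out_def)

lemma append_in_free_group:
  "w @ x \<in> carrier (free_group A) \<longleftrightarrow>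
     w \<in> carrier (free_group A) \<and> x \<in> carrier (free_group A) \<and> (w = [] \<or> cls x \<noteq> out w)"
  by (auto simp: in_free_group reduced_append cls_def out_def)

lemma Nil_in_free_group [simp]: "[] \<in> carrier (free_group A)"
  by (simp add: in_free_group)

lemma Cons_in_free_group:
  "l # x \<in> carrier (free_group A) \<longleftrightarrow>
     l \<in> A \<times> UNIV \<and> x \<in> carrier (free_group A) \<and> cls x \<noteq> Some (inv_letter l)"
  using append_in_free_group[of "[l]" x A] by (auto simp: in_free_group out_def reduced_word_def)

lemma singleton_in_free_group [simp]: "[l] \<in> carrier (free_group A) \<longleftrightarrow> l \<in> A \<times> UNIV"
  by (simp add: Cons_in_free_group)

lemma inv_letter_in [simp]: "inv_letter l \<in> A \<times> UNIV \<longleftrightarrow> l \<in> A \<times> UNIV"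
  by (cases l) simp

lemma inv_singleton:
  assumes "l \<in> A \<times> UNIV"
  shows "inv\<^bsub>free_group A\<^esub> [l] = [inv_letter l]"
proof -
  interpret group "free_group A" by (rule group_free_group)
  show ?thesis
    using assms
    by (intro inv_equality) (auto simp: mult_free_group one_free_group)
qed

lemma mult_singleton_cases:
  assumes "x \<in> carrier (free_group A)" "l \<in> A \<times> UNIV"
  shows "x \<otimes>\<^bsub>free_group A\<^esub> [l] = x @ [l] \<or> x = (x \<otimes>\<^bsub>free_group A\<^esub> [l]) @ [inv_letter l]"
proof (cases "x = [] \<or> l \<noteq> inv_letter (last x)")
  case True
  then show ?thesis
    using assms by (auto simp: mult_free_group in_free_group reduced_append intro!: foldr_lmult_append)
       (auto simp: reduced_word_def)
next
  case False
  then have x: "x = butlast x @ [inv_letter l]"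
    by (metis append_butlast_last_id inv_letter_inv_letter)
  then have bx: "butlast x \<in> carrier (free_group A)"
    using assms append_in_free_group by metis
  have "x \<otimes>\<^bsub>free_group A\<^esub> [l] = foldr lmult (butlast x) (lmult (inv_letter l) [l])"
    by (subst x) (simp add: mult_free_group)
  also have "\<dots> = butlast x"
    using bx by (auto simp: in_free_group foldr_lmult_Nil)
  finally show ?thesis using x by simp
qed

text \<open>Right multiplication only disturbs a suffix of bounded length; this is what makes the
  Cayley graph look like a tree from far away.\<close>

lemma take_mult:
  assumes "x \<in> carrier (free_group A)" "t \<in> carrier (free_group A)" "length x \<ge> m + length t"
  shows "take m (x \<otimes>\<^bsub>free_group A\<^esub> t) = take m x"
  using assms
proof (induction t arbitrary: x)
  case Nil
  then show ?case
    by (auto simp: mult_free_group in_free_group foldr_lmult_Nil)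
next
  case (Cons l t)
  interpret group "free_group A" by (rule group_free_group)
  have l: "l \<in> A \<times> UNIV" and t: "t \<in> carrier (free_group A)" and "[l] \<otimes>\<^bsub>free_group A\<^esub> t = l # t"
    using Cons.prems(2) lmult_reduced[of l t] reduced_ConsD[of l t]
    by (auto simp: mult_free_group in_free_group)
  then have "x \<otimes>\<^bsub>free_group A\<^esub> (l # t) = (x \<otimes>\<^bsub>free_group A\<^esub> [l]) \<otimes>\<^bsub>free_group A\<^esub> t"
    using Cons.prems(1) m_assoc[of x "[l]" t] by simp
  moreover have "take m ((x \<otimes>\<^bsub>free_group A\<^esub> [l]) \<otimes>\<^bsub>free_group A\<^esub> t) = take m (x \<otimes>\<^bsub>free_group A\<^esub> [l])"
    if "length (x \<otimes>\<^bsub>free_group A\<^esub> [l]) \<ge> length x - 1"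
    using that Cons.prems l t by (intro Cons.IH) auto
  moreover have "length (x \<otimes>\<^bsub>free_group A\<^esub> [l]) \<ge> length x - 1 \<and>
      take m (x \<otimes>\<^bsub>free_group A\<^esub> [l]) = take m x"
  proof (rule disjE[OF mult_singleton_cases[OF Cons.prems(1) l]])
    assume "x \<otimes>\<^bsub>free_group A\<^esub> [l] = x @ [l]"
    then show ?thesis using Cons.prems(3) by simp
  next
    assume x: "x = (x \<otimes>\<^bsub>free_group A\<^esub> [l]) @ [inv_letter l]"
    then have len: "length x = Suc (length (x \<otimes>\<^bsub>free_group A\<^esub> [l]))"
      using length_append_singleton by metis
    then have "m \<le> length (x \<otimes>\<^bsub>free_group A\<^esub> [l])"
      using Cons.prems(3) by simp
    then have "take m ((x \<otimes>\<^bsub>free_group A\<^esub> [l]) @ [inv_letter l]) = take m (x \<otimes>\<^bsub>free_group A\<^esub> [l])"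
      by simp
    with x len have "take m x = take m (x \<otimes>\<^bsub>free_group A\<^esub> [l])" "length (x \<otimes>\<^bsub>free_group A\<^esub> [l]) \<ge> length x - 1"
      by simp_all
    then show ?thesis by simp
  qed
  ultimately show ?case by simp
qed

lemma inv_mult_snoc:
  assumes "x @ [l] \<in> carrier (free_group A)"
  shows "inv\<^bsub>free_group A\<^esub> x \<otimes>\<^bsub>free_group A\<^esub> (x @ [l]) = [l]"
proof -
  interpret group "free_group A" by (rule group_free_group)
  have "x @ [l] = x \<otimes>\<^bsub>free_group A\<^esub> [l]" "x \<in> carrier (free_group A)" "[l] \<in> carrier (free_group A)"
    using assms append_in_free_group[of x "[l]" A]
    by (auto simp: mult_free_group in_free_group foldr_lmult_append)
  then show ?thesis using inv_solve_left' by auto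
qed


section \<open>Positions on the circle\<close>

text \<open>\<open>w\<close> is the longest common prefix. One of the remainders may be empty, which
  is why first letters are compared as options.\<close>

lemma diverge:
  assumes "u \<noteq> v"
  obtains w x y where "u = w @ x" "v = w @ y" "cls x \<noteq> cls y"
proof -
  have "\<exists>w x y. u = w @ x \<and> v = w @ y \<and> cls x \<noteq> cls y"
    using assms
  proof (induction u arbitrary: v)
    case Nil
    then have "cls [] \<noteq> cls v" by (cases v) auto
    then show ?case by (metis append_Nil)
  next
    case (Cons l u)
    show ?case
    proof (cases "cls v = Some l")
      case True
      then obtain v' where v: "v = l # v'" using cls_SomeD by blast
      then obtain w x y where "u = w @ x" "v' = w @ y" "cls x \<noteq> cls y"
        using Cons by blast
      then show ?thesis using v by (metis append_Cons)
    next
      case False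
      then have "cls (l # u) \<noteq> cls v" by simp
      then show ?thesis by (metis append_Nil)
    qed
  qed
  then show ?thesis using that by blast
qed

section \<open>The cyclic order of the classes and its behaviour under translation\<close>

definition first_letters :: "'a set \<Rightarrow> 'a letter option set" where
  "first_letters A = insert None (Some ` (A \<times> UNIV))"

lemma in_first_letters [simp]:
  "None \<in> first_letters A" "Some l \<in> first_letters A \<longleftrightarrow> l \<in> A \<times> UNIV"
  by (auto simp: first_letters_def)

lemma cls_in: "x \<in> carrier (free_group A) \<Longrightarrow> cls x \<in> first_letters A"
  by (cases x) (auto simp: in_free_group)

lemma out_in: "w \<in> carrier (free_group A) \<Longrightarrow> out w \<in> first_letters A"
  by (cases w rule: rev_cases) (auto simp: in_free_group)

text \<open>The relation \<open>adj\<close> abstracts the edges of \<open>Cay(F\<^sub>n; {s\<^sup>\<plusminus>\<^sup>1})\<close>; \<open>idx\<close> numbers the classes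
  of \<open>\<sim>\<^sub>1\<close> along the cycle formed by the quotient.\<close>

locale cyclic_adjacency =
  fixes A :: "'a set" and adj :: "'a letter list \<Rightarrow> 'a letter list \<Rightarrow> bool"
    and idx :: "'a letter option \<Rightarrow> nat" and N :: nat
  assumes N3: "3 \<le> N"
    and idx_bij: "bij_betw idx (first_letters A) {..<N}"
    and adj_in: "adj x y \<Longrightarrow> x \<in> carrier (free_group A) \<and> y \<in> carrier (free_group A)"
    and adj_sym: "adj x y \<Longrightarrow> adj y x"
    and adj_lmult: "l \<in> A \<times> UNIV \<Longrightarrow> adj x y \<Longrightarrow> adj (lmult l x) (lmult l y)"
    and adj_cases: "adj x y \<Longrightarrow> cls x \<noteq> cls y \<Longrightarrow>
      idx (cls y) = Suc (idx (cls x)) mod N \<or> idx (cls x) = Suc (idx (cls y)) mod N"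
    and adj_ex: "c \<in> first_letters A \<Longrightarrow> \<exists>x y. adj x y \<and> cls x = c \<and> idx (cls y) = Suc (idx c) mod N"
    and adj_unique: "adj x y \<Longrightarrow> adj x' y' \<Longrightarrow> cls x = cls x' \<Longrightarrow>
      idx (cls y) = Suc (idx (cls x)) mod N \<Longrightarrow> idx (cls y') = Suc (idx (cls x')) mod N \<Longrightarrow>
      x = x' \<and> y = y'"
begin

abbreviation "W \<equiv> carrier (free_group A)"

definition nxt :: "'a letter list \<Rightarrow> 'a letter list \<Rightarrow> bool" where
  "nxt x y \<longleftrightarrow> adj x y \<and> idx (cls y) = Suc (idx (cls x)) mod N"

lemma idx_less: "c \<in> first_letters A \<Longrightarrow> idx c < N"
  using idx_bij by (metis bij_betwE lessThan_iff)

lemma idx_inj: "c \<in> first_letters A \<Longrightarrow> d \<in> first_letters A \<Longrightarrow> idx c = idx d \<longleftrightarrow> c = d"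
  using idx_bij by (meson bij_betw_imp_inj_on inj_onD)

lemma nxt_in: "nxt x y \<Longrightarrow> x \<in> W" "nxt x y \<Longrightarrow> y \<in> W"
  using adj_in nxt_def by blast+

text \<open>A cycle of length at least 3 has neither loops nor pairs of opposite steps; this makes
  the direction of an edge along the cycle unambiguous.\<close>

lemma Suc_mod_neq:
  assumes "i < N"
  shows "Suc i mod N \<noteq> i" "Suc (Suc i mod N) mod N \<noteq> i"
  using assms N3 by (auto simp: mod_Suc)

lemma nxt_cls_neq: "nxt x y \<Longrightarrow> cls x \<noteq> cls y"
  using Suc_mod_neq(1) idx_less[OF cls_in] nxt_in by (metis nxt_def)

lemma nxt_asym: "nxt x y \<Longrightarrow> \<not> nxt y x"
  using Suc_mod_neq(2) idx_less[OF cls_in] nxt_in by (metis nxt_def)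

lemma nxt_cases: "adj x y \<Longrightarrow> cls x \<noteq> cls y \<Longrightarrow> nxt x y \<or> nxt y x"
  using adj_cases adj_sym unfolding nxt_def by blast

text \<open>The quotient keeps parallel edges. That it is a cycle therefore means that consecutive
  classes are joined by a single s-edge, and the edge going forwards from a class is determined by
  the class.\<close>

lemma nxt_unique_left: "nxt x y \<Longrightarrow> nxt x' y' \<Longrightarrow> cls x = cls x' \<Longrightarrow> x = x' \<and> y = y'"
  using adj_unique unfolding nxt_def by blast

lemma nxt_unique_right:
  assumes "nxt x y" "nxt x' y'" "cls y = cls y'"
  shows "x = x' \<and> y = y'"
proof -
  have "idx (cls x) < N" "idx (cls x') < N"
    using assms nxt_in cls_in idx_less by metis+
  moreover have "Suc (idx (cls x)) mod N = Suc (idx (cls x')) mod N"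
    using assms nxt_def by metis
  ultimately have "idx (cls x) = idx (cls x')"
    by (auto simp: mod_Suc split: if_splits)
  then show ?thesis
    using assms nxt_in cls_in idx_inj nxt_unique_left by metis
qed

text \<open>The edge that enters the class of \<open>l\<close>, moved by the inverse of
  \<open>l\<close> to the other end of the tree edge, leaves the class of the parent forwards: both
  cyclic orders run in the same direction. This edge is unique, so the choice of \<open>x\<close>
  and \<open>y\<close> does not matter.\<close>

definition eps :: "'a letter \<Rightarrow> bool" where
  "eps l \<longleftrightarrow> (\<exists>x y. nxt x (l # y) \<and> nxt (inv_letter l # x) y)"

text \<open>Left multiplication by the inverse of \<open>l\<close> maps the cone of \<open>l\<close>
  onto the complement of the cone of \<open>inv_letter l\<close>, and its complement onto that cone.
  So an edge leaving the one cone turns into an edge leaving the other.\<close>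

lemma adj_shift:
  assumes "adj (l # x) y" "cls y \<noteq> Some l"
  shows "adj x (inv_letter l # y)" "cls x \<noteq> Some (inv_letter l)"
proof -
  have in_W: "l # x \<in> W" "y \<in> W"
    using adj_in[OF assms(1)] by auto
  then have l: "l \<in> A \<times> UNIV" by (simp add: Cons_in_free_group)
  have "lmult (inv_letter l) y = inv_letter l # y"
    using assms(2) by (cases y) auto
  moreover have "lmult (inv_letter l) (l # x) = x" by simp
  ultimately show "adj x (inv_letter l # y)"
    using adj_lmult[OF _ assms(1), of "inv_letter l"] l by (metis inv_letter_in)
  show "cls x \<noteq> Some (inv_letter l)"
    using in_W by (simp add: Cons_in_free_group)
qed

text \<open>A letter either preserves or reverses the cyclic order of the two edges at its class; so the
  translates of the cycle can be glued along these edges.\<close>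

lemma glue:
  assumes xy: "nxt x (l # y)" and zx: "nxt (l # y') z"
  shows "if eps l then nxt (inv_letter l # x) y \<and> nxt y' (inv_letter l # z)
    else nxt y (inv_letter l # x) \<and> nxt (inv_letter l # z) y'"
proof -
  have 1: "cls x \<noteq> Some l" "cls z \<noteq> Some l"
    using nxt_cls_neq[OF xy] nxt_cls_neq[OF zx] by auto
  have "adj (l # y) x" "adj (l # y') z"
    using xy zx adj_sym unfolding nxt_def by auto
  then have "nxt y (inv_letter l # x) \<or> nxt (inv_letter l # x) y"
    "nxt y' (inv_letter l # z) \<or> nxt (inv_letter l # z) y'"
    using 1 adj_shift nxt_cases by (metis cls_simps(2))+
  \<comment> \<open>After translation the two edges cannot both enter, nor both leave, the class of
    the parent: by uniqueness they would coincide, and one edge would both enter and leave the class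
    of \<open>l\<close>.\<close>
  moreover have "\<not> (nxt y (inv_letter l # x) \<and> nxt y' (inv_letter l # z))"
    using nxt_unique_right[of y "inv_letter l # x" y' "inv_letter l # z"] xy zx nxt_asym by auto
  moreover have "\<not> (nxt (inv_letter l # x) y \<and> nxt (inv_letter l # z) y')"
    using nxt_unique_left[of "inv_letter l # x" y "inv_letter l # z" y'] xy zx nxt_asym by auto
  moreover have "eps l \<longleftrightarrow> nxt (inv_letter l # x) y"
  proof
    assume "eps l"
    then obtain a b where "nxt a (l # b)" "nxt (inv_letter l # a) b" unfolding eps_def by blast
    with nxt_unique_right[OF xy this(1)] show "nxt (inv_letter l # x) y" by simp
  qed (use xy in \<open>auto simp: eps_def\<close>)
  ultimately show ?thesis by auto
qed

lemma nxt_ex_left: "c \<in> first_letters A \<Longrightarrow> \<exists>x y. nxt x y \<and> cls x = c"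
  using adj_ex unfolding nxt_def by metis

lemma nxt_ex_right:
  assumes "c \<in> first_letters A"
  shows "\<exists>x y. nxt x y \<and> cls y = c"
proof -
  have "(idx c + N - 1) mod N \<in> idx ` first_letters A"
    using idx_bij N3 by (simp add: bij_betw_def)
  then obtain d where d: "d \<in> first_letters A" "idx d = (idx c + N - 1) mod N" by force
  then obtain x y where xy: "nxt x y" "cls x = d" using nxt_ex_left by blast
  then have "idx (cls y) = Suc ((idx c + N - 1) mod N) mod N"
    using d nxt_def by simp
  also have "\<dots> = idx c"
    using N3 idx_less[OF assms] by (simp add: mod_Suc_eq)
  finally show ?thesis
    using xy idx_inj[OF cls_in assms] nxt_in by metis
qed

lemma glue_left:
  assumes "nxt (l # y) z"
  shows "if eps l then nxt y (inv_letter l # z) else nxt (inv_letter l # z) y"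
proof -
  have "Some l \<in> first_letters A" using nxt_in[OF assms] by (simp add: in_free_group)
  then obtain x y' where "nxt x y'" "cls y' = Some l" using nxt_ex_right by blast
  then show ?thesis using glue[OF _ assms] cls_SomeD by (metis (full_types))
qed

lemma glue_right:
  assumes "nxt x (l # y)"
  shows "if eps l then nxt (inv_letter l # x) y else nxt y (inv_letter l # x)"
proof -
  have "Some l \<in> first_letters A" using nxt_in[OF assms] by (simp add: in_free_group)
  then obtain y' z where "nxt y' z" "cls y' = Some l" using nxt_ex_left by blast
  then show ?thesis using glue[OF assms] cls_SomeD by (metis (full_types))
qed

section \<open>Coordinates at the vertices and positions on the circle\<close>

text \<open>The classes around the vertex \<open>w\<close> are numbered along the translated cycle so that the class
  containing the parent of \<open>w\<close> gets number 0; the root is its own parent. The cone of the child in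
  slot \<open>k\<close> occupies \<open>[k, k + 1/2]\<close> in the coordinate of \<open>w\<close>, which \<open>node w\<close> translates to a position on the
  circle \<open>\<real>/\<int>\<close>.\<close>

definition slot :: "'a letter list \<Rightarrow> 'a letter option \<Rightarrow> nat" where
  "slot w c = (idx c + N - idx (out w)) mod N"

text \<open>Below the root the coordinates in use form the interval from 1 to N - 1/2, of length N -
  3/2, which has to fit into half a slot: hence the factor 1 / (2 N - 3). Without \<open>eps\<close>
  it is traversed backwards. The last letter of the word is stripped first, since a coordinate of
  \<open>w @ [l]\<close> is translated into one of \<open>w\<close>; the root divides the circle
  into \<open>N\<close> slots.\<close>

primrec node_rev :: "'a letter list \<Rightarrow> real \<Rightarrow> real" where
  "node_rev [] \<mu> = \<mu> / N"
| "node_rev (l # r) \<mu> = node_rev r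
     (if eps l then slot (rev r) (Some l) + (\<mu> - 1) / (2 * real N - 3)
      else slot (rev r) (Some l) + 1 / 2 - (\<mu> - 1) / (2 * real N - 3))"

definition node :: "'a letter list \<Rightarrow> real \<Rightarrow> real" where
  "node w = node_rev (rev w)"

lemma node_Nil: "node [] \<mu> = \<mu> / N"
  by (simp add: node_def)

lemma node_snoc: "node (w @ [l]) \<mu> = node w
     (if eps l then slot w (Some l) + (\<mu> - 1) / (2 * real N - 3)
      else slot w (Some l) + 1 / 2 - (\<mu> - 1) / (2 * real N - 3))"
  by (simp add: node_def)

lemma N_pos: "real N > 0" "real N \<ge> 3" "2 * real N - 3 \<ge> 3"
  using N3 by auto

text \<open>Affinity is stated for convex combinations because points of an edge are given by the
  ratio in which they divide it.\<close>

lemma node_affine: "node w ((1 - t) * \<mu> + t * \<nu>) = (1 - t) * node w \<mu> + t * node w \<nu>"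
proof (induction w arbitrary: \<mu> \<nu> rule: rev_induct)
  case Nil
  then show ?case by (simp add: node_Nil add_divide_distrib)
next
  case (snoc l w)
  have "k + ((1 - t) * \<mu> + t * \<nu> - 1) / c = (1 - t) * (k + (\<mu> - 1) / c) + t * (k + (\<nu> - 1) / c)"
    "k + 1 / 2 - ((1 - t) * \<mu> + t * \<nu> - 1) / c =
      (1 - t) * (k + 1 / 2 - (\<mu> - 1) / c) + t * (k + 1 / 2 - (\<nu> - 1) / c)" if "c > 0" for k c :: real
    using that by (simp_all add: field_simps)
  moreover have "2 * real N - 3 > 0" using N_pos by simp
  ultimately show ?case
    unfolding node_snoc by (simp add: snoc[symmetric])
qed

text \<open>The root contracts by \<open>N\<close> and every further letter by 2 N - 3. This yields
  injectivity of \<open>node w\<close> and, as 2 N - 3 is at least 3, arcs that shrink to points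
  along a branch.\<close>

lemma node_diff: "\<bar>node w \<mu> - node w \<nu>\<bar> = \<bar>\<mu> - \<nu>\<bar> / (N * (2 * real N - 3) ^ length w)"
proof (induction w arbitrary: \<mu> \<nu> rule: rev_induct)
  case Nil
  then show ?case using N_pos by (simp add: node_Nil flip: diff_divide_distrib)
next
  case (snoc l w)
  have "\<bar>(k + (\<mu> - 1) / c) - (k + (\<nu> - 1) / c)\<bar> = \<bar>\<mu> - \<nu>\<bar> / c"
    "\<bar>(k + 1 / 2 - (\<mu> - 1) / c) - (k + 1 / 2 - (\<nu> - 1) / c)\<bar> = \<bar>\<mu> - \<nu>\<bar> / c" if "c > 0" for k c :: real
    using that by (auto simp: field_simps abs_if)
  moreover have "2 * real N - 3 > 0" using N_pos by simp
  ultimately show ?case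
    unfolding node_snoc by (simp add: snoc)
qed

lemma node_eq_iff: "node w \<mu> = node w \<nu> \<longleftrightarrow> \<mu> = \<nu>"
proof -
  have "node w \<mu> = node w \<nu> \<longleftrightarrow> \<bar>node w \<mu> - node w \<nu>\<bar> = 0" by simp
  also have "\<dots> \<longleftrightarrow> \<mu> = \<nu>"
    using N_pos unfolding node_diff by auto
  finally show ?thesis .
qed

lemma slot_less: "slot w c < N"
  using N3 by (simp add: slot_def)

lemma slot_eq:
  assumes "w \<in> W" "c \<in> first_letters A"
  shows "slot w c = (if idx c \<ge> idx (out w) then idx c - idx (out w) else idx c + N - idx (out w))"
proof (cases "idx c \<ge> idx (out w)")
  case True
  then have eq: "idx c + N - idx (out w) = idx c - idx (out w) + N" by simp
  have "slot w c = idx c - idx (out w)"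
    unfolding slot_def eq mod_add_self2
    by (intro mod_less less_imp_diff_less idx_less assms)
  then show ?thesis using True by simp
next
  case False
  then show ?thesis using idx_less[OF out_in[OF assms(1)]] by (simp add: slot_def)
qed

lemma slot_out [simp]: "w \<in> W \<Longrightarrow> slot w (out w) = 0"
  using idx_less[OF out_in] by (simp add: slot_def)

lemma slot_inj:
  assumes "w \<in> W" "c \<in> first_letters A" "d \<in> first_letters A"
  shows "slot w c = slot w d \<longleftrightarrow> c = d"
  using idx_less[OF out_in[OF assms(1)]] idx_less[OF assms(2)] idx_less[OF assms(3)] idx_inj[OF assms(2,3)]
  by (auto simp: slot_eq assms split: if_splits)

lemma slot_ge_1:
  assumes "w \<in> W" "c \<in> first_letters A" "c \<noteq> out w"
  shows "slot w c \<ge> 1"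
  using slot_inj[OF assms(1,2) out_in[OF assms(1)]] assms by simp

lemma slot_surj:
  assumes "w \<in> W" "k < N"
  obtains c where "c \<in> first_letters A" "slot w c = k"
proof -
  have "(k + idx (out w)) mod N \<in> idx ` first_letters A"
    using idx_bij N3 by (simp add: bij_betw_def)
  then obtain c where c: "c \<in> first_letters A" "idx c = (k + idx (out w)) mod N" by force
  have "slot w c = k"
    using idx_less[OF out_in[OF assms(1)]] assms idx_less[OF c(1)] c
    by (auto simp: slot_eq mod_if split: if_splits)
  with c that show ?thesis by blast
qed

lemma slot_nxt:
  assumes "w \<in> W" "nxt x y"
  shows "slot w (cls y) = Suc (slot w (cls x)) mod N"
proof -
  have "idx (cls x) < N" "idx (cls y) < N" "idx (out w) < N" "idx (cls y) = Suc (idx (cls x)) mod N"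
    using assms nxt_in cls_in idx_less out_in nxt_def by metis+
  then show ?thesis
    unfolding slot_eq[OF assms(1) cls_in[OF nxt_in(1)[OF assms(2)]]]
      slot_eq[OF assms(1) cls_in[OF nxt_in(2)[OF assms(2)]]]
    by (auto simp: mod_Suc)
qed

lemma child_in_W: "w \<in> W \<Longrightarrow> w @ [l] \<in> W \<longleftrightarrow> Some l \<in> first_letters A \<and> Some l \<noteq> out w"
  by (auto simp: append_in_free_group[of w "[l]"])

text \<open>Left end of what is occupied in slot \<open>k\<close>. The vertex itself occupies a
  single point of its slot, normally the left end; in the last slot it moves to N - 1/2. Thus both
  ends 1 and N - 1/2 of the coordinate interval are always occupied, as they must be where edges
  leave the cone.\<close>

definition lend :: "'a letter list \<Rightarrow> nat \<Rightarrow> real" where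
  "lend w k = (if k = slot w None \<and> k = N - 1 then N - 1 / 2 else k)"

definition rend :: "'a letter list \<Rightarrow> nat \<Rightarrow> real" where
  "rend w k = (if k = slot w None then lend w k else k + 1 / 2)"

definition angle :: "'a letter list \<Rightarrow> real" where
  "angle w = node w (lend w (slot w None))"

text \<open>Below the root, slot 0 stands for the parent and is cut off, as is the rest of the last
  slot. The root has the whole circle, half-open because the positions 0 and 1 coincide.\<close>

definition dom :: "'a letter list \<Rightarrow> real set" where
  "dom w = (if w = [] then {0..<N} else {1..N - 1 / 2})"

section \<open>Arcs of cones and how they nest\<close>

definition arc :: "'a letter list \<Rightarrow> real set" where
  "arc w = node w ` dom w"

definition seg :: "'a letter list \<Rightarrow> 'a letter \<Rightarrow> real set" where
  "seg w l = {slot w (Some l)..slot w (Some l) + 1 / 2}"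

lemma angle_Nil: "angle [] = 0"
  using N3 slot_out[of "[]"] by (simp add: angle_def node_Nil lend_def)

lemma arc_Nil: "arc [] = {0..<1}"
proof -
  have "y \<in> arc []" if "0 \<le> y" "y < 1" for y
  proof -
    have "y = node [] (y * N)" "y * N \<in> dom []"
      using that N_pos by (auto simp: node_Nil dom_def)
    then show ?thesis unfolding arc_def by blast
  qed
  then show ?thesis using N_pos by (auto simp: arc_def node_Nil dom_def)
qed

lemma affine_image_Icc:
  fixes g h :: "real \<Rightarrow> real"
  assumes "\<And>x. x \<in> {a..b} \<Longrightarrow> g x \<in> {c..d}" "\<And>y. y \<in> {c..d} \<Longrightarrow> h y \<in> {a..b} \<and> g (h y) = y"
  shows "g ` {a..b} = {c..d}"
  using assms by (metis (no_types, lifting) image_eqI subsetI subset_antisym image_subset_iff)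

text \<open>Reversing the orientation does not affect the image: both branches of the recursion
  carry the interval from 1 to N - 1/2 onto the same half slot.\<close>

lemma arc_snoc: "arc (w @ [l]) = node w ` seg w l"
proof -
  define c where "c = 2 * real N - 3"
  define k where "k = real (slot w (Some l))"
  have c: "c > 0" "real N - 1 / 2 = 1 + c / 2"
    using N_pos by (auto simp: c_def field_simps)
  have h: "0 \<le> y * c" "y * c \<le> c / 2" if "0 \<le> y" "y \<le> 1 / 2" for y
    using mult_right_mono[of y "1 / 2" c] that c by auto
  have "(\<lambda>\<mu>. k + (\<mu> - 1) / c) ` {1..1 + c / 2} = {k..k + 1 / 2}"
  proof (rule affine_image_Icc[where h = "\<lambda>\<mu>. (\<mu> - k) * c + 1"])
    show "(y - k) * c + 1 \<in> {1..1 + c / 2} \<and> k + ((y - k) * c + 1 - 1) / c = y"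
      if "y \<in> {k..k + 1 / 2}" for y
      using h[of "y - k"] that c by auto
  qed (use c in \<open>auto simp: divide_le_eq\<close>)
  moreover have "(\<lambda>\<mu>. k + 1 / 2 - (\<mu> - 1) / c) ` {1..1 + c / 2} = {k..k + 1 / 2}"
  proof (rule affine_image_Icc[where h = "\<lambda>\<mu>. (k + 1 / 2 - \<mu>) * c + 1"])
    show "(k + 1 / 2 - y) * c + 1 \<in> {1..1 + c / 2} \<and> k + 1 / 2 - ((k + 1 / 2 - y) * c + 1 - 1) / c = y"
      if "y \<in> {k..k + 1 / 2}" for y
      using h[of "k + 1 / 2 - y"] that c by auto
  qed (use c in \<open>auto simp: divide_le_eq\<close>)
  ultimately have "(\<lambda>\<mu>. if eps l then k + (\<mu> - 1) / c else k + 1 / 2 - (\<mu> - 1) / c) ` dom (w @ [l]) = seg w l"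
    unfolding dom_def seg_def c k_def[symmetric] by simp
  moreover have "arc (w @ [l]) = node w ` (\<lambda>\<mu>. if eps l then k + (\<mu> - 1) / c else k + 1 / 2 - (\<mu> - 1) / c) ` dom (w @ [l])"
    unfolding arc_def image_image node_snoc c_def k_def ..
  ultimately show ?thesis by simp
qed

lemma child_slot:
  assumes "w @ [l] \<in> W"
  shows "1 \<le> slot w (Some l)" "slot w (Some l) \<le> N - 1" "slot w (Some l) \<noteq> slot w None"
proof -
  have w: "w \<in> W" "Some l \<in> first_letters A" "Some l \<noteq> out w"
    using assms append_in_free_group child_in_W by blast+
  show "1 \<le> slot w (Some l)" using slot_ge_1 w by blast
  show "slot w (Some l) \<le> N - 1" using slot_less[of w "Some l"] by simp
  show "slot w (Some l) \<noteq> slot w None" using slot_inj[OF w(1,2), of None] by simp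
qed

lemma seg_subset_dom:
  assumes "w @ [l] \<in> W"
  shows "seg w l \<subseteq> dom w"
proof -
  have "real (slot w (Some l)) \<ge> 1" "real (slot w (Some l)) \<le> real N - 1"
    using child_slot[OF assms] N3 by linarith+
  then show ?thesis by (auto simp: dom_def seg_def)
qed

lemma arc_snoc_subset: "w @ [l] \<in> W \<Longrightarrow> arc (w @ [l]) \<subseteq> arc w"
  unfolding arc_snoc arc_def[of w] by (intro image_mono seg_subset_dom)

lemma arc_append_subset: "w @ x \<in> W \<Longrightarrow> arc (w @ x) \<subseteq> arc w"
proof (induction x rule: rev_induct)
  case (snoc l x)
  have "w @ x \<in> W" using snoc.prems append_in_free_group[of "w @ x" "[l]"] by simp
  then show ?case using snoc.IH arc_snoc_subset[of "w @ x" l] snoc.prems by simp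
qed simp

lemma seg_disjoint:
  assumes "w @ [l] \<in> W" "w @ [m] \<in> W" "l \<noteq> m"
  shows "seg w l \<inter> seg w m = {}"
proof -
  have "slot w (Some l) \<noteq> slot w (Some m)"
    using assms slot_inj child_in_W append_in_free_group by (metis option.inject)
  then have "real (slot w (Some l)) + 1 \<le> slot w (Some m) \<or> real (slot w (Some m)) + 1 \<le> slot w (Some l)"
    by linarith
  then show ?thesis by (auto simp: seg_def)
qed

lemma arc_siblings_disjoint:
  assumes "w @ l # x \<in> W" "w @ m # y \<in> W" "l \<noteq> m"
  shows "arc (w @ l # x) \<inter> arc (w @ m # y) = {}"
proof -
  have "w @ [l] \<in> W" "w @ [m] \<in> W"
    using assms append_in_free_group[of "w @ [_]"] by (metis append.assoc append_Cons append_Nil)+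
  moreover from this have "arc (w @ [l]) \<inter> arc (w @ [m]) = {}"
    using seg_disjoint[of w l m] assms(3) by (auto simp: arc_snoc node_eq_iff)
  moreover have "arc (w @ l # x) \<subseteq> arc (w @ [l])" "arc (w @ m # y) \<subseteq> arc (w @ [m])"
    using arc_append_subset[of "w @ [_]"] assms(1,2) by simp_all
  ultimately show ?thesis by blast
qed

text \<open>The part of the arc of \<open>w\<close> outside the arcs of its children: the position of \<open>w\<close> and the
  gaps between consecutive slots.\<close>

definition own :: "'a letter list \<Rightarrow> real set" where
  "own w = {\<mu> \<in> dom w. \<forall>l. w @ [l] \<in> W \<longrightarrow> \<mu> \<notin> seg w l}"

lemma own_child_disjoint:
  assumes "w @ l # x \<in> W"
  shows "node w ` own w \<inter> arc (w @ l # x) = {}"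
proof -
  have l: "w @ [l] \<in> W"
    using assms append_in_free_group[of "w @ [l]" x] by simp
  then have "node w ` own w \<inter> arc (w @ [l]) = {}"
    by (auto simp: arc_snoc own_def node_eq_iff simp del: split_paired_All)
  moreover have "arc (w @ l # x) \<subseteq> arc (w @ [l])"
    using arc_append_subset[of "w @ [l]" x] assms by simp
  ultimately show ?thesis by blast
qed

lemma own_subset_arc: "node w ` own w \<subseteq> arc w"
  by (auto simp: arc_def own_def)

text \<open>Split both words at their longest common prefix. Either \<open>u\<close> is this prefix,
  and what it owns avoids the arcs of its children, or the words pass through different children,
  whose arcs are disjoint.\<close>

lemma own_arc_disjoint:
  assumes "u \<in> W" "v \<in> W" "\<nexists>x. u = v @ x"
  shows "node u ` own u \<inter> arc v = {}"
proof -
  have "u \<noteq> v" using assms(3) by force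
  then obtain w x y where d: "u = w @ x" "v = w @ y" "cls x \<noteq> cls y"
    using diverge by blast
  then obtain m y' where y: "y = m # y'" using assms(3) by (cases y) auto
  show ?thesis
  proof (cases x)
    case Nil
    then show ?thesis using own_child_disjoint d y assms by simp
  next
    case (Cons l x')
    then have "arc u \<inter> arc v = {}"
      using arc_siblings_disjoint d y assms by simp
    then show ?thesis using own_subset_arc by blast
  qed
qed

lemma own_disjoint:
  assumes "u \<in> W" "v \<in> W" "u \<noteq> v"
  shows "node u ` own u \<inter> node v ` own v = {}"
proof (cases "\<exists>x. u = v @ x")
  case True
  then have "\<nexists>x. v = u @ x" using assms(3) by auto
  then show ?thesis using own_arc_disjoint[OF assms(2,1)] own_subset_arc[of u] by blast
next
  case False
  then show ?thesis using own_arc_disjoint[OF assms(1,2)] own_subset_arc[of v] by blast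
qed

text \<open>Gap \<open>k\<close> leads from slot \<open>k\<close> to the next one. Below the root,
  the two gaps next to slot 0 belong to edges that leave the cone, and these are assigned to an
  ancestor.\<close>

definition gaps :: "'a letter list \<Rightarrow> nat set" where
  "gaps w = (if w = [] then {0..<N} else {1..<N - 1})"

definition gap :: "'a letter list \<Rightarrow> nat \<Rightarrow> real set" where
  "gap w k = {rend w k<..<lend w (Suc k)}"

lemma slot_None_Nil [simp]: "slot [] None = 0"
  using slot_out[of "[]"] by simp

lemma lend_own:
  assumes "w \<in> W"
  shows "lend w (slot w None) \<in> own w"
proof -
  have *: "w \<noteq> [] \<Longrightarrow> slot w None \<ge> 1"
    using slot_ge_1[OF assms, of None] by (simp add: out_def)
  have "real (slot w None) + 1 \<le> N" using slot_less[of w None] by linarith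
  then have "lend w (slot w None) \<in> dom w"
    using * N3 by (auto simp: lend_def dom_def)
  moreover have "lend w (slot w None) \<notin> seg w l" if "w @ [l] \<in> W" for l
  proof -
    have "real (slot w (Some l)) + 1 \<le> slot w None \<or> real (slot w None) + 1 \<le> slot w (Some l)"
      using child_slot(3)[OF that] by linarith
    moreover have "real (slot w (Some l)) + 1 \<le> N"
      using slot_less[of w "Some l"] by linarith
    ultimately show ?thesis
      using N3 by (auto simp: lend_def seg_def of_nat_diff)
  qed
  ultimately show ?thesis by (auto simp: own_def)
qed

lemma angle_own: "w \<in> W \<Longrightarrow> angle w \<in> node w ` own w"
  using lend_own by (auto simp: angle_def)

lemma lend_ge: "lend w k \<ge> k" and rend_ge: "rend w k \<ge> k"
  using N3 by (auto simp: lend_def rend_def of_nat_diff)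

lemma lend_le: "k < N \<Longrightarrow> lend w k \<le> k + 1 / 2" and rend_le: "k < N \<Longrightarrow> rend w k \<le> k + 1 / 2"
  using N3 by (auto simp: lend_def rend_def of_nat_diff)

lemma rend_less_lend: "k < N \<Longrightarrow> rend w k < lend w (Suc k)"
  using lend_ge[of "Suc k" w] rend_le[of k w] by simp

lemma gap_disjoint:
  assumes "k < N" "k' < N" "\<mu> \<in> gap w k" "\<mu> \<in> gap w k'"
  shows "k = k'"
proof -
  have "False" if "i < N" "j < N" "\<mu> \<in> gap w i" "\<mu> \<in> gap w j" "i < j" for i j
  proof (cases "Suc i = j")
    case True
    have "lend w j \<le> rend w j" by (auto simp: lend_def rend_def)
    then show ?thesis using that True by (auto simp: gap_def)
  next
    case False
    then have "Suc (Suc i) \<le> j" using that by simp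
    then have "real i + 2 \<le> j" by linarith
    moreover have "lend w (Suc i) \<le> i + 2"
      using lend_le[of "Suc i" w] that by simp
    ultimately show ?thesis using that rend_ge[of j w] by (auto simp: gap_def)
  qed
  then show ?thesis using assms by (metis nat_neq_iff)
qed

lemma gap_own:
  assumes "w \<in> W" "k \<in> gaps w" "\<mu> \<in> gap w k"
  shows "\<mu> \<in> own w" "\<mu> \<noteq> lend w (slot w None)"
proof -
  have k: "k < N" using assms(2) by (auto simp: gaps_def split: if_splits)
  have "\<mu> \<in> dom w"
  proof (cases "w = []")
    case True
    have "lend w (Suc k) \<le> N"
      using k True by (auto simp: lend_def)
    then show ?thesis using assms(3) True rend_ge[of k w] by (auto simp: gap_def dom_def)
  next
    case False
    then have "Suc k < N" "1 \<le> k" using assms(2) by (auto simp: gaps_def)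
    then have "lend w (Suc k) \<le> N - 1 / 2" using lend_le[of "Suc k" w] by linarith
    then show ?thesis using assms(3) False rend_ge[of k w] \<open>1 \<le> k\<close> by (auto simp: gap_def dom_def)
  qed
  moreover have "\<mu> \<notin> seg w l" if "w @ [l] \<in> W" for l
  proof
    assume \<mu>: "\<mu> \<in> seg w l"
    let ?j = "slot w (Some l)"
    have j: "lend w ?j = ?j" "rend w ?j = ?j + 1 / 2" "?j < N"
      using child_slot(3)[OF that] slot_less by (auto simp: lend_def rend_def)
    consider "?j < k" | "?j = k" | "?j = Suc k" | "?j > Suc k" by linarith
    then show False
    proof cases
      case 1
      then have "real ?j + 1 \<le> k" by linarith
      then show ?thesis using \<mu> assms(3) rend_ge[of k w] by (auto simp: seg_def gap_def)
    next
      case 2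
      then show ?thesis using \<mu> assms(3) j by (auto simp: seg_def gap_def)
    next
      case 3
      then show ?thesis using \<mu> assms(3) j by (auto simp: seg_def gap_def)
    next
      case 4
      then have "real k + 2 \<le> ?j" by linarith
      then show ?thesis using \<mu> assms(3) lend_le[of "Suc k" w] 4 j(3) by (auto simp: seg_def gap_def)
    qed
  qed
  ultimately show "\<mu> \<in> own w" by (auto simp: own_def)
  show "\<mu> \<noteq> lend w (slot w None)"
  proof
    assume \<mu>: "\<mu> = lend w (slot w None)"
    let ?j = "slot w None"
    have j: "rend w ?j = lend w ?j" "?j < N" using slot_less by (auto simp: rend_def)
    consider "?j < k" | "?j = k" | "?j = Suc k" | "?j > Suc k" by linarith
    then show False
    proof cases
      case 1
      then have "real ?j + 1 \<le> k" by linarith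
      then show ?thesis using \<mu> assms(3) rend_ge[of k w] lend_le[OF j(2), of w] by (auto simp: gap_def)
    next
      case 4
      then have "real k + 2 \<le> ?j" by linarith
      then show ?thesis using \<mu> assms(3) lend_le[of "Suc k" w] lend_ge[of ?j w] 4 j(2) by (auto simp: gap_def)
    qed (use \<mu> assms(3) j in \<open>auto simp: gap_def\<close>)
  qed
qed

text \<open>The integer part of \<open>\<mu>\<close> selects the slot, and the position within this
  slot decides between the three cases.\<close>

lemma dom_cover:
  assumes "w \<in> W" "\<mu> \<in> dom w"
  shows "\<mu> = lend w (slot w None) \<or> (\<exists>k\<in>gaps w. \<mu> \<in> gap w k) \<or> (\<exists>l. w @ [l] \<in> W \<and> \<mu> \<in> seg w l)"
proof -
  define k where "k = nat \<lfloor>\<mu>\<rfloor>"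
  have "\<mu> \<ge> 0" "\<mu> < N" using assms(2) by (auto simp: dom_def split: if_splits)
  then have k: "real k \<le> \<mu>" "\<mu> < k + 1" "k < N" unfolding k_def by linarith+
  obtain c where c: "c \<in> first_letters A" "slot w c = k" using slot_surj assms(1) k(3) by blast
  have k1: "w \<noteq> [] \<Longrightarrow> k \<ge> 1"
  proof -
    assume "w \<noteq> []"
    then have "\<mu> \<ge> 1" using assms(2) by (simp add: dom_def)
    then show "k \<ge> 1" unfolding k_def by linarith
  qed
  have lS: "\<mu> < lend w (Suc k)" using lend_ge[of "Suc k" w] k(2) by simp
  have last: "w \<noteq> [] \<Longrightarrow> k = N - 1 \<Longrightarrow> \<mu> \<le> k + 1 / 2"
    using assms(2) N3 by (auto simp: dom_def of_nat_diff)
  show ?thesis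
  proof (cases c)
    case None
    then have kN: "k = slot w None" using c by simp
    consider "\<mu> = lend w k" | "\<mu> > lend w k" | "\<mu> < lend w k" by linarith
    then show ?thesis
    proof cases
      case 1 then show ?thesis using kN by simp
    next
      case 2
      then have "\<mu> \<in> gap w k" using lS kN by (auto simp: gap_def rend_def)
      moreover have "k \<in> gaps w"
      proof (cases "w = []")
        case False
        have "k \<noteq> N - 1"
          using 2 kN False last N3 by (auto simp: lend_def of_nat_diff)
        then show ?thesis using k1 k(3) False by (auto simp: gaps_def)
      qed (use k in \<open>auto simp: gaps_def\<close>)
      ultimately show ?thesis by blast
    next
      case 3
      then have kN1: "k = N - 1" "w \<noteq> []"
        using k(1) kN N3 by (auto simp: lend_def split: if_splits)
      \<comment> \<open>Only a vertex moved to the right end of the last slot leaves room on its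
        left; the gap that starts in slot N - 2 extends over this room.\<close>
      define j where "j = N - 2"
      have j: "Suc j = k" "j \<noteq> slot w None" "j \<ge> 1" "j < N - 1" using kN1 kN N3 by (auto simp: j_def)
      then have "rend w j < \<mu>" using k(1) by (auto simp: rend_def)
      then have "\<mu> \<in> gap w j" using 3 j by (simp add: gap_def)
      moreover have "j \<in> gaps w" using j kN1 by (simp add: gaps_def)
      ultimately show ?thesis by blast
    qed
  next
    case (Some l)
    show ?thesis
    proof (cases "\<mu> \<le> k + 1 / 2")
      case True
      have "c \<noteq> out w"
        using slot_out[OF assms(1)] k1 c Some by (cases "w = []") auto
      then have "w @ [l] \<in> W" using child_in_W assms(1) c(1) Some by blast
      moreover have "\<mu> \<in> seg w l" using True k(1) c(2) Some by (simp add: seg_def)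
      ultimately show ?thesis by blast
    next
      case False
      have "k \<noteq> slot w None" using slot_inj[OF assms(1) c(1), of None] c(2) Some by simp
      then have "\<mu> \<in> gap w k" using False lS by (simp add: gap_def rend_def)
      moreover have "k \<in> gaps w"
      proof (cases "w = []")
        case w: False
        then have "k \<noteq> N - 1" using last False by blast
        then show ?thesis using w k1 k(3) by (auto simp: gaps_def)
      qed (use k(3) in \<open>simp add: gaps_def\<close>)
      ultimately show ?thesis by blast
    qed
  qed
qed

section \<open>Edges of the cycle and its translates as gaps between slots\<close>

lemma rend_last: "rend w (N - 1) = N - 1 / 2"
  using N3 by (auto simp: rend_def lend_def of_nat_diff)

lemma lend_first: "lend w 1 = 1"
  using N3 by (auto simp: lend_def)

text \<open>Induction along \<open>x\<close>. Translated to the child, the edge joins slot 0, the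
  parent, with slot 1 or slot \<open>N - 1\<close>; by induction its end sits at 1 or N - 1/2 in the
  coordinate of the child, and \<open>eps\<close> tells which end of the child's half slot this is.
  In the base case the vertex occupies a single point, so left and right end agree.\<close>

lemma extreme:
  assumes "w @ x \<in> W" "w \<noteq> [] \<or> x \<noteq> []"
  shows "(nxt x y \<longrightarrow> angle (w @ x) = node w (rend w (slot w (cls x)))) \<and>
    (nxt y x \<longrightarrow> angle (w @ x) = node w (lend w (slot w (cls x))))"
  using assms
proof (induction x arbitrary: w y)
  case Nil
  then show ?case by (auto simp: angle_def rend_def)
next
  case (Cons l x)
  have w: "w @ [l] \<in> W" and lx: "l # x \<in> W"
    using Cons.prems append_in_free_group[of "w @ [l]" x] append_in_free_group[of w "l # x"] by auto
  let ?k = "slot w (Some l)"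
  have k: "lend w ?k = ?k" "rend w ?k = ?k + 1 / 2"
    using child_slot(3)[OF w] by (auto simp: lend_def rend_def)
  define c where "c = 2 * real N - 3"
  have c: "c > 0" "real N - 1 / 2 = 1 + c / 2" using N_pos by (auto simp: c_def field_simps)
  have ends: "node (w @ [l]) 1 = node w (if eps l then ?k else ?k + 1 / 2)"
    "node (w @ [l]) (N - 1 / 2) = node w (if eps l then ?k + 1 / 2 else ?k)"
    unfolding node_snoc c c_def[symmetric] using c by auto
  have IH: "nxt x z \<Longrightarrow> angle (w @ l # x) = node (w @ [l]) (rend (w @ [l]) (slot (w @ [l]) (cls x)))"
    "nxt z x \<Longrightarrow> angle (w @ l # x) = node (w @ [l]) (lend (w @ [l]) (slot (w @ [l]) (cls x)))" for z
    using Cons.IH[of "w @ [l]" z] Cons.prems by auto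
  have lo: "angle (w @ l # x) = node (w @ [l]) 1" if "nxt (inv_letter l # z) x" for z
  proof -
    have "slot (w @ [l]) (cls x) = Suc (slot (w @ [l]) (Some (inv_letter l))) mod N"
      using slot_nxt[OF w that] by simp
    also have "\<dots> = 1" using slot_out[OF w] N3 by simp
    finally show ?thesis using IH(2)[OF that] lend_first by simp
  qed
  have hi: "angle (w @ l # x) = node (w @ [l]) (N - 1 / 2)" if "nxt x (inv_letter l # z)" for z
  proof -
    have "Suc (slot (w @ [l]) (cls x)) mod N = slot (w @ [l]) (Some (inv_letter l))"
      using slot_nxt[OF w that] by simp
    also have "\<dots> = 0" using slot_out[OF w] by simp
    finally have "slot (w @ [l]) (cls x) = N - 1"
      using slot_less[of "w @ [l]" "cls x"] by (auto simp: mod_Suc split: if_splits)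
    then show ?thesis using IH(1)[OF that] rend_last by simp
  qed
  show ?case
    using glue_left[of l x y] glue_right[of y l x] lo[of y] hi[of y] ends k by (auto split: if_splits)
qed

text \<open>At the root the last gap ends at position 1, which is the position 0 of the identity.\<close>

lemma gap_edge:
  assumes "w @ x \<in> W" "w @ y \<in> W" "nxt x y"
  shows "slot w (cls x) \<in> gaps w" "angle (w @ x) = node w (rend w (slot w (cls x)))"
    "angle (w @ y) = node w (lend w (Suc (slot w (cls x)))) \<or>
      w @ y = [] \<and> node w (lend w (Suc (slot w (cls x)))) = 1"
proof -
  let ?k = "slot w (cls x)"
  have w: "w \<in> W" "x \<in> W" "y \<in> W" "w \<noteq> [] \<Longrightarrow> cls x \<noteq> out w" "w \<noteq> [] \<Longrightarrow> cls y \<noteq> out w"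
    using assms append_in_free_group by blast+
  have k: "slot w (cls y) = Suc ?k mod N" "?k < N"
    using slot_nxt[OF w(1) assms(3)] slot_less by auto
  \<comment> \<open>Below the root, slot 0 is the parent. As \<open>y\<close> points away from the
    parent, the edge does not wrap around past the last slot.\<close>
  have kN: "Suc ?k < N" if "w \<noteq> []"
  proof -
    have "slot w (cls y) \<ge> 1" using slot_ge_1 w cls_in that by blast
    then have "Suc ?k \<noteq> N" using k(1) by auto
    then show ?thesis using k(2) by simp
  qed
  show "?k \<in> gaps w"
  proof (cases "w = []")
    case False
    then have "?k \<ge> 1" using slot_ge_1 w cls_in by blast
    with kN[OF False] show ?thesis using False by (simp add: gaps_def)
  qed (use k(2) in \<open>simp add: gaps_def\<close>)
  show "angle (w @ x) = node w (rend w ?k)"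
  proof (cases "w = [] \<and> x = []")
    case True
    then show ?thesis using N3 by (simp add: angle_def rend_def)
  qed (use extreme[OF assms(1), of y] assms(3) in auto)
  show "angle (w @ y) = node w (lend w (Suc ?k)) \<or> w @ y = [] \<and> node w (lend w (Suc ?k)) = 1"
  proof (cases "w = [] \<and> y = []")
    case True
    then have "Suc ?k = N" using k by (auto simp: mod_Suc split: if_splits)
    then show ?thesis using True N3 by (simp add: node_Nil lend_def)
  next
    case False
    have "Suc ?k \<noteq> N"
    proof
      assume "Suc ?k = N"
      with kN have "w = []" by auto
      moreover have "slot w (cls y) = 0" using k \<open>Suc ?k = N\<close> by simp
      ultimately have "cls y = None"
        using slot_inj[of "[]" "cls y" None] cls_in[OF w(3)] by simp
      with False \<open>w = []\<close> show False by simp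
    qed
    then have "slot w (cls y) = Suc ?k" using k by (simp add: mod_Suc)
    then show ?thesis using extreme[OF assms(2), of x] assms(3) False by auto
  qed
qed

text \<open>Removing the longest common prefix is a translation; afterwards the ends lie in
  different classes, so the edge is one of the cycle.\<close>

lemma adj_gap:
  assumes "adj u v" "u \<noteq> v"
  obtains w x y where "w @ x \<in> W" "w @ y \<in> W" "nxt x y" "{u, v} = {w @ x, w @ y}"
proof -
  obtain w x y where d: "u = w @ x" "v = w @ y" "cls x \<noteq> cls y"
    using diverge assms(2) by blast
  have in_W: "w @ x \<in> W" "w @ y \<in> W" using adj_in[OF assms(1)] d by auto
  have "adj x y" using assms(1) in_W unfolding d(1,2)
  proof (induction w)
    case (Cons l w)
    have "adj (lmult (inv_letter l) ((l # w) @ x)) (lmult (inv_letter l) ((l # w) @ y))"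
      using Cons.prems by (intro adj_lmult) (auto simp: Cons_in_free_group)
    then show ?case using Cons by (simp add: Cons_in_free_group)
  qed simp
  then consider "nxt x y" | "nxt y x" using nxt_cases[OF _ d(3)] by blast
  then show ?thesis
  proof cases
    case 1 then show ?thesis using that[OF in_W] d by simp
  next
    case 2 then show ?thesis using that[OF in_W(2,1)] d by (simp add: insert_commute)
  qed
qed

lemma adj_append:
  assumes "adj x y" "w @ x \<in> W" "w @ y \<in> W"
  shows "adj (w @ x) (w @ y)"
  using assms
proof (induction w)
  case (Cons l w)
  have "adj (lmult l (w @ x)) (lmult l (w @ y))"
    using Cons by (intro adj_lmult) (auto simp: Cons_in_free_group)
  then show ?case
    using Cons.prems lmult_reduced[of l "w @ x"] lmult_reduced[of l "w @ y"] by (simp add: in_free_group)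
qed simp

text \<open>Conversely to \<open>gap_edge\<close>, no gap stays empty. Below the root, the slots at
  both ends of the gap differ from 0, so putting \<open>w\<close> in front of the ends of the edge
  causes no cancellation.\<close>

lemma gap_adj:
  assumes "w \<in> W" "k \<in> gaps w"
  obtains x y where "w @ x \<in> W" "w @ y \<in> W" "nxt x y" "slot w (cls x) = k"
proof -
  have kN: "k < N" using assms(2) by (auto simp: gaps_def split: if_splits)
  obtain c where c: "c \<in> first_letters A" "slot w c = k" using slot_surj assms(1) kN by blast
  obtain x y where xy: "nxt x y" "cls x = c" using nxt_ex_left c(1) by blast
  have "w @ x \<in> W \<and> w @ y \<in> W"
  proof (cases "w = []")
    case False
    then have k: "1 \<le> k" "Suc k < N" using assms(2) by (auto simp: gaps_def)
    have "slot w (cls y) = Suc k" using slot_nxt[OF assms(1) xy(1)] xy c k by simp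
    then have "cls x \<noteq> out w" "cls y \<noteq> out w" using slot_out[OF assms(1)] xy c k by auto
    then show ?thesis using append_in_free_group assms(1) nxt_in[OF xy(1)] by blast
  qed (use nxt_in[OF xy(1)] in simp)
  then show ?thesis using that xy c by blast
qed

lemma angle_inj:
  assumes "u \<in> W" "v \<in> W" "angle u = angle v"
  shows "u = v"
  using own_disjoint[of u v] angle_own assms by (metis disjoint_iff)

lemma angle_in_arc_iff:
  assumes "u \<in> W" "v \<in> W"
  shows "angle u \<in> arc v \<longleftrightarrow> (\<exists>x. u = v @ x)"
proof
  assume "\<exists>x. u = v @ x"
  then show "angle u \<in> arc v"
    using angle_own[OF assms(1)] own_subset_arc arc_append_subset assms(1) by blast
next
  assume "angle u \<in> arc v"
  then show "\<exists>x. u = v @ x"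
    using own_arc_disjoint[OF assms] angle_own[OF assms(1)] by blast
qed

lemma arc_range: "w \<in> W \<Longrightarrow> arc w \<subseteq> {0..<1}"
  using arc_append_subset[of "[]" w] arc_Nil by simp

lemma angle_range: "w \<in> W \<Longrightarrow> angle w \<in> {0..<1}"
  using arc_range angle_own own_subset_arc by blast

end


section \<open>Ends and compactness\<close>

lemma bary_swap: "bary u v t = bary v u (1 - t)"
  by (auto simp: bary_def)

lemma bary_pos: "bary u v t w > 0 \<Longrightarrow> w = u \<or> w = v"
  by (rule ccontr) (simp add: bary_def)

text \<open>An edge alters only a suffix of bounded length. Together with finiteness of the basis
  this makes the graph locally finite and gives it the same ends as the tree.\<close>

locale bounded_cyclic_adjacency = cyclic_adjacency +
  fixes L :: nat
  assumes finA: "finite A"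
    and L_pos: "L \<ge> 1"
    and adj_irrefl: "adj x y \<Longrightarrow> x \<noteq> y"
    and adj_take: "adj x y \<Longrightarrow> m + L \<le> length x \<Longrightarrow> take m y = take m x"
    and adj_length: "adj x y \<Longrightarrow> length y \<le> length x + L"
begin

definition X :: "'a letter list graph" where
  "X = \<lparr>verts = W, edges = {{x, y} | x y. adj x y} \<union> {{x, x @ [l]} | x l. x @ [l] \<in> W}\<rparr>"

lemma verts_X [simp]: "verts X = W"
  by (simp add: X_def)

lemma edge_cases:
  assumes "{u, v} \<in> edges X"
  shows "adj u v \<or> (\<exists>l. v = u @ [l]) \<and> v \<in> W \<or> (\<exists>l. u = v @ [l]) \<and> u \<in> W"
  using assms adj_sym by (auto simp: X_def doubleton_eq_iff)

lemma adj_edge: "adj x y \<Longrightarrow> {x, y} \<in> edges X"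
  by (auto simp: X_def)

lemma tree_edge: "x @ [l] \<in> W \<Longrightarrow> {x, x @ [l]} \<in> edges X"
  unfolding X_def graph.select_convs by blast

lemma edge_in:
  assumes "{u, v} \<in> edges X"
  shows "u \<in> W" "v \<in> W" "u \<noteq> v"
  using edge_cases[OF assms] adj_in adj_irrefl append_in_free_group[of _ "[_]"] by blast+

lemma edge_take:
  assumes "{u, v} \<in> edges X" "m + L \<le> length u"
  shows "take m v = take m u"
  using edge_cases[OF assms(1)] adj_take assms(2) L_pos by auto

lemma edge_length:
  assumes "{u, v} \<in> edges X"
  shows "length v \<le> length u + L"
  using edge_cases[OF assms(1)] adj_length L_pos by auto

definition ball :: "nat \<Rightarrow> 'a letter list set" where
  "ball m = {w \<in> W. length w \<le> m}"

lemma finite_ball: "finite (ball m)"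
proof -
  have "ball m \<subseteq> {w. set w \<subseteq> A \<times> UNIV \<and> length w \<le> m}"
    by (auto simp: ball_def in_free_group)
  then show ?thesis
    by (rule finite_subset) (simp add: finite_lists_length_le finA)
qed

lemma ball_subset: "ball m \<subseteq> W"
  by (auto simp: ball_def)

lemma finite_neighbours: "finite {v. {u, v} \<in> edges X}"
proof (rule finite_subset)
  show "{v. {u, v} \<in> edges X} \<subseteq> ball (length u + L)"
    using edge_in edge_length by (auto simp: ball_def)
qed (rule finite_ball)

lemma locally_finite_X: "locally_finite_graph X"
  unfolding locally_finite_graph_def
proof
  fix v assume "v \<in> verts X"
  have "{e \<in> edges X. v \<in> e} \<subseteq> (\<lambda>y. {v, y}) ` {y. {v, y} \<in> edges X}"
    by (auto simp: X_def insert_commute)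
  then show "finite {e \<in> edges X. v \<in> e}"
    by (rule finite_surj[OF finite_neighbours])
qed

lemma joined_edge:
  assumes "{u, v} \<in> edges X" "u \<notin> S" "v \<notin> S"
  shows "joined X S u v"
  using assms edge_in by (auto simp: joined_def)

lemma joined_cone:
  assumes "w @ x \<in> W" "\<And>y. w @ y \<notin> S"
  shows "joined X S w (w @ x)"
  using assms(1)
proof (induction x rule: rev_induct)
  case Nil
  then show ?case using assms(2)[of "[]"] by (simp add: joined_def)
next
  case (snoc l x)
  have "w @ x \<in> W" using snoc.prems append_in_free_group[of "w @ x" "[l]"] by simp
  moreover have "joined X S (w @ x) (w @ x @ [l])"
    using joined_edge[OF tree_edge[of "w @ x" l]] snoc.prems assms(2) by simp
  ultimately show ?case using joined_trans[OF snoc.IH] by simp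
qed

lemma connected_X: "connected_graph X"
proof -
  have "joined X {} [] x" if "x \<in> W" for x
    using joined_cone[of "[]" x "{}"] that by simp
  then have "joined X {} x y" if "x \<in> W" "y \<in> W" for x y
    using joined_trans[OF joined_sym, of X "{}" "[]" x y] that by simp
  moreover have "verts X \<noteq> {}" unfolding verts_X using Nil_in_free_group by blast
  ultimately show ?thesis unfolding connected_graph_def by simp
qed

text \<open>Edges between words longer than \<open>m + L\<close> keep the first \<open>m\<close>
  letters, so a path outside the ball cannot pass from one cone of level \<open>m\<close> to
  another.\<close>

lemma joined_take:
  assumes "joined X (ball (m + L)) x y"
  shows "take m x = take m y"
proof -
  have "(x, y) \<in> {(a, b). a \<in> W - ball (m + L) \<and> b \<in> W - ball (m + L) \<and> {a, b} \<in> edges X}\<^sup>*"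
    using assms by (simp add: joined_def)
  then show ?thesis
  proof induction
    case (step y z)
    then show ?case using edge_take[of y z m] by (auto simp: ball_def)
  qed simp
qed

section \<open>Ends as infinite reduced words, given by their finite prefixes\<close>

definition branch :: "(nat \<Rightarrow> 'a letter list) \<Rightarrow> bool" where
  "branch u \<longleftrightarrow> u 0 = [] \<and> (\<forall>m. u m \<in> W \<and> (\<exists>l. u (Suc m) = u m @ [l]))"

lemma branch_in: "branch u \<Longrightarrow> u m \<in> W"
  by (simp add: branch_def)

lemma branch_length: "branch u \<Longrightarrow> length (u m) = m"
proof (induction m)
  case (Suc m)
  then show ?case by (metis branch_def length_append_singleton)
qed (simp add: branch_def)

lemma branch_append: "branch u \<Longrightarrow> \<exists>x. u (m + k) = u m @ x"
proof (induction k)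
  case (Suc k)
  then show ?case by (metis add_Suc_right append.assoc branch_def)
qed simp

lemma branch_take: "branch u \<Longrightarrow> m \<le> i \<Longrightarrow> take m (u i) = u m"
  using branch_append[of u m "i - m"] branch_length[of u m] by auto

definition tends :: "(nat \<Rightarrow> 'a letter list) \<Rightarrow> (nat \<Rightarrow> 'a letter list) \<Rightarrow> bool" where
  "tends r u \<longleftrightarrow> (\<forall>m. \<exists>K. \<forall>i\<ge>K. take m (r i) = u m)"

lemma tendsD:
  assumes "tends r u"
  obtains K where "\<And>i. i \<ge> K \<Longrightarrow> take m (r i) = u m"
  using assms unfolding tends_def by blast

lemma tends_unique: "tends r u \<Longrightarrow> tends r v \<Longrightarrow> u = v"
proof
  fix m assume "tends r u" "tends r v"
  then obtain K K' where "\<And>i. i \<ge> K \<Longrightarrow> take m (r i) = u m" "\<And>i. i \<ge> K' \<Longrightarrow> take m (r i) = v m"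
    using tendsD by metis
  then show "u m = v m" by (metis max.cobounded1 max.cobounded2)
qed

lemma ray_in: "ray X r \<Longrightarrow> r i \<in> W"
  by (auto simp: ray_def)

lemma ray_leaves_ball:
  assumes "ray X r"
  obtains K where "\<And>i. i \<ge> K \<Longrightarrow> length (r i) > m"
proof -
  have "finite (r -` ball m)"
    using assms finite_ball by (auto simp: ray_def intro: finite_vimageI)
  then obtain K where "\<forall>i\<in>r -` ball m. i < K"
    using finite_nat_set_iff_bounded by blast
  then have "length (r i) > m" if "i \<ge> K" for i
    using that ray_in[OF assms, of i] by (force simp: ball_def)
  with that show ?thesis by blast
qed

text \<open>A ray may use s-edges and move back towards the root. It does leave every ball for good,
  however, and from then on none of its steps changes the prefix in question.\<close>

lemma ray_tends:
  assumes "ray X r"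
  obtains u where "branch u" "tends r u"
proof -
  have "\<exists>K. \<forall>i\<ge>K. length (r i) \<ge> m + L" for m
    using ray_leaves_ball[OF assms, of "m + L"] by (meson less_imp_le)
  then obtain K where K: "\<And>m i. i \<ge> K m \<Longrightarrow> length (r i) \<ge> m + L" by metis
  define u where "u m = take m (r (K m))" for m
  have u: "take m (r i) = u m" if "i \<ge> K m" for m i
    using that
  proof (induction i rule: dec_induct)
    case (step i)
    have "{r i, r (Suc i)} \<in> edges X" using assms by (simp add: ray_def)
    then show ?case using step edge_take K by metis
  qed (simp add: u_def)
  have "branch u"
    unfolding branch_def
  proof (intro conjI allI)
    fix m
    let ?i = "max (K m) (K (Suc m))"
    have i: "take m (r ?i) = u m" "take (Suc m) (r ?i) = u (Suc m)" "m < length (r ?i)"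
      using u[of m ?i] u[of "Suc m" ?i] K[of "Suc m" ?i] by auto
    then have "u (Suc m) = u m @ [r ?i ! m]"
      by (metis take_Suc_conv_app_nth)
    then show "\<exists>l. u (Suc m) = u m @ [l]" by blast
    show "u m \<in> W"
      using ray_in[OF assms, of ?i] append_in_free_group[of "u m" "drop m (r ?i)"] i(1)
      by (metis append_take_drop_id)
  qed (simp add: u_def)
  moreover have "tends r u" unfolding tends_def using u by blast
  ultimately show ?thesis using that by blast
qed

lemma branch_tends: "branch u \<Longrightarrow> tends u u"
  unfolding tends_def using branch_take by blast

lemma branch_ray:
  assumes "branch u"
  shows "ray X u"
  unfolding ray_def
proof (intro conjI allI)
  show "inj u" using branch_length[OF assms] by (metis injI)
  show "range u \<subseteq> verts X" using branch_in[OF assms] by auto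
  show "{u i, u (Suc i)} \<in> edges X" for i
    using tree_edge branch_in[OF assms, of "Suc i"] assms unfolding branch_def by metis
qed

lemma beyond_finite:
  assumes "finite S"
  obtains m where "\<And>w :: 'a letter list. length w \<ge> m \<Longrightarrow> w \<notin> S"
proof -
  have "finite (length ` S)" using assms by simp
  then obtain m where "\<forall>i\<in>length ` S. i < m"
    using finite_nat_set_iff_bounded by blast
  then show ?thesis using that[of m] by fastforce
qed

lemma joined_branch:
  assumes "branch u" "\<And>w. length w \<ge> m \<Longrightarrow> w \<notin> S" "x \<in> W" "take m x = u m" "y \<in> W" "take m y = u m"
  shows "joined X S x y"
proof -
  have "joined X S (u m) z" if "z \<in> W" "take m z = u m" for z
    using joined_cone[of "u m" "drop m z" S] that assms(2) branch_length[OF assms(1), of m]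
    by (metis append_take_drop_id le_add1 length_append)
  then show ?thesis
    using joined_trans[OF joined_sym, of X S "u m" x y] assms(3-6) by simp
qed

text \<open>Balls separate rays with different limits. Conversely, a finite set misses a whole cone
  around the common limit, and this cone is connected through tree edges.\<close>

lemma ray_equiv_iff:
  assumes "ray X r" "ray X r'" "tends r u" "tends r' u'" "branch u"
  shows "(r, r') \<in> ray_equiv X \<longleftrightarrow> u = u'"
proof
  assume eq: "(r, r') \<in> ray_equiv X"
  show "u = u'"
  proof
    fix m
    obtain K where K: "\<forall>i\<ge>K. \<forall>j\<ge>K. joined X (ball (m + L)) (r i) (r' j)"
      using ray_equivD(3)[OF eq finite_ball] ball_subset by (metis verts_X)
    obtain K1 where K1: "\<And>i. i \<ge> K1 \<Longrightarrow> take m (r i) = u m" using tendsD[OF assms(3)] by metis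
    obtain K2 where K2: "\<And>i. i \<ge> K2 \<Longrightarrow> take m (r' i) = u' m" using tendsD[OF assms(4)] by metis
    let ?i = "max K (max K1 K2)"
    have "joined X (ball (m + L)) (r ?i) (r' ?i)" using K by simp
    then show "u m = u' m" using joined_take K1[of ?i] K2[of ?i] by simp
  qed
next
  assume "u = u'"
  show "(r, r') \<in> ray_equiv X"
  proof (rule ray_equivI[OF assms(1,2)])
    fix S :: "'a letter list set" assume "finite S"
    then obtain m where m: "\<And>w :: 'a letter list. length w \<ge> m \<Longrightarrow> w \<notin> S" using beyond_finite by blast
    obtain K1 where K1: "\<And>i. i \<ge> K1 \<Longrightarrow> take m (r i) = u m" using tendsD[OF assms(3)] by metis
    obtain K2 where K2: "\<And>i. i \<ge> K2 \<Longrightarrow> take m (r' i) = u' m" using tendsD[OF assms(4)] by metis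
    have "joined X S (r i) (r' j)" if "i \<ge> max K1 K2" "j \<ge> max K1 K2" for i j
      using joined_branch[OF assms(5) m, where x = "r i" and y = "r' j"] K1[of i] K2[of j] that \<open>u = u'\<close>
        ray_in assms(1,2) by simp
    then show "\<exists>N. \<forall>i\<ge>N. \<forall>j\<ge>N. joined X S (r i) (r' j)" by blast
  qed
qed

text \<open>By \<open>ray_equiv_iff\<close> all rays of an end have the same limit, so the choice is
  immaterial.\<close>

definition dir :: "(nat \<Rightarrow> 'a letter list) set \<Rightarrow> nat \<Rightarrow> 'a letter list" where
  "dir \<omega> = (SOME u. branch u \<and> (\<exists>r\<in>\<omega>. tends r u))"

lemma end_ray:
  assumes "\<omega> \<in> graph_ends X" "r \<in> \<omega>"
  shows "ray X r" "\<omega> = ray_equiv X `` {r}"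
proof -
  obtain r0 where r0: "ray X r0" "\<omega> = ray_equiv X `` {r0}"
    using assms(1) by (auto simp: graph_ends_def elim: quotientE)
  then have "(r0, r) \<in> ray_equiv X" using assms(2) by simp
  then show "ray X r" "\<omega> = ray_equiv X `` {r}"
    using ray_equivD(2) equiv_class_eq[OF equiv_ray_equiv] r0 by blast+
qed

lemma end_ex_ray: "\<omega> \<in> graph_ends X \<Longrightarrow> \<exists>r. r \<in> \<omega>"
  unfolding graph_ends_def using in_quotient_imp_non_empty[OF equiv_ray_equiv] by blast

lemma dir:
  assumes "\<omega> \<in> graph_ends X"
  shows "branch (dir \<omega>)" "r \<in> \<omega> \<Longrightarrow> tends r (dir \<omega>)"
proof -
  obtain r0 where r0: "r0 \<in> \<omega>" using end_ex_ray assms by blast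
  then obtain u0 where "branch u0" "tends r0 u0"
    using ray_tends end_ray(1) assms by metis
  then have "\<exists>u. branch u \<and> (\<exists>r\<in>\<omega>. tends r u)" using r0 by blast
  then have d: "branch (dir \<omega>) \<and> (\<exists>r\<in>\<omega>. tends r (dir \<omega>))"
    unfolding dir_def by (rule someI_ex)
  then show "branch (dir \<omega>)" by blast
  obtain r' where r': "r' \<in> \<omega>" "tends r' (dir \<omega>)" using d by blast
  assume r: "r \<in> \<omega>"
  obtain u where u: "tends r u"
    using ray_tends end_ray(1)[OF assms r] by metis
  have "(r', r) \<in> ray_equiv X" using end_ray(2)[OF assms r'(1)] r by blast
  then show "tends r (dir \<omega>)"
    using ray_equiv_iff[OF end_ray(1)[OF assms r'(1)] end_ray(1)[OF assms r] r'(2) u] d u by simp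
qed

lemma dir_inj:
  assumes "\<omega> \<in> graph_ends X" "\<eta> \<in> graph_ends X" "dir \<omega> = dir \<eta>"
  shows "\<omega> = \<eta>"
proof -
  obtain r r' where r: "r \<in> \<omega>" "r' \<in> \<eta>" using end_ex_ray assms by metis
  have "(r, r') \<in> ray_equiv X"
    using ray_equiv_iff[OF end_ray(1)[OF assms(1) r(1)] end_ray(1)[OF assms(2) r(2)]
        dir(2)[OF assms(1) r(1)] dir(2)[OF assms(2) r(2)] dir(1)[OF assms(1)]] assms(3) by simp
  then have "ray_equiv X `` {r} = ray_equiv X `` {r'}"
    by (rule equiv_class_eq[OF equiv_ray_equiv])
  then show ?thesis
    using end_ray(2)[OF assms(1) r(1)] end_ray(2)[OF assms(2) r(2)] by simp
qed

lemma dir_surj: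
  assumes "branch u"
  obtains \<omega> where "\<omega> \<in> graph_ends X" "dir \<omega> = u"
proof -
  define \<omega> where "\<omega> = ray_equiv X `` {u}"
  have "\<omega> \<in> graph_ends X"
    using branch_ray[OF assms] by (auto simp: \<omega>_def graph_ends_def intro: quotientI)
  moreover have "u \<in> \<omega>"
    using equiv_class_self[OF equiv_ray_equiv] branch_ray[OF assms] by (simp add: \<omega>_def)
  ultimately show ?thesis
    using that dir(2) tends_unique branch_tends[OF assms] by metis
qed

lemma end_component_cone:
  assumes "\<omega> \<in> graph_ends X" "\<And>w. length w \<ge> m \<Longrightarrow> w \<notin> S" "v \<in> W" "take m v = dir \<omega> m"
  shows "v \<in> end_component X S \<omega>"
proof -
  obtain r where r: "r \<in> \<omega>" using end_ex_ray assms(1) by blast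
  obtain K where "\<And>i. i \<ge> K \<Longrightarrow> take m (r i) = dir \<omega> m"
    using dir(2)[OF assms(1) r] tendsD by metis
  then have "joined X S v (r i)" if "i \<ge> K" for i
    using joined_branch[OF dir(1)[OF assms(1)] assms(2)] assms that ray_in end_ray(1)[OF assms(1) r] by simp
  then show ?thesis using r unfolding end_component_def by blast
qed

text \<open>The counterpart of \<open>end_component_cone\<close>: the component lies inside a cone.
  The two bounds allow cones to replace the basic neighbourhoods of an end.\<close>

lemma end_component_ball:
  assumes "\<omega> \<in> graph_ends X" "v \<in> end_component X (ball (m + L)) \<omega>"
  shows "v \<in> W" "length v > m + L" "take m v = dir \<omega> m"
proof -
  obtain r K where r: "r \<in> \<omega>" "\<forall>i\<ge>K. joined X (ball (m + L)) v (r i)"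
    using assms(2) unfolding end_component_def by blast
  obtain K' where K': "\<And>i. i \<ge> K' \<Longrightarrow> take m (r i) = dir \<omega> m"
    using dir(2)[OF assms(1) r(1)] tendsD by metis
  have j: "joined X (ball (m + L)) v (r (max K K'))" using r(2) by simp
  then show "take m v = dir \<omega> m" using joined_take K'[of "max K K'"] by simp
  show "v \<in> W" "length v > m + L" using j by (auto simp: joined_def ball_def)
qed

lemma dir_prefix:
  assumes "\<eta> \<in> graph_ends X" "r \<in> \<eta>" "\<And>i. i \<ge> K \<Longrightarrow> take m (r i) = w"
  shows "dir \<eta> m = w"
proof -
  obtain K' where "\<And>i. i \<ge> K' \<Longrightarrow> take m (r i) = dir \<eta> m"
    using dir(2)[OF assms(1,2)] tendsD by metis
  then show ?thesis using assms(3) by (metis max.cobounded1 max.cobounded2)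
qed

section \<open>Compactness\<close>

definition cone_points :: "'a letter list \<Rightarrow> 'a letter list fpoint set" where
  "cone_points w = {Pt p | p. p \<in> complex_points X \<and> (\<exists>x. w @ x \<in> W \<and> p (w @ x) > 0)} \<union>
     {End \<eta> | \<eta>. \<eta> \<in> graph_ends X \<and> dir \<eta> (length w) = w}"

lemma cone_points_end_nbhd:
  assumes "\<omega> \<in> graph_ends X" "\<And>w. length w \<ge> m \<Longrightarrow> w \<notin> S"
  shows "cone_points (dir \<omega> m) \<subseteq> end_nbhd X S \<omega>"
proof
  have len: "length (dir \<omega> m) = m" using branch_length dir(1)[OF assms(1)] by blast
  fix z assume "z \<in> cone_points (dir \<omega> m)"
  then consider p x where "z = Pt p" "p \<in> complex_points X" "dir \<omega> m @ x \<in> W" "p (dir \<omega> m @ x) > 0"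
    | \<eta> where "z = End \<eta>" "\<eta> \<in> graph_ends X" "dir \<eta> m = dir \<omega> m"
    using len unfolding cone_points_def by auto
  then show "z \<in> end_nbhd X S \<omega>"
  proof cases
    case 1
    then have "dir \<omega> m @ x \<in> end_component X S \<omega>"
      using end_component_cone[OF assms] len by simp
    then show ?thesis using 1 unfolding end_nbhd_def by blast
  next
    case 2
    obtain r where r: "r \<in> \<eta>" using end_ex_ray 2 by blast
    obtain K where "\<And>i. i \<ge> K \<Longrightarrow> take m (r i) = dir \<eta> m"
      using dir(2)[OF 2(2) r] tendsD by metis
    then have "r i \<in> end_component X S \<omega>" if "i \<ge> K" for i
      using end_component_cone[OF assms] ray_in end_ray(1)[OF 2(2) r] that 2(3) by simp
    then show ?thesis using 2 r unfolding end_nbhd_def by blast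
  qed
qed

lemma continuous_edge:
  assumes "{u, v} \<in> edges X"
  shows "continuous_map (top_of_set {0..1}) (freudenthal X) (\<lambda>t. Pt (bary u v t))"
  unfolding continuous_map_def topspace_freudenthal openin_freudenthal
proof (intro conjI allI impI)
  have "Pt (bary u v t) \<in> fpoints X" if "t \<in> {0..1}" for t
    using assms that unfolding fpoints_def complex_points_def by blast
  then show "(\<lambda>t. Pt (bary u v t)) \<in> topspace (top_of_set {0..1}) \<rightarrow> fpoints X"
    by simp
  show "openin (top_of_set {0..1}) {t \<in> topspace (top_of_set {0..1}). Pt (bary u v t) \<in> U}"
    if "fopen X U" for U
    using fopenD(2)[OF that assms] by simp
qed

definition star_points :: "'a letter list \<Rightarrow> 'a letter list fpoint set" where
  "star_points w = insert (vertex_point w)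
     (\<Union>v\<in>{v. {w, v} \<in> edges X}. (\<lambda>t. Pt (bary w v t)) ` {0..1})"

lemma vertex_in: "w \<in> W \<Longrightarrow> vertex_point w \<in> fpoints X"
  by (auto simp: vertex_point_def fpoints_def complex_points_def)

lemma compact_star: "w \<in> W \<Longrightarrow> compactin (freudenthal X) (star_points w)"
proof -
  assume w: "w \<in> W"
  have "compactin (freudenthal X) (\<Union>v\<in>{v. {w, v} \<in> edges X}. (\<lambda>t. Pt (bary w v t)) ` {0..1})"
  proof (intro compactin_Union[OF finite_imageI[OF finite_neighbours]])
    fix S assume "S \<in> (\<lambda>v. (\<lambda>t. Pt (bary w v t)) ` {0..1}) ` {v. {w, v} \<in> edges X}"
    then obtain v where "{w, v} \<in> edges X" "S = (\<lambda>t. Pt (bary w v t)) ` {0..1}" by blast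
    then show "compactin (freudenthal X) S"
      using image_compactin[OF _ continuous_edge, of "{0..1}"] by (simp add: compactin_subtopology)
  qed
  moreover have "compactin (freudenthal X) {vertex_point w}"
    using vertex_in[OF w] by (simp add: topspace_freudenthal)
  ultimately show ?thesis
    unfolding star_points_def using compactin_Un by fastforce
qed

lemma cone_points_split:
  assumes "w \<in> W"
  shows "cone_points w \<subseteq> star_points w \<union> (\<Union>l\<in>{l \<in> A \<times> UNIV. w @ [l] \<in> W}. cone_points (w @ [l]))"
proof
  fix z assume "z \<in> cone_points w"
  then consider p x where "z = Pt p" "p \<in> complex_points X" "w @ x \<in> W" "p (w @ x) > 0"
    | \<eta> where "z = End \<eta>" "\<eta> \<in> graph_ends X" "dir \<eta> (length w) = w"
    unfolding cone_points_def by auto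
  then show "z \<in> star_points w \<union> (\<Union>l\<in>{l \<in> A \<times> UNIV. w @ [l] \<in> W}. cone_points (w @ [l]))"
  proof cases
    case 1
    show ?thesis
    proof (cases x)
      case Nil
      then have pw: "p w > 0" using 1 by simp
      consider "p = bary w w 0" | v t where "{w, v} \<in> edges X" "t \<in> {0..1}" "p = bary w v t"
      proof -
        from 1(2) consider v where "p = bary v v 0" | u v t where "{u, v} \<in> edges X" "t \<in> {0..1}" "p = bary u v t"
          unfolding complex_points_def by blast
        then show thesis
        proof cases
          case (1 v)
          then show ?thesis using pw that(1) by (cases "v = w") (auto simp: bary_def)
        next
          case (2 u v t)
          then consider "u = w" | "v = w" using pw bary_pos[of u v t w] by auto
          then show ?thesis
          proof cases
            case 1 then show ?thesis using 2 that(2) by blast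
          next
            case v: 2
            have "p = bary w u (1 - t)" using 2 v bary_swap by metis
            then show ?thesis using 2 v that(2)[of u "1 - t"] by (auto simp: insert_commute)
          qed
        qed
      qed
      then show ?thesis using 1(1) unfolding star_points_def vertex_point_def by cases auto
    next
      case (Cons l y)
      then have "w @ [l] \<in> W" "l \<in> A \<times> UNIV"
        using 1(3) append_in_free_group[of "w @ [l]" y] by (auto simp: in_free_group)
      then show ?thesis using 1 Cons unfolding cone_points_def by auto
    qed
  next
    case 2
    obtain l where l: "dir \<eta> (Suc (length w)) = w @ [l]"
      using dir(1)[OF 2(2)] 2(3) unfolding branch_def by metis
    then have "w @ [l] \<in> W" using branch_in dir(1)[OF 2(2)] by metis
    moreover from this have "l \<in> A \<times> UNIV" by (auto simp: in_free_group)
    ultimately show ?thesis using 2 l unfolding cone_points_def by auto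
  qed
qed

text \<open>Koenig's argument. A cone without finite subcover has a child of this kind, as closed
  stars are compact and the children are finitely many. The resulting branch defines an end, and a
  single member of the cover containing this end contains a whole cone of the branch.\<close>

lemma compact_X: "compact_space (freudenthal X)"
  unfolding compact_space_alt topspace_freudenthal
proof (intro allI impI)
  fix \<U> assume \<U>: "(\<forall>U\<in>\<U>. openin (freudenthal X) U) \<and> fpoints X \<subseteq> \<Union>\<U>"
  define covered where "covered Z \<longleftrightarrow> (\<exists>\<F>. finite \<F> \<and> \<F> \<subseteq> \<U> \<and> Z \<subseteq> \<Union>\<F>)" for Z
  have covered_UN: "covered (\<Union>i\<in>I. Z i)" if fin: "finite I" and cov: "\<forall>i\<in>I. covered (Z i)" for I :: "'a letter set" and Z
  proof -
    obtain \<F> where F: "\<forall>i\<in>I. finite (\<F> i) \<and> \<F> i \<subseteq> \<U> \<and> Z i \<subseteq> \<Union>(\<F> i)"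
      using bchoice[OF cov[unfolded covered_def]] by blast
    have "finite (\<Union>i\<in>I. \<F> i)" "(\<Union>i\<in>I. \<F> i) \<subseteq> \<U>"
      using F fin by auto
    moreover have "(\<Union>i\<in>I. Z i) \<subseteq> \<Union>(\<Union>i\<in>I. \<F> i)"
    proof (rule UN_least)
      fix i assume i: "i \<in> I"
      then have "Z i \<subseteq> \<Union>(\<F> i)" using F by simp
      with i show "Z i \<subseteq> \<Union>(\<Union>i\<in>I. \<F> i)" by fastforce
    qed
    ultimately have "finite (\<Union>i\<in>I. \<F> i) \<and> (\<Union>i\<in>I. \<F> i) \<subseteq> \<U> \<and> (\<Union>i\<in>I. Z i) \<subseteq> \<Union>(\<Union>i\<in>I. \<F> i)"
      by blast
    then show ?thesis unfolding covered_def by (rule exI)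
  qed
  have covered_Un: "covered (Y \<union> Z)" if "covered Y" "covered Z" for Y Z
  proof -
    obtain \<F> \<G> where F: "finite \<F>" "\<F> \<subseteq> \<U>" "Y \<subseteq> \<Union>\<F>" "finite \<G>" "\<G> \<subseteq> \<U>" "Z \<subseteq> \<Union>\<G>"
      using \<open>covered Y\<close>[unfolded covered_def] \<open>covered Z\<close>[unfolded covered_def] by (elim exE conjE)
    have "Y \<union> Z \<subseteq> \<Union>(\<F> \<union> \<G>)"
      unfolding Union_Un_distrib using F(3,6) by (rule Un_mono)
    moreover have "finite (\<F> \<union> \<G>)" "\<F> \<union> \<G> \<subseteq> \<U>" using F by simp_all
    ultimately show ?thesis
      unfolding covered_def by (intro exI[of _ "\<F> \<union> \<G>"] conjI)
  qed
  have covered_subset: "covered Y" if "Y \<subseteq> Z" "covered Z" for Y Z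
  proof -
    obtain \<F> where F: "finite \<F>" "\<F> \<subseteq> \<U>" "Z \<subseteq> \<Union>\<F>"
      using \<open>covered Z\<close>[unfolded covered_def] by (elim exE conjE)
    show ?thesis
      unfolding covered_def by (intro exI[of _ \<F>] conjI F(1,2) subset_trans[OF \<open>Y \<subseteq> Z\<close> F(3)])
  qed
  have star: "covered (star_points w)" if "w \<in> W" for w
  proof -
    have K: "compactin (freudenthal X) (star_points w)" using compact_star that by blast
    then have "star_points w \<subseteq> \<Union>\<U>"
      using \<U> compactin_subset_topspace topspace_freudenthal by fastforce
    then show ?thesis using compactinD[OF K, of \<U>] \<U> unfolding covered_def by blast
  qed
  have step: "\<exists>w'. (w' \<in> W \<and> \<not> covered (cone_points w')) \<and> (\<exists>l. w' = w @ [l])"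
    if "w \<in> W \<and> \<not> covered (cone_points w)" for w
  proof (rule ccontr)
    assume "\<not> ?thesis"
    then have "covered (cone_points (w @ [l]))" if "w @ [l] \<in> W" for l
      using that by blast
    moreover have "finite {l \<in> A \<times> UNIV. w @ [l] \<in> W}" using finA by simp
    ultimately have "covered (\<Union>l\<in>{l \<in> A \<times> UNIV. w @ [l] \<in> W}. cone_points (w @ [l]))"
      by (intro covered_UN) simp_all
    then have "covered (cone_points w)"
      using that by (intro covered_subset[OF cone_points_split covered_Un[OF star]]) simp_all
    then show False using that by blast
  qed
  have "covered (cone_points [])"
  proof (rule ccontr)
    assume "\<not> covered (cone_points [])"
    then have start: "[] \<in> W \<and> \<not> covered (cone_points [])" by simp
    \<comment> \<open>The clause for index 0 forces the sequence to start at the root, as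
      \<open>branch\<close> demands.\<close>
    have "\<exists>u. \<forall>m. ((u m \<in> W \<and> \<not> covered (cone_points (u m))) \<and> (m = 0 \<longrightarrow> u m = [])) \<and>
        (\<exists>l. u (Suc m) = u m @ [l])"
    proof (rule dependent_nat_choice)
      show "\<exists>w'. ((w' \<in> W \<and> \<not> covered (cone_points w')) \<and> (Suc m = 0 \<longrightarrow> w' = [])) \<and> (\<exists>l. w' = w @ [l])"
        if "(w \<in> W \<and> \<not> covered (cone_points w)) \<and> (m = 0 \<longrightarrow> w = [])" for w and m :: nat
        using step[of w] that by simp
    qed (use start in blast)
    then obtain u where u: "\<And>m. u m \<in> W \<and> \<not> covered (cone_points (u m))" "u 0 = []"
        "\<And>m. \<exists>l. u (Suc m) = u m @ [l]"
      by metis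
    then have "branch u" unfolding branch_def by blast
    then obtain \<omega> where \<omega>: "\<omega> \<in> graph_ends X" "dir \<omega> = u" using dir_surj by blast
    then have "End \<omega> \<in> fpoints X" by (simp add: fpoints_def)
    then obtain U where U: "U \<in> \<U>" "End \<omega> \<in> U" using \<U> by blast
    then obtain S where S: "finite S" "end_nbhd X S \<omega> \<subseteq> U"
      using \<U> fopenD(3)[of X U \<omega>] openin_freudenthal by blast
    obtain m where "\<And>w :: 'a letter list. length w \<ge> m \<Longrightarrow> w \<notin> S" using beyond_finite S(1) by blast
    then have "cone_points (u m) \<subseteq> U" using cone_points_end_nbhd[OF \<omega>(1)] \<omega>(2) S(2) by blast
    then have "covered (cone_points (u m))"
      unfolding covered_def using U(1) by (intro exI[of _ "{U}"]) auto
    then show False using u(1) by blast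
  qed
  moreover have "fpoints X \<subseteq> cone_points []"
  proof
    fix z assume z: "z \<in> fpoints X"
    show "z \<in> cone_points []"
    proof (cases z)
      case (End \<eta>)
      then have "\<eta> \<in> graph_ends X" using z by (auto simp: fpoints_def)
      then show ?thesis using dir(1) End by (auto simp: cone_points_def branch_def)
    next
      case (Pt p)
      then have p: "p \<in> complex_points X" using z by (auto simp: fpoints_def)
      then consider v where "v \<in> W" "p = bary v v 0" | u v t where "{u, v} \<in> edges X" "t \<in> {0..1}" "p = bary u v t"
        unfolding complex_points_def by auto
      then have "\<exists>x. x \<in> W \<and> p x > 0"
      proof cases
        case (1 v)
        then show ?thesis by (auto simp: bary_def)
      next
        case (2 u v t)
        then have "u \<in> W" "v \<in> W" "u \<noteq> v" using edge_in by blast+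
        then have "if t < 1 then p u > 0 else p v > 0" using 2 by (auto simp: bary_def)
        then show ?thesis using \<open>u \<in> W\<close> \<open>v \<in> W\<close> by (auto split: if_splits)
      qed
      then show ?thesis using p Pt by (auto simp: cone_points_def)
    qed
  qed
  ultimately have "covered (fpoints X)" using covered_subset by blast
  then show "\<exists>\<F>. finite \<F> \<and> \<F> \<subseteq> \<U> \<and> fpoints X \<subseteq> \<Union>\<F>" unfolding covered_def .
qed

end


section \<open>Chords and arcs of the unit circle\<close>

definition circ :: "real \<Rightarrow> complex" where
  "circ y = cis (2 * pi * y)"

lemma norm_circ [simp]: "norm (circ y) = 1"
  by (simp add: circ_def)

lemma circ_0 [simp]: "circ 0 = 1" and circ_1 [simp]: "circ 1 = 1"
  by (simp_all add: circ_def)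

lemma continuous_circ: "continuous_on S circ"
  unfolding circ_def by (intro continuous_intros)

lemma circ_inj:
  assumes "x \<in> {0..<1}" "y \<in> {0..<1}" "circ x = circ y"
  shows "x = y"
proof -
  have "sin (2 * pi * x) = sin (2 * pi * y) \<and> cos (2 * pi * x) = cos (2 * pi * y)"
    using assms(3) by (simp add: circ_def complex_eq_iff)
  then obtain n :: int where "2 * pi * x = 2 * pi * y + 2 * pi * n"
    using sin_cos_eq_iff[of "2 * pi * x" "2 * pi * y"] by auto
  then have "2 * pi * x = 2 * pi * (y + n)" by (simp add: algebra_simps)
  then have n: "x = y + n" by simp
  then have "\<bar>real_of_int n\<bar> < 1" using assms by auto
  then show ?thesis using n by simp
qed

lemma circ_surj:
  assumes "norm z = 1"
  obtains y where "y \<in> {0..<1}" "z = circ y"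
proof -
  define y where "y = Arg z / (2 * pi)"
  have "z = cis (2 * pi * y)"
    using assms cis_Arg[of z] norm_zero[where 'a = complex] by (cases "z = 0") (simp_all add: y_def sgn_div_norm)
  also have "\<dots> = cis (2 * pi * frac y) * cis (2 * pi * of_int \<lfloor>y\<rfloor>)"
    by (simp add: cis_mult frac_def algebra_simps)
  also have "\<dots> = circ (frac y)"
    using cis_multiple_2pi[of "of_int \<lfloor>y\<rfloor>"] by (simp add: circ_def)
  finally show ?thesis using that[of "frac y"] frac_ge_0 frac_lt_1 by auto
qed

text \<open>Strict convexity of the disk in quantitative form: the squared norm falls below 1 by t
  (1 - t) times the squared length of the chord.\<close>

lemma norm_chord_less:
  fixes a b :: complex
  assumes "norm a = 1" "norm b = 1" "a \<noteq> b" "0 < t" "t < 1"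
  shows "norm ((1 - t) *\<^sub>R a + t *\<^sub>R b) < 1"
proof -
  have a: "a \<bullet> a = 1" and b: "b \<bullet> b = 1"
    using assms by (simp_all flip: power2_norm_eq_inner)
  have "(norm ((1 - t) *\<^sub>R a + t *\<^sub>R b))\<^sup>2 = 1 - t * (1 - t) * (norm (a - b))\<^sup>2"
    unfolding power2_norm_eq_inner
    by (simp add: inner_add_left inner_add_right inner_diff_left inner_diff_right a b inner_commute algebra_simps)
  also have "\<dots> < 1\<^sup>2" using assms by simp
  finally show ?thesis by (rule power_less_imp_less_base) simp
qed

text \<open>If the points agree and \<open>t\<close> is the smaller parameter, then \<open>c\<close>
  divides the chord from \<open>a\<close> to \<open>b\<close> in the ratio given by t / t'. Either
  \<open>c\<close> equals \<open>b\<close>, or \<open>c\<close> lies inside the circle.\<close>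

lemma chords_common_end:
  fixes a b c :: complex
  assumes "norm a = 1" "norm b = 1" "norm c = 1" "a \<noteq> b" "a \<noteq> c" "b \<noteq> c" "0 < t" "0 < t'"
  shows "(1 - t) *\<^sub>R a + t *\<^sub>R b \<noteq> (1 - t') *\<^sub>R a + t' *\<^sub>R c"
proof -
  have "False" if 1: "norm b = 1" "norm c = 1" "a \<noteq> b" "b \<noteq> c" "0 < t" "0 < t'" "t \<le> t'"
    and eq: "(1 - t) *\<^sub>R a + t *\<^sub>R b = (1 - t') *\<^sub>R a + t' *\<^sub>R c" for b c t t'
  proof -
    define r where "r = t / t'"
    have r: "0 < r" "r \<le> 1" "t = r * t'" using 1 by (auto simp: r_def)
    have "t' *\<^sub>R c = t' *\<^sub>R ((1 - r) *\<^sub>R a + r *\<^sub>R b)"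
      using eq unfolding r(3) by (simp add: algebra_simps)
    then have c: "c = (1 - r) *\<^sub>R a + r *\<^sub>R b" using \<open>0 < t'\<close> by simp
    show False
    proof (cases "r = 1")
      case True
      then show ?thesis using c 1 by simp
    next
      case False
      then show ?thesis using norm_chord_less[of a b r] c 1 r assms(1) by simp
    qed
  qed
  note * = this
  show ?thesis
  proof
    assume "(1 - t) *\<^sub>R a + t *\<^sub>R b = (1 - t') *\<^sub>R a + t' *\<^sub>R c"
    then show False
      using *[of b c t t'] *[of c b t' t] assms by (cases "t \<le> t'") auto
  qed
qed

lemma cos_outside_less:
  assumes "0 \<le> u" "u < x" "x < 2 * pi - u"
  shows "cos x < cos u"
proof (cases "x \<le> pi")
  case True
  then show ?thesis using assms cos_monotone_0_pi by auto
next
  case False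
  have "cos x = cos (2 * pi - x)" by (simp add: cos_diff)
  also have "\<dots> < cos u" using assms False by (intro cos_monotone_0_pi) auto
  finally show ?thesis .
qed

text \<open>The line through the end points of an arc separates the arc from its complement.\<close>

lemma chords_separated:
  assumes "0 \<le> \<alpha>" "\<alpha> \<le> \<beta>" "\<beta> < 1"
    and "a \<in> {\<alpha>..\<beta>}" "b \<in> {\<alpha>..\<beta>}" "c \<in> {0..<1} - {\<alpha>..\<beta>}" "d \<in> {0..<1} - {\<alpha>..\<beta>}"
    and "t \<in> {0..1}" "t' \<in> {0..1}"
  shows "(1 - t) *\<^sub>R circ a + t *\<^sub>R circ b \<noteq> (1 - t') *\<^sub>R circ c + t' *\<^sub>R circ d"
proof -
  \<comment> \<open>The normal of the separating line points to the midpoint \<open>m\<close> of the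
    arc, and the line has level \<open>cos (2 * pi * h)\<close> for half the length \<open>h\<close>
    of the arc.\<close>
  define m h where "m = (\<alpha> + \<beta>) / 2" and "h = (\<beta> - \<alpha>) / 2"
  have h: "0 \<le> h" "h < 1 / 2" using assms by (auto simp: h_def)
  have inner: "circ y \<bullet> circ m = cos (2 * pi * \<bar>y - m\<bar>)" for y
  proof -
    have "circ y \<bullet> circ m = cos (2 * pi * y - 2 * pi * m)"
      by (simp add: circ_def inner_complex_def cos_diff)
    also have "\<dots> = cos (2 * pi * (y - m))" by (simp add: algebra_simps)
    also have "\<dots> = cos (2 * pi * \<bar>y - m\<bar>)"
    proof (cases "y \<ge> m")
      case False
      then have "2 * pi * \<bar>y - m\<bar> = - (2 * pi * (y - m))" by (simp add: algebra_simps)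
      then show ?thesis by (simp only: cos_minus)
    qed simp
    finally show ?thesis .
  qed
  have inside: "circ y \<bullet> circ m \<ge> cos (2 * pi * h)" if "y \<in> {\<alpha>..\<beta>}" for y
  proof -
    have "\<bar>y - m\<bar> \<le> h" using that unfolding m_def h_def by (auto simp: abs_if field_simps)
    then have "2 * pi * \<bar>y - m\<bar> \<le> 2 * pi * h" by simp
    moreover have "2 * pi * h \<le> pi" using h by simp
    ultimately show ?thesis unfolding inner by (intro cos_monotone_0_pi_le) auto
  qed
  have outside: "circ y \<bullet> circ m < cos (2 * pi * h)" if "y \<in> {0..<1} - {\<alpha>..\<beta>}" for y
  proof -
    \<comment> \<open>The second bound handles the way round through position 0: in that direction,
      too, the point is farther than \<open>h\<close> from the midpoint.\<close>
    have "h < \<bar>y - m\<bar>" "\<bar>y - m\<bar> < 1 - h"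
      using that assms(1-3) unfolding m_def h_def by (auto simp: abs_if field_simps)
    then have "2 * pi * h < 2 * pi * \<bar>y - m\<bar>" "2 * pi * \<bar>y - m\<bar> < 2 * pi * (1 - h)"
      by simp_all
    then show ?thesis
      unfolding inner using h by (intro cos_outside_less) (auto simp: algebra_simps)
  qed
  let ?c = "cos (2 * pi * h)"
  have "((1 - t) *\<^sub>R circ a + t *\<^sub>R circ b) \<bullet> circ m \<ge> ?c"
  proof -
    have "(1 - t) * ?c + t * ?c \<le> (1 - t) * (circ a \<bullet> circ m) + t * (circ b \<bullet> circ m)"
      using assms inside by (intro add_mono mult_left_mono) auto
    then show ?thesis by (simp add: inner_add_left algebra_simps)
  qed
  moreover have "((1 - t') *\<^sub>R circ c + t' *\<^sub>R circ d) \<bullet> circ m < ?c"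
  proof -
    have "(1 - t') * (circ c \<bullet> circ m) + t' * (circ d \<bullet> circ m) < ?c"
      using convex_bound_lt[OF outside[OF assms(6)] outside[OF assms(7)], of "1 - t'" t'] assms(9) by simp
    then show ?thesis by (simp add: inner_add_left)
  qed
  ultimately show ?thesis by force
qed


section \<open>The embedding into the disk\<close>

text \<open>A point of the complex is a bare coordinate function. Its support recovers the edge on
  which it lies and keeps the sums below finite.\<close>

definition supp :: "('v \<Rightarrow> real) \<Rightarrow> 'v set" where
  "supp p = {v. p v \<noteq> 0}"

lemma supp_bary:
  assumes "u \<noteq> v"
  shows "supp (bary u v t) = (if t = 0 then {u} else if t = 1 then {v} else {u, v})"
  using assms by (auto simp: supp_def bary_def)

lemma supp_vertex: "supp (bary v v t) = {v}"
  by (auto simp: supp_def bary_def)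

lemma sum_supp_bary:
  fixes g :: "'v \<Rightarrow> 'b::real_vector"
  assumes "u \<noteq> v"
  shows "(\<Sum>w\<in>supp (bary u v t). bary u v t w *\<^sub>R g w) = (1 - t) *\<^sub>R g u + t *\<^sub>R g v"
proof -
  have "(\<Sum>w\<in>supp (bary u v t). bary u v t w *\<^sub>R g w) = (\<Sum>w\<in>{u, v}. bary u v t w *\<^sub>R g w)"
    by (rule sum.mono_neutral_left) (auto simp: supp_def bary_def split: if_splits)
  then show ?thesis using assms by (simp add: bary_def)
qed

lemma sum_supp_vertex:
  fixes g :: "'v \<Rightarrow> 'b::real_vector"
  shows "(\<Sum>w\<in>supp (bary v v t). bary v v t w *\<^sub>R g w) = g v"
  unfolding supp_vertex by (simp add: bary_def)

context bounded_cyclic_adjacency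
begin

lemma angle_neq: "u \<in> W \<Longrightarrow> v \<in> W \<Longrightarrow> u \<noteq> v \<Longrightarrow> circ (angle u) \<noteq> circ (angle v)"
  using circ_inj angle_inj angle_range by blast

text \<open>The correction term lets the edge arriving at the identity from below end at position 1
  instead of 0.\<close>

definition phase :: "('a letter list \<Rightarrow> real) \<Rightarrow> real" where
  "phase p = (\<Sum>v\<in>supp p. p v *\<^sub>R angle v) + p [] * of_bool (\<exists>v\<in>supp p. angle v > 1 / 2)"

definition chordal :: "('a letter list \<Rightarrow> real) \<Rightarrow> complex" where
  "chordal p = (\<Sum>v\<in>supp p. p v *\<^sub>R circ (angle v))"

definition endpos :: "(nat \<Rightarrow> 'a letter list) \<Rightarrow> real" where
  "endpos u = (THE y. \<forall>m. y \<in> arc (u m))"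

text \<open>The support of a vertex is a singleton and hence no \<open>adj\<close> edge, so the
  chordal formula returns the position of the vertex. A tree edge that is also an \<open>adj\<close>
  edge is sent to the circle.\<close>

primrec disk :: "'a letter list fpoint \<Rightarrow> complex" where
  "disk (Pt p) = (if \<exists>x y. adj x y \<and> supp p = {x, y} then circ (phase p) else chordal p)"
| "disk (End \<omega>) = circ (endpos (dir \<omega>))"

declare disk.simps(1) [simp del]

lemma not_adj_singleton: "\<not> (\<exists>x y. adj x y \<and> {v} = {x, y})"
  using adj_irrefl by blast

lemma disk_vertex: "disk (Pt (bary v v t)) = circ (angle v)"
  unfolding disk.simps supp_vertex using not_adj_singleton[of v]
  by (simp only: if_False chordal_def sum_supp_vertex)

lemma disk_ends:
  assumes "u \<noteq> v"
  shows "disk (Pt (bary u v 0)) = circ (angle u)" "disk (Pt (bary u v 1)) = circ (angle v)"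
proof -
  have "bary u v 0 = bary u u 0" "bary u v 1 = bary v v 0" by (auto simp: bary_def)
  then show "disk (Pt (bary u v 0)) = circ (angle u)" "disk (Pt (bary u v 1)) = circ (angle v)"
    using disk_vertex by metis+
qed

lemma disk_tree:
  assumes "u \<noteq> v" "\<not> adj u v"
  shows "disk (Pt (bary u v t)) = (1 - t) *\<^sub>R circ (angle u) + t *\<^sub>R circ (angle v)"
proof -
  have "\<not> (\<exists>x y. adj x y \<and> supp (bary u v t) = {x, y})"
    using assms not_adj_singleton adj_sym by (auto simp: supp_bary doubleton_eq_iff)
  then show ?thesis
    unfolding disk.simps by (simp only: if_False chordal_def sum_supp_bary[OF assms(1)])
qed

lemma disk_adj:
  assumes "adj u v" "0 < t" "t < 1"
  shows "disk (Pt (bary u v t)) = circ ((1 - t) * angle u + t * angle v +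
    bary u v t [] * of_bool (angle u > 1 / 2 \<or> angle v > 1 / 2))"
proof -
  have ne: "u \<noteq> v" using assms(1) adj_irrefl by blast
  have s: "supp (bary u v t) = {u, v}" using assms ne by (simp add: supp_bary)
  then have "\<exists>x y. adj x y \<and> supp (bary u v t) = {x, y}" using assms(1) by blast
  then have "disk (Pt (bary u v t)) = circ (phase (bary u v t))" by (simp add: disk.simps(1))
  also have "phase (bary u v t) = (1 - t) * angle u + t * angle v +
    bary u v t [] * of_bool (angle u > 1 / 2 \<or> angle v > 1 / 2)"
    unfolding phase_def sum_supp_bary[OF ne] by (simp add: s)
  finally show ?thesis .
qed

lemma disk_gap:
  assumes "w @ x \<in> W" "w @ y \<in> W" "nxt x y" "t \<in> {0..1}"
  defines "k \<equiv> slot w (cls x)"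
  shows "disk (Pt (bary (w @ x) (w @ y) t)) = circ (node w ((1 - t) * rend w k + t * lend w (Suc k)))"
proof -
  note g = gap_edge[OF assms(1-3), folded k_def]
  have adj: "adj (w @ x) (w @ y)" using assms(1-3) adj_append nxt_def by blast
  then have ne: "w @ x \<noteq> w @ y" using adj_irrefl by blast
  consider "t = 0" | "t = 1" | "0 < t" "t < 1" using assms(4) by fastforce
  then show ?thesis
  proof cases
    case 1
    then show ?thesis using g(2) disk_ends[OF ne] by simp
  next
    case 2
    have "circ (angle (w @ y)) = circ (node w (lend w (Suc k)))"
      using g(3) by (auto simp: angle_Nil)
    then show ?thesis using 2 disk_ends[OF ne] by simp
  next
    case 3
    have slots: "slot w (cls y) = Suc k mod N" "k < N"
      using slot_nxt assms(1,3) append_in_free_group slot_less unfolding k_def by blast+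
    have "(1 - t) * angle (w @ x) + t * angle (w @ y) + bary (w @ x) (w @ y) t [] *
        of_bool (angle (w @ x) > 1 / 2 \<or> angle (w @ y) > 1 / 2) =
      (1 - t) * node w (rend w k) + t * node w (lend w (Suc k))"
    proof -
      consider "w = []" "x = []" | "w = []" "y = []" | "w @ x \<noteq> []" "w @ y \<noteq> []" by blast
      then show ?thesis
      proof cases
        case 1
        then have k: "k = 0" by (simp add: k_def)
        have y: "angle (w @ y) = node w (lend w (Suc k))" using g(3) ne 1 by auto
        \<comment> \<open>The neighbour of the identity in slot 1 sits at 1 / N, below the
          threshold, so the edge starts at position 0.\<close>
        have "real N \<ge> 3" using N3 by simp
        then have "angle y \<le> 1 / 2"
          using y 1 lend_first[of "[]"] by (simp add: k node_Nil)
        then show ?thesis using y g(2) 1 by (simp add: angle_Nil)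
      next
        case 2
        then have k: "Suc k = N" using slots by (auto simp: mod_Suc split: if_splits)
        have lend: "node w (lend w (Suc k)) = 1" using 2 k N3 by (simp add: node_Nil lend_def)
        \<comment> \<open>The neighbour in the last slot sits at (N - 1/2) / N, beyond the
          threshold, so the correction moves the identity from 0 to 1.\<close>
        have "angle (w @ x) > 1 / 2"
        proof -
          have "k = N - 1" using k by simp
          then have "angle (w @ x) = (real N - 1 / 2) / N" using g(2) 2 rend_last by (simp add: node_Nil)
          also have "\<dots> > 1 / 2" using N_pos by (simp add: field_simps)
          finally show ?thesis .
        qed
        then show ?thesis using lend g(2) 2 ne by (auto simp: angle_Nil bary_def)
      next
        case 3
        then show ?thesis using g by (auto simp: bary_def)
      qed
    qed
    then show ?thesis
      using disk_adj[OF adj 3] by (simp add: node_affine)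
  qed
qed

section \<open>Continuity of the map into the disk\<close>

lemma edge_disk_cases:
  assumes "{u, v} \<in> edges X"
  obtains (gap) w x y where "w @ x \<in> W" "w @ y \<in> W" "nxt x y" "u = w @ x" "v = w @ y"
  | (pag) w x y where "w @ x \<in> W" "w @ y \<in> W" "nxt x y" "v = w @ x" "u = w @ y"
  | (tree) "\<not> adj u v"
proof (cases "adj u v")
  case True
  obtain w x y where "w @ x \<in> W" "w @ y \<in> W" "nxt x y" "{u, v} = {w @ x, w @ y}"
    using adj_gap[OF True adj_irrefl[OF True]] by metis
  then show ?thesis using gap pag by (auto simp: doubleton_eq_iff)
qed (use tree in blast)

lemma continuous_node: "continuous_on S (node w)"
proof -
  have "continuous_on S (\<lambda>\<mu>. (1 - \<mu>) * node w 0 + \<mu> * node w 1)"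
    by (intro continuous_intros)
  then show ?thesis
    by (rule continuous_on_eq) (rule node_affine[of w _ 0 1, simplified, symmetric])
qed

lemma continuous_disk_edge:
  assumes "{u, v} \<in> edges X"
  shows "continuous_on {0..1} (\<lambda>t. disk (Pt (bary u v t)))"
proof -
  have via_gap: "continuous_on {0..1} (\<lambda>t. disk (Pt (bary (w @ x) (w @ y) t)))"
    if "w @ x \<in> W" "w @ y \<in> W" "nxt x y" for w x y
  proof -
    let ?k = "slot w (cls x)"
    have "continuous_on {0..1} (\<lambda>t. circ (node w ((1 - t) * rend w ?k + t * lend w (Suc ?k))))"
      by (intro continuous_on_compose2[OF continuous_circ[of UNIV]]
          continuous_on_compose2[OF continuous_node[of UNIV]] continuous_intros) auto
    then show ?thesis using disk_gap[OF that] continuous_on_cong by (metis (no_types, lifting))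
  qed
  show ?thesis using assms
  proof (cases rule: edge_disk_cases)
    case (gap w x y)
    then show ?thesis using via_gap by simp
  next
    case (pag w x y)
    have "continuous_on {0..1} (\<lambda>t. disk (Pt (bary (w @ x) (w @ y) (1 - t))))"
      by (rule continuous_on_compose2[OF via_gap[OF pag(1-3)]])
        (auto intro!: continuous_intros)
    then show ?thesis using pag bary_swap[of u v] by simp
  next
    case tree
    then show ?thesis
      using disk_tree[of u v] edge_in(3)[OF assms] by (simp add: continuous_intros)
  qed
qed

lemma arc_convex:
  assumes "w \<noteq> []" "y \<in> arc w" "y' \<in> arc w" "t \<in> {0..1}"
  shows "(1 - t) * y + t * y' \<in> arc w"
proof -
  obtain \<mu> \<nu> where \<mu>: "y = node w \<mu>" "y' = node w \<nu>" "\<mu> \<in> dom w" "\<nu> \<in> dom w"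
    using assms by (auto simp: arc_def)
  have "convex (dom w)" using assms(1) by (simp add: dom_def)
  then have "(1 - t) * \<mu> + t * \<nu> \<in> dom w"
    using convexD[of "dom w" \<mu> \<nu> "1 - t" t] \<mu> assms(4) by simp
  then show ?thesis unfolding \<mu> node_affine[symmetric] arc_def by blast
qed

lemma arc_interval:
  assumes "w \<noteq> []"
  obtains \<alpha> \<beta> where "arc w = {\<alpha>..\<beta>}"
proof -
  have "connected (arc w)" "compact (arc w)"
    using assms unfolding arc_def dom_def
    by (auto intro!: connected_continuous_image compact_continuous_image continuous_node)
  then show ?thesis using that connected_compact_interval_1 by metis
qed

text \<open>Coordinates differ by at most \<open>N\<close>, which cancels the contraction at the
  root; each letter contributes a factor of at most 1/3.\<close>

lemma arc_diameter:
  assumes "y \<in> arc w" "y' \<in> arc w"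
  shows "\<bar>y - y'\<bar> \<le> (1 / 3) ^ length w"
proof -
  obtain \<mu> \<nu> where \<mu>: "y = node w \<mu>" "y' = node w \<nu>" "\<mu> \<in> dom w" "\<nu> \<in> dom w"
    using assms by (auto simp: arc_def)
  then have "\<bar>\<mu> - \<nu>\<bar> \<le> N" by (auto simp: dom_def split: if_splits)
  then have "\<bar>y - y'\<bar> \<le> real N / (N * (2 * real N - 3) ^ length w)"
    unfolding \<mu> node_diff using N_pos by (intro divide_right_mono) auto
  also have "\<dots> = 1 / (2 * real N - 3) ^ length w" using N_pos by simp
  also have "\<dots> \<le> 1 / 3 ^ length w"
    using N_pos by (intro divide_left_mono power_mono mult_pos_pos) auto
  finally show ?thesis by (simp add: power_divide)
qed

lemma arc_ne: "w \<in> W \<Longrightarrow> angle w \<in> arc w"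
  using angle_own own_subset_arc by blast

lemma nested_unique:
  assumes "branch u" "\<And>m. y \<in> arc (u m)" "\<And>m. y' \<in> arc (u m)"
  shows "y = y'"
proof (rule ccontr)
  assume "y \<noteq> y'"
  then obtain m where "(1 / 3) ^ m < \<bar>y - y'\<bar>"
    using real_arch_pow_inv[of "\<bar>y - y'\<bar>" "1 / 3"] by auto
  then show False using arc_diameter[OF assms(2,3), of m] branch_length[OF assms(1)] by simp
qed

lemma endpos:
  assumes "branch u"
  shows "endpos u \<in> arc (u m)"
proof -
  \<comment> \<open>The intersection starts at level 1, since the arc of the root is half-open and
    not compact.\<close>
  have "\<Inter>(range (\<lambda>m. arc (u (Suc m)))) \<noteq> {}"
  proof (rule compact_nest)
    fix m n :: nat
    have "u (Suc m) \<noteq> []" using branch_length[OF assms, of "Suc m"] by auto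
    then show "compact (arc (u (Suc m)))"
      by (rule arc_interval) simp
    show "arc (u (Suc m)) \<noteq> {}" using arc_ne branch_in assms by blast
    assume "m \<le> n"
    then obtain x where "u (Suc n) = u (Suc m) @ x"
      using branch_append[OF assms, of "Suc m" "n - m"] by auto
    then show "arc (u (Suc n)) \<subseteq> arc (u (Suc m))"
      using arc_append_subset branch_in[OF assms, of "Suc n"] by metis
  qed
  then obtain y where y: "\<And>m. y \<in> arc (u (Suc m))" by auto
  have "y \<in> arc (u m)" for m
  proof (cases m)
    case 0
    have "y \<in> {0..<1}" using y[of 0] arc_range[OF branch_in[OF assms, of "Suc 0"]] by blast
    then show ?thesis using 0 arc_Nil assms by (simp add: branch_def)
  next
    case (Suc k)
    then show ?thesis using y by simp
  qed
  note all = this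
  have "endpos u = y"
    unfolding endpos_def
  proof (rule the_equality)
    show "y' = y" if "\<forall>m. y' \<in> arc (u m)" for y'
      using nested_unique[OF assms, of y' y] that all by simp
  qed (use all in simp)
  then show ?thesis using all by simp
qed

lemma endpos_range: "branch u \<Longrightarrow> endpos u \<in> {0..<1}"
  using endpos[of u 0] arc_Nil by (simp add: branch_def)

text \<open>Away from the identity the correction vanishes, and the image is a convex combination of
  the end positions, taken either before or after wrapping around the circle.\<close>

lemma disk_edge_form:
  assumes "{u, v} \<in> edges X" "u \<noteq> []" "v \<noteq> []" "t \<in> {0..1}"
  shows "disk (Pt (bary u v t)) = circ ((1 - t) * angle u + t * angle v) \<or>
    disk (Pt (bary u v t)) = (1 - t) *\<^sub>R circ (angle u) + t *\<^sub>R circ (angle v)"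
proof -
  have ne: "u \<noteq> v" using edge_in assms by blast
  consider "t = 0" | "t = 1" | "0 < t" "t < 1" using assms(4) by fastforce
  then show ?thesis
  proof cases
    case 3
    then show ?thesis
    proof (cases "adj u v")
      case True
      then show ?thesis using disk_adj[OF True 3] assms by (simp add: bary_def)
    qed (use disk_tree[OF ne] in simp)
  qed (use disk_ends[OF ne] in simp_all)
qed

text \<open>Near an end all vertices of a cone sit in one short arc. An s-edge between two of them
  stays in this arc because it is an interval, and a chord stays near the end because Euclidean
  balls are convex.\<close>

lemma continuous_disk: "continuous_map (freudenthal X) euclidean disk"
  unfolding continuous_map_def topspace_freudenthal openin_freudenthal
proof (intro conjI allI impI)
  fix U :: "complex set" assume "openin euclidean U"
  then have U: "open U" by simp
  show "fopen X {z \<in> fpoints X. disk z \<in> U}"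
  proof (rule fopenI)
    fix u v assume e: "{u, v} \<in> edges X"
    have "Pt (bary u v t) \<in> fpoints X" if "t \<in> {0..1}" for t
      using e that unfolding fpoints_def complex_points_def by blast
    then have "{t \<in> {0..1}. Pt (bary u v t) \<in> {z \<in> fpoints X. disk z \<in> U}} =
        {0..1} \<inter> (\<lambda>t. disk (Pt (bary u v t))) -` U" by blast
    then show "openin (top_of_set {0..1}) {t \<in> {0..1}. Pt (bary u v t) \<in> {z \<in> fpoints X. disk z \<in> U}}"
      using continuous_openin_preimage_gen[OF continuous_disk_edge[OF e] U] by simp
  next
    fix \<omega> assume "End \<omega> \<in> {z \<in> fpoints X. disk z \<in> U}"
    then have \<omega>: "\<omega> \<in> graph_ends X" "circ (endpos (dir \<omega>)) \<in> U"
      by (auto simp: fpoints_def)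
    define y where "y = endpos (dir \<omega>)"
    note br = dir(1)[OF \<omega>(1)]
    obtain \<epsilon> where \<epsilon>: "\<epsilon> > 0" "Elementary_Metric_Spaces.ball (circ y) \<epsilon> \<subseteq> U"
      using U \<omega>(2) open_contains_ball unfolding y_def by blast
    obtain \<delta> where \<delta>: "\<delta> > 0" "\<And>y'. \<bar>y' - y\<bar> < \<delta> \<Longrightarrow> dist (circ y') (circ y) < \<epsilon>"
      using continuous_circ[of UNIV] \<epsilon>(1) unfolding continuous_on_iff dist_real_def by (metis UNIV_I)
    obtain m0 where m0: "(1 / 3) ^ m0 < \<delta>" using real_arch_pow_inv[of \<delta> "1 / 3"] \<delta>(1) by auto
    \<comment> \<open>A nonempty prefix keeps the identity, and with it the correction term, out of
      the cone.\<close>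
    define m where "m = Suc m0"
    have "(1 / 3 :: real) ^ m \<le> (1 / 3) ^ m0" unfolding m_def by (intro power_decreasing) auto
    then have m: "(1 / 3) ^ m < \<delta>" using m0 by (rule order_le_less_trans)
    have len: "length (dir \<omega> m) = m" using branch_length br by blast
    have near: "circ y' \<in> Elementary_Metric_Spaces.ball (circ y) \<epsilon>" if "y' \<in> arc (dir \<omega> m)" for y'
      using arc_diameter[OF that endpos[OF br]] len m \<delta>(2)[of y'] by (auto simp: y_def dist_commute)
    have pref: "angle v \<in> arc (dir \<omega> m)" "v \<noteq> []" if "v \<in> W" "take m v = dir \<omega> m" for v
    proof -
      have "v = dir \<omega> m @ drop m v" using that(2) by (metis append_take_drop_id)
      then show "angle v \<in> arc (dir \<omega> m)"
        using angle_in_arc_iff that(1) branch_in[OF br] by metis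
      show "v \<noteq> []" using that(2) len by (auto simp: m_def)
    qed
    \<comment> \<open>With radius \<open>m + L\<close>, even an edge that only touches the component
      has both ends in the cone of \<open>dir \<omega> m\<close>.\<close>
    have "end_nbhd X (ball (m + L)) \<omega> \<subseteq> {z \<in> fpoints X. disk z \<in> U}"
    proof
      fix z assume z: "z \<in> end_nbhd X (ball (m + L)) \<omega>"
      then consider p v where "z = Pt p" "p \<in> complex_points X" "v \<in> end_component X (ball (m + L)) \<omega>" "p v > 0"
        | \<eta> r K where "z = End \<eta>" "\<eta> \<in> graph_ends X" "r \<in> \<eta>" "\<And>i. i \<ge> K \<Longrightarrow> r i \<in> end_component X (ball (m + L)) \<omega>"
        unfolding end_nbhd_def by blast
      then have "disk z \<in> Elementary_Metric_Spaces.ball (circ y) \<epsilon> \<and> z \<in> fpoints X"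
      proof cases
        case (1 p v)
        note v = end_component_ball[OF \<omega>(1) 1(3)]
        have "disk z \<in> Elementary_Metric_Spaces.ball (circ y) \<epsilon>"
        proof -
          from 1(2) consider v' where "p = bary v' v' 0" | a b t where "{a, b} \<in> edges X" "t \<in> {0..1}" "p = bary a b t"
            unfolding complex_points_def by blast
          then show ?thesis
          proof cases
            case (1 v')
            then have "v' = v" using \<open>p v > 0\<close> bary_pos by fast
            then show ?thesis using 1 \<open>z = Pt p\<close> disk_vertex near pref v by simp
          next
            case (2 a b t)
            have "v = a \<or> v = b" using \<open>p v > 0\<close> 2(3) bary_pos by simp
            then have "take m a = dir \<omega> m \<and> take m b = dir \<omega> m"
              using edge_take[of a b m] edge_take[of b a m] 2(1) v by (auto simp: insert_commute)
            then have ab: "angle a \<in> arc (dir \<omega> m)" "a \<noteq> []" "angle b \<in> arc (dir \<omega> m)" "b \<noteq> []"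
              using pref edge_in 2(1) by metis+
            have "circ ((1 - t) * angle a + t * angle b) \<in> Elementary_Metric_Spaces.ball (circ y) \<epsilon>"
              using near arc_convex ab 2(2) len by (metis length_0_conv m_def nat.distinct(1))
            moreover have "(1 - t) *\<^sub>R circ (angle a) + t *\<^sub>R circ (angle b) \<in> Elementary_Metric_Spaces.ball (circ y) \<epsilon>"
              using convexD[OF convex_ball near near, OF ab(1,3), of "1 - t" t] 2(2) by simp
            ultimately show ?thesis
              using disk_edge_form[OF 2(1) ab(2,4) 2(2)] 2(3) \<open>z = Pt p\<close> by auto
          qed
        qed
        moreover have "z \<in> fpoints X" using 1 by (auto simp: fpoints_def)
        ultimately show ?thesis by blast
      next
        case (2 \<eta> r K)
        have "dir \<eta> m = dir \<omega> m"
          using dir_prefix[OF 2(2,3), of K m] end_component_ball(3)[OF \<omega>(1) 2(4)] by blast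
        then have "endpos (dir \<eta>) \<in> arc (dir \<omega> m)" using endpos[OF dir(1)[OF 2(2)], of m] by simp
        then show ?thesis using near 2 by (simp add: fpoints_def)
      qed
      then show "z \<in> {z \<in> fpoints X. disk z \<in> U}" using \<epsilon>(2) by blast
    qed
    then show "\<exists>S. finite S \<and> S \<subseteq> verts X \<and> end_nbhd X S \<omega> \<subseteq> {z \<in> fpoints X. disk z \<in> U}"
      using finite_ball ball_subset by (intro exI[of _ "ball (m + L)"]) simp
  qed simp
qed simp

section \<open>Injectivity, and surjectivity onto the circle\<close>

text \<open>Graph of the correspondence between \<open>own w\<close> and the points placed there,
  namely \<open>w\<close> and the open s-edges assigned to it. As a relation it serves both
  directions: from a point to its coordinate and back.\<close>

definition own_point :: "'a letter list \<Rightarrow> real \<Rightarrow> 'a letter list fpoint \<Rightarrow> bool" where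
  "own_point w \<mu> z \<longleftrightarrow> w \<in> W \<and> (\<mu> = lend w (slot w None) \<and> z = vertex_point w \<or>
     (\<exists>x y t. w @ x \<in> W \<and> w @ y \<in> W \<and> nxt x y \<and> 0 < t \<and> t < 1 \<and>
       \<mu> = (1 - t) * rend w (slot w (cls x)) + t * lend w (Suc (slot w (cls x))) \<and>
       z = Pt (bary (w @ x) (w @ y) t)))"

lemma own_point_gap:
  assumes "w @ x \<in> W" "w @ y \<in> W" "nxt x y" "0 < t" "t < 1"
  shows "(1 - t) * rend w (slot w (cls x)) + t * lend w (Suc (slot w (cls x))) \<in> gap w (slot w (cls x))"
proof -
  let ?k = "slot w (cls x)"
  let ?a = "rend w ?k" and ?b = "lend w (Suc ?k)"
  have ab: "?a < ?b" using rend_less_lend slot_less by blast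
  have "(1 - t) * ?a + t * ?b = ?a + t * (?b - ?a)" "(1 - t) * ?a + t * ?b = ?b - (1 - t) * (?b - ?a)"
    by (simp_all add: algebra_simps)
  moreover have "t * (?b - ?a) > 0" "(1 - t) * (?b - ?a) > 0" using ab assms by simp_all
  ultimately show ?thesis unfolding gap_def by auto
qed

lemma own_point_own:
  assumes "own_point w \<mu> z"
  shows "\<mu> \<in> own w" "disk z = circ (node w \<mu>)" "z \<in> fpoints X"
proof -
  have w: "w \<in> W" using assms by (simp add: own_point_def)
  have "\<mu> \<in> own w \<and> disk z = circ (node w \<mu>) \<and> z \<in> fpoints X"
  proof (cases "\<mu> = lend w (slot w None) \<and> z = vertex_point w")
    case True
    then show ?thesis
      using lend_own[OF w] disk_vertex[of w 0] vertex_in[OF w] by (simp add: vertex_point_def angle_def)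
  next
    case False
    then obtain x y t where g: "w @ x \<in> W" "w @ y \<in> W" "nxt x y" "0 < t" "t < 1"
        "\<mu> = (1 - t) * rend w (slot w (cls x)) + t * lend w (Suc (slot w (cls x)))"
        "z = Pt (bary (w @ x) (w @ y) t)"
      using assms unfolding own_point_def by blast
    have "{w @ x, w @ y} \<in> edges X" using adj_edge adj_append g nxt_def by blast
    then have "z \<in> fpoints X"
      unfolding g(7) fpoints_def complex_points_def using g(4,5) by fastforce
    moreover have "\<mu> \<in> own w"
      unfolding g(6) by (rule gap_own(1)[OF w gap_edge(1)[OF g(1-3)] own_point_gap[OF g(1-5)]])
    moreover have "disk z = circ (node w \<mu>)"
      unfolding g(6,7) using g(4,5) by (intro disk_gap[OF g(1-3)]) simp
    ultimately show ?thesis by blast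
  qed
  then show "\<mu> \<in> own w" "disk z = circ (node w \<mu>)" "z \<in> fpoints X" by blast+
qed

lemma own_point_unique:
  assumes "own_point w \<mu> z" "own_point w \<mu> z'"
  shows "z = z'"
proof -
  have w: "w \<in> W" using assms by (simp add: own_point_def)
  have vertex: "\<mu> \<noteq> lend w (slot w None)"
    if "w @ x \<in> W" "w @ y \<in> W" "nxt x y" "0 < t" "t < 1"
      "\<mu> = (1 - t) * rend w (slot w (cls x)) + t * lend w (Suc (slot w (cls x)))" for x y t
    unfolding that(6) by (rule gap_own(2)[OF w gap_edge(1)[OF that(1-3)] own_point_gap[OF that(1-5)]])
  have gap: "Pt (bary (w @ x) (w @ y) t) = Pt (bary (w @ x') (w @ y') t')"
    if g: "w @ x \<in> W" "w @ y \<in> W" "nxt x y" "0 < t" "t < 1"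
      "\<mu> = (1 - t) * rend w (slot w (cls x)) + t * lend w (Suc (slot w (cls x)))"
      and g': "w @ x' \<in> W" "w @ y' \<in> W" "nxt x' y'" "0 < t'" "t' < 1"
      "\<mu> = (1 - t') * rend w (slot w (cls x')) + t' * lend w (Suc (slot w (cls x')))" for x y t x' y' t'
  proof -
    let ?k = "slot w (cls x)"
    have k: "?k = slot w (cls x')"
      by (rule gap_disjoint[OF slot_less slot_less, of \<mu> w])
        (use own_point_gap[OF g(1-5)] own_point_gap[OF g'(1-5)] g(6) g'(6) in simp_all)
    then have "cls x = cls x'"
      using slot_inj[OF w cls_in cls_in] nxt_in g(3) g'(3) by metis
    then have xy: "x = x'" "y = y'" using nxt_unique_left[OF g(3) g'(3)] by auto
    have "(t - t') * (lend w (Suc ?k) - rend w ?k) = 0"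
      using g(6) g'(6) k by (simp add: algebra_simps)
    then have "t = t'" using rend_less_lend[OF slot_less, of w w "cls x"] by simp
    with xy show ?thesis by simp
  qed
  show ?thesis
  proof (cases "\<mu> = lend w (slot w None)")
    case True
    then show ?thesis using assms vertex unfolding own_point_def by blast
  next
    case False
    obtain x y t where g: "w @ x \<in> W" "w @ y \<in> W" "nxt x y" "0 < t" "t < 1"
      "\<mu> = (1 - t) * rend w (slot w (cls x)) + t * lend w (Suc (slot w (cls x)))"
      and z: "z = Pt (bary (w @ x) (w @ y) t)"
      using assms(1) False unfolding own_point_def by blast
    obtain x' y' t' where g': "w @ x' \<in> W" "w @ y' \<in> W" "nxt x' y'" "0 < t'" "t' < 1"
      "\<mu> = (1 - t') * rend w (slot w (cls x')) + t' * lend w (Suc (slot w (cls x')))"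
      and z': "z' = Pt (bary (w @ x') (w @ y') t')"
      using assms(2) False unfolding own_point_def by blast
    show ?thesis unfolding z z' by (rule gap[OF g g'])
  qed
qed

lemma own_point_ex:
  assumes "w \<in> W" "\<mu> \<in> dom w" "\<nexists>l. w @ [l] \<in> W \<and> \<mu> \<in> seg w l"
  obtains z where "own_point w \<mu> z"
proof -
  from dom_cover[OF assms(1,2)] assms(3)
  consider "\<mu> = lend w (slot w None)" | k where "k \<in> gaps w" "\<mu> \<in> gap w k" by blast
  then show ?thesis
  proof cases
    case 1
    then have "own_point w \<mu> (vertex_point w)" using assms(1) by (simp add: own_point_def)
    then show ?thesis by (rule that)
  next
    case (2 k)
    obtain x y where xy: "w @ x \<in> W" "w @ y \<in> W" "nxt x y" "slot w (cls x) = k"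
      using gap_adj[OF assms(1) 2(1)] by metis
    define t where "t = (\<mu> - rend w k) / (lend w (Suc k) - rend w k)"
    have "rend w k < \<mu>" "\<mu> < lend w (Suc k)" using 2(2) by (auto simp: gap_def)
    then have "0 < t" "t < 1" "t * (lend w (Suc k) - rend w k) = \<mu> - rend w k"
      by (auto simp: t_def)
    moreover from this have "\<mu> = (1 - t) * rend w k + t * lend w (Suc k)"
      by (simp add: algebra_simps)
    ultimately have "own_point w \<mu> (Pt (bary (w @ x) (w @ y) t))"
      unfolding own_point_def using assms(1) xy by blast
    then show ?thesis by (rule that)
  qed
qed

lemma own_point_in: "own_point w \<mu> z \<Longrightarrow> w \<in> W"
  by (simp add: own_point_def)

lemma own_point_range: "own_point w \<mu> z \<Longrightarrow> node w \<mu> \<in> {0..<1}"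
  using own_point_own(1) own_subset_arc arc_range own_point_in by blast

definition chord_point :: "'a letter list \<Rightarrow> 'a letter \<Rightarrow> real \<Rightarrow> 'a letter list fpoint \<Rightarrow> bool" where
  "chord_point x l t z \<longleftrightarrow>
     x @ [l] \<in> W \<and> \<not> adj x (x @ [l]) \<and> 0 < t \<and> t < 1 \<and> z = Pt (bary x (x @ [l]) t)"

text \<open>Vertices and s-edges land on the circle in sets owned by words, the remaining tree edges
  are open chords, and ends are limits of arcs. End points of edges are counted among the
  vertices.\<close>

lemma points_cases:
  assumes "z \<in> fpoints X"
  obtains (own) w \<mu> where "own_point w \<mu> z"
  | (chord) x l t where "chord_point x l t z"
  | (endp) \<omega> where "\<omega> \<in> graph_ends X" "z = End \<omega>"
proof (cases z)
  case (End \<omega>)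
  then show ?thesis using assms endp by (auto simp: fpoints_def)
next
  case (Pt p)
  have vertex: thesis if "v \<in> W" "p = bary v v 0" for v
    using own[of v] that Pt by (auto simp: own_point_def vertex_point_def)
  have "p \<in> complex_points X" using assms Pt by (auto simp: fpoints_def)
  then consider v where "v \<in> W" "p = bary v v 0" | u v t where "{u, v} \<in> edges X" "t \<in> {0..1}" "p = bary u v t"
    unfolding complex_points_def by auto
  then show ?thesis
  proof cases
    case (1 v)
    then show ?thesis using vertex by blast
  next
    case (2 u v t)
    note e = edge_in[OF 2(1)]
    consider "t = 0" | "t = 1" | "0 < t" "t < 1" using 2(2) by fastforce
    then show ?thesis
    proof cases
      case 1
      then have "p = bary u u 0" using 2(3) by (auto simp: bary_def)
      then show ?thesis using vertex e by blast
    next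
      case t: 2
      then have "p = bary v v 0" using 2(3) by (auto simp: bary_def)
      then show ?thesis using vertex e by blast
    next
      case 3
      have via_gap: thesis if "w @ x \<in> W" "w @ y \<in> W" "nxt x y" "0 < t" "t < 1" "p = bary (w @ x) (w @ y) t" for w x y t
      proof -
        have "w \<in> W" using that(1) append_in_free_group by blast
        then show thesis using own[of w] that Pt unfolding own_point_def by blast
      qed
      have via_tree: thesis if "x @ [l] \<in> W" "\<not> adj x (x @ [l])" "0 < t" "t < 1" "p = bary x (x @ [l]) t" for x l t
        using chord[of x l t] that Pt by (simp add: chord_point_def)
      show ?thesis using 2(1)
      proof (cases rule: edge_disk_cases)
        case (gap w x y)
        then show ?thesis using via_gap[of w x y t] 3 2(3) by simp
      next
        case (pag w x y)
        then show ?thesis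
          using via_gap[of w x y "1 - t"] 3 2(3) bary_swap[of u v t] by simp
      next
        case tr: tree
        then consider l where "v = u @ [l]" "v \<in> W" | l where "u = v @ [l]" "u \<in> W"
          using edge_cases[OF 2(1)] by blast
        then show ?thesis
        proof cases
          case (1 l)
          then show ?thesis using via_tree[of u l t] tr 3 2(3) by simp
        next
          case (2 l)
          have "\<not> adj v (v @ [l])" using tr 2 adj_sym by blast
          then show ?thesis using via_tree[of v l "1 - t"] 2 3 \<open>p = bary u v t\<close> bary_swap[of u v t] by simp
        qed
      qed
    qed
  qed
qed

lemma chord_point_disk:
  assumes "chord_point x l t z"
  shows "disk z = (1 - t) *\<^sub>R circ (angle x) + t *\<^sub>R circ (angle (x @ [l]))" "norm (disk z) < 1"
    "x \<in> W" "x @ [l] \<in> W" "0 < t" "t < 1"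
proof -
  show x: "x @ [l] \<in> W" "0 < t" "t < 1" using assms by (auto simp: chord_point_def)
  then show "x \<in> W" using append_in_free_group by blast
  show d: "disk z = (1 - t) *\<^sub>R circ (angle x) + t *\<^sub>R circ (angle (x @ [l]))"
    using assms disk_tree[of x "x @ [l]" t] by (simp add: chord_point_def)
  show "norm (disk z) < 1"
    unfolding d using x \<open>x \<in> W\<close> angle_neq[of x "x @ [l]"] by (intro norm_chord_less) auto
qed

text \<open>Two tree edges without a common end point: the cone at the upper end of the lower one contains
  both ends of this edge and no end of the other one.\<close>

lemma chords_disjoint:
  assumes "x @ [l] \<in> W" "x' @ [l'] \<in> W" "0 < t" "t < 1" "0 < t'" "t' < 1"
    and "length x \<le> length x'" "x @ [l] \<noteq> x' @ [l']"
  shows "(1 - t) *\<^sub>R circ (angle x) + t *\<^sub>R circ (angle (x @ [l])) \<noteq>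
    (1 - t') *\<^sub>R circ (angle x') + t' *\<^sub>R circ (angle (x' @ [l']))"
proof -
  have W: "x \<in> W" "x' \<in> W" using assms(1,2) append_in_free_group by blast+
  \<comment> \<open>As \<open>x\<close> is not longer than \<open>x'\<close> and the upper ends
    differ, these are the only two ways in which the edges can share an end point.\<close>
  consider "x = x'" | "x' = x @ [l]" | "x \<noteq> x'" "x' \<noteq> x @ [l]" by blast
  then show ?thesis
  proof cases
    case 1
    then show ?thesis
      using assms W angle_neq[of x "x @ [l]"] angle_neq[of x "x @ [l']"] angle_neq[of "x @ [l]" "x @ [l']"]
      unfolding 1[symmetric] by (intro chords_common_end) auto
  next
    case 2
    have "(1 - (1 - t)) *\<^sub>R circ (angle x') + (1 - t) *\<^sub>R circ (angle x) \<noteq>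
      (1 - t') *\<^sub>R circ (angle x') + t' *\<^sub>R circ (angle (x' @ [l']))"
      using assms W 2 angle_neq[of x' x] angle_neq[of x' "x' @ [l']"] angle_neq[of x "x' @ [l']"]
      by (intro chords_common_end) auto
    then show ?thesis using 2 by (simp add: add.commute)
  next
    case 3
    have "x' \<noteq> []" using 3(1) assms(7) by auto
    then obtain \<alpha> \<beta> where arc: "arc x' = {\<alpha>..\<beta>}" using arc_interval by blast
    have in_arc: "angle x' \<in> arc x'" "angle (x' @ [l']) \<in> arc x'"
      using angle_in_arc_iff W(2) assms(2) by blast+
    have "\<nexists>y. x = x' @ y" using 3(1) assms(7) by auto
    moreover have "\<nexists>y. x @ [l] = x' @ y"
    proof
      assume "\<exists>y. x @ [l] = x' @ y"
      then obtain y where y: "x @ [l] = x' @ y" by blast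
      show False
      proof (cases y rule: rev_cases)
        case Nil
        then show ?thesis using y 3(2) by simp
      next
        case (snoc y' m)
        then have "x = x' @ y'" using y by simp
        then show ?thesis using \<open>\<nexists>y. x = x' @ y\<close> by blast
      qed
    qed
    ultimately have "angle x \<notin> arc x'" "angle (x @ [l]) \<notin> arc x'"
      using angle_in_arc_iff W assms(1) by blast+
    then have out: "angle x \<in> {0..<1} - {\<alpha>..\<beta>}" "angle (x @ [l]) \<in> {0..<1} - {\<alpha>..\<beta>}"
      using angle_range W assms(1) arc by blast+
    have "{\<alpha>..\<beta>} \<subseteq> {0..<1}" "\<alpha> \<le> \<beta>" using arc arc_range[OF W(2)] in_arc by auto
    then have ab: "0 \<le> \<alpha>" "\<alpha> \<le> \<beta>" "\<beta> < 1" by auto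
    show ?thesis
      using chords_separated[OF ab in_arc[unfolded arc] out, of t' t] assms by auto
  qed
qed

text \<open>The norm separates open chords from the rest. On the circle, sets owned by different
  words are disjoint, an end avoids them because it lies in arcs of arbitrarily long words, and
  different ends eventually lie in disjoint arcs.\<close>

lemma disk_inj:
  assumes "z \<in> fpoints X" "z' \<in> fpoints X" "disk z = disk z'"
  shows "z = z'"
proof -
  have norm1: "norm (disk z) = 1" if "own_point w \<mu> z" for w \<mu> z
    using own_point_own(2)[OF that] by simp
  have own_end: False if "own_point w \<mu> z" "\<omega> \<in> graph_ends X" "disk z = disk (End \<omega>)" for w \<mu> z \<omega>
  proof -
    have "node w \<mu> = endpos (dir \<omega>)"
      using circ_inj[OF own_point_range[OF that(1)] endpos_range[OF dir(1)[OF that(2)]]]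
        own_point_own(2)[OF that(1)] that(3) by simp
    \<comment> \<open>A prefix of the end that is longer than \<open>w\<close> cannot be a prefix of
      \<open>w\<close>, so its arc avoids what \<open>w\<close> owns.\<close>
    moreover have "endpos (dir \<omega>) \<in> arc (dir \<omega> (Suc (length w)))" using endpos dir(1)[OF that(2)] by blast
    moreover have "\<nexists>x. w = dir \<omega> (Suc (length w)) @ x"
    proof
      assume "\<exists>x. w = dir \<omega> (Suc (length w)) @ x"
      then obtain x where "length w = length (dir \<omega> (Suc (length w)) @ x)" using arg_cong by metis
      then show False using branch_length[OF dir(1)[OF that(2)], of "Suc (length w)"] by simp
    qed
    moreover have "node w \<mu> \<in> node w ` own w" using own_point_own(1)[OF that(1)] by (rule imageI)
    ultimately show False
      using own_arc_disjoint[OF own_point_in[OF that(1)] branch_in[OF dir(1)[OF that(2)]]]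
      by (metis disjoint_iff)
  qed
  show ?thesis using assms(1)
  proof (cases rule: points_cases)
    case (own w \<mu>)
    show ?thesis using assms(2)
    proof (cases rule: points_cases)
      case (own w' \<mu>')
      have eq: "node w \<mu> = node w' \<mu>'"
        using circ_inj[OF own_point_range[OF \<open>own_point w \<mu> z\<close>] own_point_range[OF own]]
          own_point_own(2)[OF \<open>own_point w \<mu> z\<close>] own_point_own(2)[OF own] assms(3) by simp
      have "w = w'"
        using own_disjoint[OF own_point_in[OF \<open>own_point w \<mu> z\<close>] own_point_in[OF own]]
          own_point_own(1)[OF \<open>own_point w \<mu> z\<close>] own_point_own(1)[OF own] eq by blast
      then show ?thesis using own_point_unique \<open>own_point w \<mu> z\<close> own eq node_eq_iff by metis
    next
      case (chord x l t)
      then show ?thesis using chord_point_disk(2) norm1[OF own] assms(3) by fastforce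
    next
      case (endp \<omega>)
      then show ?thesis using own_end own assms(3) by blast
    qed
  next
    case (chord x l t)
    note c = chord_point_disk[OF chord]
    show ?thesis using assms(2)
    proof (cases rule: points_cases)
      case (own w' \<mu>')
      then show ?thesis using c(2) norm1[OF own] assms(3) by simp
    next
      case ch': (chord x' l' t')
      note c' = chord_point_disk[OF ch']
      have "x @ [l] = x' @ [l']"
      proof (rule ccontr)
        assume ne: "x @ [l] \<noteq> x' @ [l']"
        show False
        proof (cases "length x \<le> length x'")
          case True
          then show ?thesis using chords_disjoint[OF c(4) c'(4) c(5,6) c'(5,6) True ne] c(1) c'(1) assms(3) by simp
        next
          case False
          then show ?thesis
            using chords_disjoint[OF c'(4) c(4) c'(5,6) c(5,6) _ ne[symmetric]] c(1) c'(1) assms(3) by simp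
        qed
      qed
      then have x: "x = x'" "l = l'" by auto
      have "(t - t') *\<^sub>R (circ (angle (x @ [l])) - circ (angle x)) = 0"
        using c(1) c'(1) assms(3) x by (simp add: algebra_simps)
      then have "t = t'" using angle_neq[OF c(3,4)] by auto
      then show ?thesis using chord ch' x by (simp add: chord_point_def)
    next
      case (endp \<omega>)
      then show ?thesis using c(2) assms(3) by simp
    qed
  next
    case (endp \<omega>)
    show ?thesis using assms(2)
    proof (cases rule: points_cases)
      case (own w' \<mu>')
      then show ?thesis using own_end endp assms(3) by metis
    next
      case (chord x l t)
      then show ?thesis
        using chord_point_disk(2) endp(2) assms(3) by (metis disk.simps(2) norm_circ less_irrefl)
    next
      case e': (endp \<eta>)
      note br = dir(1)[OF endp(1)] dir(1)[OF e'(1)]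
      have eq: "endpos (dir \<omega>) = endpos (dir \<eta>)"
        using circ_inj[OF endpos_range endpos_range] br endp e' assms(3) by simp
      have "dir \<omega> m = dir \<eta> m" for m
      proof (rule ccontr)
        assume "dir \<omega> m \<noteq> dir \<eta> m"
        then obtain w x y where d: "dir \<omega> m = w @ x" "dir \<eta> m = w @ y" "cls x \<noteq> cls y"
          using diverge by blast
        have "length x = length y"
          using d branch_length[OF br(1), of m] branch_length[OF br(2), of m] by simp
        then obtain a x' b y' where xy: "x = a # x'" "y = b # y'" "a \<noteq> b"
          using d(3) by (cases x; cases y) auto
        then have "arc (dir \<omega> m) \<inter> arc (dir \<eta> m) = {}"
          using arc_siblings_disjoint[of w a x' b y'] branch_in[OF br(1), of m] branch_in[OF br(2), of m] d by simp
        then show False using endpos[OF br(1), of m] endpos[OF br(2), of m] eq by auto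
      qed
      then have "dir \<omega> = dir \<eta>" by blast
      then show ?thesis using dir_inj endp e' by blast
    qed
  qed
qed

text \<open>A position in the arc of \<open>w\<close> is either owned by \<open>w\<close>, and then
  attained, or it lies in the arc of a child. If it is never attained, the descent continues forever
  and produces an end at exactly this position.\<close>

lemma disk_surj:
  assumes "norm c = 1"
  shows "\<exists>z\<in>fpoints X. disk z = c"
proof (rule ccontr)
  assume no: "\<not> (\<exists>z\<in>fpoints X. disk z = c)"
  obtain \<theta> where \<theta>: "\<theta> \<in> {0..<1}" "c = circ \<theta>" using circ_surj[OF assms] by metis
  have step: "\<exists>l. w @ [l] \<in> W \<and> \<theta> \<in> arc (w @ [l])" if w: "w \<in> W" "\<theta> \<in> arc w" for w
  proof (rule ccontr)
    assume none: "\<not> ?thesis"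
    obtain \<mu> where \<mu>: "\<mu> \<in> dom w" "\<theta> = node w \<mu>" using w(2) by (auto simp: arc_def)
    then have "\<nexists>l. w @ [l] \<in> W \<and> \<mu> \<in> seg w l" using none arc_snoc by blast
    then obtain z where "own_point w \<mu> z" using own_point_ex w(1) \<mu>(1) by metis
    then show False using own_point_own no \<mu>(2) \<theta>(2) by metis
  qed
  have "\<exists>u. \<forall>m. (u m \<in> W \<and> \<theta> \<in> arc (u m) \<and> (m = 0 \<longrightarrow> u m = [])) \<and> (\<exists>l. u (Suc m) = u m @ [l])"
  proof (rule dependent_nat_choice)
    show "\<exists>w. w \<in> W \<and> \<theta> \<in> arc w \<and> (0 = (0::nat) \<longrightarrow> w = [])"
      using \<theta>(1) arc_Nil by auto
    show "\<exists>w'. (w' \<in> W \<and> \<theta> \<in> arc w' \<and> (Suc m = 0 \<longrightarrow> w' = [])) \<and> (\<exists>l. w' = w @ [l])"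
      if "w \<in> W \<and> \<theta> \<in> arc w \<and> (m = 0 \<longrightarrow> w = [])" for w and m :: nat
      using step[of w] that by blast
  qed
  then obtain u where u: "\<And>m. u m \<in> W" "\<And>m. \<theta> \<in> arc (u m)" "u 0 = []" "\<And>m. \<exists>l. u (Suc m) = u m @ [l]"
    by metis
  then have br: "branch u" unfolding branch_def by blast
  then have "endpos u = \<theta>" using nested_unique[OF br] endpos[OF br] u(2) by blast
  moreover obtain \<omega> where "\<omega> \<in> graph_ends X" "dir \<omega> = u" using dir_surj[OF br] by metis
  ultimately have "End \<omega> \<in> fpoints X" "disk (End \<omega>) = c" using \<theta>(2) by (auto simp: fpoints_def)
  then show False using no by blast
qed

lemma norm_disk_le:
  assumes "z \<in> fpoints X"
  shows "norm (disk z) \<le> 1"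
  using assms
proof (cases rule: points_cases)
  case (own w \<mu>)
  then show ?thesis using own_point_own(2) by simp
next
  case (chord x l t)
  then show ?thesis using chord_point_disk(2) by fastforce
qed simp

lemma outerplanar_X: "outerplanar X"
proof -
  let ?D = "cball (0 :: complex) 1"
  define C where "C = {z \<in> fpoints X. norm (disk z) = 1}"
  have "continuous_map (freudenthal X) (top_of_set ?D) disk"
    using continuous_disk norm_disk_le
    by (auto simp: continuous_map_in_subtopology topspace_freudenthal)
  moreover have "inj_on disk (topspace (freudenthal X))"
    using disk_inj by (auto simp: inj_on_def topspace_freudenthal)
  ultimately have emb: "embedding_map (freudenthal X) (top_of_set ?D) disk"
    using continuous_imp_embedding_map compact_X Hausdorff_space_subtopology[OF Hausdorff_space_euclidean] by blast
  have img: "disk ` C = sphere 0 1"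
  proof
    show "sphere 0 1 \<subseteq> disk ` C"
    proof
      fix c :: complex assume "c \<in> sphere 0 1"
      then have c: "norm c = 1" by simp
      then obtain z where "z \<in> fpoints X" "disk z = c" using disk_surj by blast
      with c show "c \<in> disk ` C" unfolding C_def by blast
    qed
  qed (auto simp: C_def)
  have "homeomorphic_map (subtopology (freudenthal X) C)
      (subtopology (subtopology (top_of_set ?D) (disk ` topspace (freudenthal X))) (sphere 0 1)) disk"
    using emb unfolding embedding_map_def
    by (rule homeomorphic_map_subtopologies_alt) (auto simp: C_def topspace_freudenthal)
  moreover have "?D \<inter> (disk ` topspace (freudenthal X) \<inter> sphere 0 1) = sphere 0 1"
    using img by (auto simp: C_def topspace_freudenthal)
  ultimately have "homeomorphic_map (subtopology (freudenthal X) C) (top_of_set (sphere 0 1)) disk"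
    by (simp add: subtopology_subtopology Int_assoc)
  then have "hamiltonian_circle X C"
    unfolding hamiltonian_circle_def
    using homeomorphic_map_imp_homeomorphic_space vertex_in disk_vertex[of _ 0]
    by (auto simp: C_def topspace_freudenthal vertex_point_def)
  then show ?thesis
    unfolding outerplanar_def using connected_X locally_finite_X emb img by blast
qed

end


section \<open>The Cayley graph\<close>

lemma same_first_letter_iff:
  "(x, y) \<in> same_first_letter A \<longleftrightarrow>
     x \<in> carrier (free_group A) \<and> y \<in> carrier (free_group A) \<and> cls x = cls y"
  by (auto simp: same_first_letter_def cls_def)

context
  fixes A :: "'a set" and s :: "'a letter list"
  assumes finA: "finite A" and card_A: "card A \<ge> 1" and s_in: "s \<in> carrier (free_group A)"
    and cyc: "is_cycle (quotient_graph (Cay (free_group A) {s, inv\<^bsub>free_group A\<^esub> s}) (same_first_letter A))"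
begin

interpretation G: group "free_group A" by (rule group_free_group)

abbreviation (input) "F \<equiv> carrier (free_group A)"

definition sadj :: "'a letter list \<Rightarrow> 'a letter list \<Rightarrow> bool" where
  "sadj x y \<longleftrightarrow> x \<in> F \<and> y \<in> F \<and> x \<noteq> y \<and> inv\<^bsub>free_group A\<^esub> x \<otimes>\<^bsub>free_group A\<^esub> y \<in> {s, inv\<^bsub>free_group A\<^esub> s}"

lemma sadj_sym: "sadj x y \<Longrightarrow> sadj y x"
proof -
  assume "sadj x y"
  then have xy: "x \<in> F" "y \<in> F" "x \<noteq> y" "inv\<^bsub>free_group A\<^esub> x \<otimes>\<^bsub>free_group A\<^esub> y \<in> {s, inv\<^bsub>free_group A\<^esub> s}"
    by (auto simp: sadj_def)
  have "inv\<^bsub>free_group A\<^esub> (inv\<^bsub>free_group A\<^esub> x \<otimes>\<^bsub>free_group A\<^esub> y) = inv\<^bsub>free_group A\<^esub> y \<otimes>\<^bsub>free_group A\<^esub> x"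
    using xy by (simp add: G.inv_mult_group)
  then have "inv\<^bsub>free_group A\<^esub> y \<otimes>\<^bsub>free_group A\<^esub> x \<in> {s, inv\<^bsub>free_group A\<^esub> s}"
    using xy(4) s_in by auto
  then show ?thesis using xy by (simp add: sadj_def)
qed

lemma sadj_mult: "g \<in> F \<Longrightarrow> sadj x y \<Longrightarrow> sadj (g \<otimes>\<^bsub>free_group A\<^esub> x) (g \<otimes>\<^bsub>free_group A\<^esub> y)"
proof -
  assume g: "g \<in> F" and xy: "sadj x y"
  then have in_W: "x \<in> F" "y \<in> F" by (auto simp: sadj_def)
  have "inv\<^bsub>free_group A\<^esub> g \<otimes>\<^bsub>free_group A\<^esub> (g \<otimes>\<^bsub>free_group A\<^esub> y) = y"
    using g in_W by (simp flip: G.m_assoc)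
  then have "inv\<^bsub>free_group A\<^esub> (g \<otimes>\<^bsub>free_group A\<^esub> x) \<otimes>\<^bsub>free_group A\<^esub> (g \<otimes>\<^bsub>free_group A\<^esub> y) =
      inv\<^bsub>free_group A\<^esub> x \<otimes>\<^bsub>free_group A\<^esub> y"
    using g in_W by (simp add: G.inv_mult_group G.m_assoc)
  then show ?thesis using g xy by (simp add: sadj_def)
qed

lemma sadj_lmult:
  assumes "l \<in> A \<times> UNIV" "sadj x y"
  shows "sadj (lmult l x) (lmult l y)"
  using sadj_mult[of "[l]" x y] assms by (simp add: mult_free_group)

lemma sadj_right: "sadj x y \<Longrightarrow> \<exists>t\<in>{s, inv\<^bsub>free_group A\<^esub> s}. y = x \<otimes>\<^bsub>free_group A\<^esub> t"
  unfolding sadj_def by (metis G.inv_solve_left' G.inv_closed G.m_closed)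

lemma edges_s: "edges (Cay (free_group A) {s, inv\<^bsub>free_group A\<^esub> s}) = {{x, y} | x y. sadj x y}"
  by (simp add: Cay_def sadj_def)

section \<open>Vertices of the quotient graph as first letters\<close>

definition cset :: "'a letter option \<Rightarrow> 'a letter list set" where
  "cset c = {x \<in> F. cls x = c}"

lemma class_cset: "x \<in> F \<Longrightarrow> same_first_letter A `` {x} = cset (cls x)"
  by (auto simp: same_first_letter_iff cset_def)

lemma class_ex:
  assumes "c \<in> first_letters A"
  shows "\<exists>x\<in>F. cls x = c"
proof (cases c)
  case None
  then show ?thesis by (intro bexI[of _ "[]"]) simp_all
next
  case (Some l)
  then show ?thesis using assms by (intro bexI[of _ "[l]"]) simp_all
qed

lemma cset_inj:
  assumes "c \<in> first_letters A" "cset c = cset d"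
  shows "c = d"
proof -
  obtain x where "x \<in> F" "cls x = c" using class_ex[OF assms(1)] by blast
  then have "x \<in> cset c" by (simp add: cset_def)
  then have "x \<in> cset d" by (simp only: assms(2))
  then show ?thesis using \<open>cls x = c\<close> by (simp add: cset_def)
qed

lemma quotient_cset: "F // same_first_letter A = cset ` first_letters A"
proof
  show "F // same_first_letter A \<subseteq> cset ` first_letters A"
  proof
    fix z assume "z \<in> F // same_first_letter A"
    then obtain x where x: "x \<in> F" "z = same_first_letter A `` {x}" by (rule quotientE)
    then show "z \<in> cset ` first_letters A" unfolding x(2) class_cset[OF x(1)] by (intro imageI cls_in)
  qed
  show "cset ` first_letters A \<subseteq> F // same_first_letter A"
  proof
    fix z assume "z \<in> cset ` first_letters A"
    then obtain c where c: "c \<in> first_letters A" "z = cset c" by blast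
    obtain x where x: "x \<in> F" "cls x = c" using class_ex[OF c(1)] by blast
    then have "z = same_first_letter A `` {x}" using class_cset c(2) by simp
    then show "z \<in> F // same_first_letter A" using quotientI x(1) by simp
  qed
qed

lemma card_first_letters: "card (first_letters A) \<ge> 3" "finite (first_letters A)"
proof -
  have "card (Some ` (A \<times> (UNIV :: bool set))) = card A * 2"
    by (simp add: card_image card_cartesian_product)
  moreover have "finite (Some ` (A \<times> (UNIV :: bool set)))" using finA by simp
  ultimately show "card (first_letters A) \<ge> 3" "finite (first_letters A)"
    using card_A by (auto simp: first_letters_def)
qed

text \<open>Everything the geometry needs to know about \<open>s\<close> is collected in the locale.
  It remains to read the numbering off the vertex list of the cycle, to check that consecutive
  classes are joined by exactly one s-edge, and to match the edge sets.\<close>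

lemma outerplanar_Cay:
  "outerplanar (Cay (free_group A)
     (free_basis A \<union> m_inv (free_group A) ` free_basis A \<union> {s, inv\<^bsub>free_group A\<^esub> s}))"
proof -
  let ?Q = "quotient_graph (Cay (free_group A) {s, inv\<^bsub>free_group A\<^esub> s}) (same_first_letter A)"
  obtain vs es where vs: "length es = length vs" "distinct vs" "distinct es"
      "set vs = mverts ?Q" "set es = medges ?Q"
      "\<And>i. i < length vs \<Longrightarrow> endpoints ?Q (es ! i) = {vs ! i, vs ! (Suc i mod length vs)}"
    using cyc unfolding is_cycle_def by blast
  define N where "N = length vs"
  have set_vs: "set vs = cset ` first_letters A"
    using vs(4) quotient_cset by (simp add: quotient_graph_def Cay_def)
  have inj: "inj_on cset (first_letters A)" using cset_inj by (auto simp: inj_on_def)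
  have "N = card (first_letters A)"
    unfolding N_def using distinct_card[OF vs(2)] set_vs card_image[OF inj] by simp
  then have N3: "3 \<le> N" using card_first_letters by simp
  define idx where "idx c = (THE i. i < N \<and> vs ! i = cset c)" for c
  have idx: "idx c < N \<and> vs ! idx c = cset c" if "c \<in> first_letters A" for c
  proof -
    have "cset c \<in> set vs" using that set_vs by blast
    then have "\<exists>!i. i < N \<and> vs ! i = cset c"
      using vs(2) unfolding N_def in_set_conv_nth by (metis nth_eq_iff_index_eq)
    then show ?thesis unfolding idx_def by (rule theI')
  qed
  have idx_eq: "idx c = i" if "i < N" "vs ! i = cset c" "c \<in> first_letters A" for i c
    using idx[OF that(3)] that(1,2) vs(2) nth_eq_iff_index_eq unfolding N_def by metis
  have bij: "bij_betw idx (first_letters A) {..<N}"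
    unfolding bij_betw_def
  proof
    show "inj_on idx (first_letters A)"
      using idx cset_inj by (metis inj_onI)
    show "idx ` first_letters A = {..<N}"
    proof
      show "{..<N} \<subseteq> idx ` first_letters A"
      proof
        fix i assume "i \<in> {..<N}"
        then have i: "i < N" by simp
        then have "vs ! i \<in> set vs" by (simp add: N_def)
        then have "vs ! i \<in> cset ` first_letters A" by (simp only: set_vs)
        then obtain c where c: "c \<in> first_letters A" "vs ! i = cset c" by blast
        then have "i = idx c" using idx_eq[OF i c(2,1)] by simp
        then show "i \<in> idx ` first_letters A" using c(1) by blast
      qed
    qed (use idx in auto)
  qed
  have image_cls: "(\<lambda>x. same_first_letter A `` {x}) ` {x, y} = {cset (cls x), cset (cls y)}" if "x \<in> F" "y \<in> F" for x y
    using class_cset that by simp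
  have medges: "e \<in> set es \<longleftrightarrow> (\<exists>x y. e = {x, y} \<and> sadj x y \<and> cls x \<noteq> cls y)" for e
  proof -
    have "card ((\<lambda>x. same_first_letter A `` {x}) ` {x, y}) = 2 \<longleftrightarrow> cls x \<noteq> cls y" if "sadj x y" for x y
    proof -
      have xy: "x \<in> F" "y \<in> F" using that by (auto simp: sadj_def)
      have "cset (cls x) = cset (cls y) \<longleftrightarrow> cls x = cls y" using cset_inj cls_in[OF xy(1)] by metis
      then show ?thesis unfolding image_cls[OF xy] by (auto simp: card_insert_if)
    qed
    then show ?thesis
      unfolding vs(5) quotient_graph_def multigraph.select_convs edges_s by blast
  qed
  have ends: "{cset (cls x), cset (cls y)} = {vs ! i, vs ! (Suc i mod N)}"
    if "i < N" "es ! i = {x, y}" "sadj x y" for i x y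
    using vs(6)[of i] that image_cls[of x y] unfolding N_def quotient_graph_def multigraph.select_convs
    by (simp add: sadj_def)
  \<comment> \<open>Edge number \<open>i\<close> of the cycle joins the classes numbered
    \<open>i\<close> and \<open>Suc i mod N\<close>, in one of the two orders.\<close>
  have located: "\<exists>i<N. es ! i = {x, y} \<and>
      (i = idx (cls x) \<and> idx (cls y) = Suc i mod N \<or> i = idx (cls y) \<and> idx (cls x) = Suc i mod N)"
    if "sadj x y" "cls x \<noteq> cls y" for x y
  proof -
    have "{x, y} \<in> set es" using medges that by blast
    then obtain i where i: "i < N" "es ! i = {x, y}" using vs(1) unfolding N_def in_set_conv_nth by auto
    have c: "cls x \<in> first_letters A" "cls y \<in> first_letters A" using that(1) cls_in by (auto simp: sadj_def)
    have "Suc i mod N < N" using N3 by simp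
    then have "i = idx (cls x) \<and> idx (cls y) = Suc i mod N \<or> i = idx (cls y) \<and> idx (cls x) = Suc i mod N"
      using ends[OF i that(1)] idx_eq[OF i(1)] idx_eq[of "Suc i mod N"] c unfolding doubleton_eq_iff by metis
    with i show ?thesis by blast
  qed
  have Suc_Suc: "Suc (Suc i mod N) mod N \<noteq> i" if "i < N" for i
    using that N3 by (auto simp: mod_Suc)
  \<comment> \<open>Right multiplication by \<open>s\<close> or its inverse affects at most that
    many letters; the increment makes the bound valid for tree edges also when \<open>s\<close> is
    empty.\<close>
  define L where "L = Suc (max (length s) (length (inv\<^bsub>free_group A\<^esub> s)))"
  interpret bounded_cyclic_adjacency A sadj idx N L
  proof
    show "3 \<le> N" "bij_betw idx (first_letters A) {..<N}" "finite A" by (fact N3 bij finA)+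
    show "1 \<le> L" by (simp add: L_def)
    show "x \<in> F \<and> y \<in> F" "x \<noteq> y" if "sadj x y" for x y
      using that by (auto simp: sadj_def)
    show "sadj y x" if "sadj x y" for x y using that by (rule sadj_sym)
    show "sadj (lmult l x) (lmult l y)" if "l \<in> A \<times> UNIV" "sadj x y" for l x y
      using that by (rule sadj_lmult)
    show "idx (cls y) = Suc (idx (cls x)) mod N \<or> idx (cls x) = Suc (idx (cls y)) mod N"
      if "sadj x y" "cls x \<noteq> cls y" for x y
      using located[OF that] by auto
    show "\<exists>x y. sadj x y \<and> cls x = c \<and> idx (cls y) = Suc (idx c) mod N" if c: "c \<in> first_letters A" for c
    proof -
      let ?i = "idx c"
      have i: "?i < N" using idx c by blast
      then have "es ! ?i \<in> set es" using vs(1) unfolding N_def by simp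
      then obtain x y where xy: "es ! ?i = {x, y}" "sadj x y" "cls x \<noteq> cls y" using medges by blast
      then obtain j where j: "j < N" "es ! j = {x, y}"
        "j = idx (cls x) \<and> idx (cls y) = Suc j mod N \<or> j = idx (cls y) \<and> idx (cls x) = Suc j mod N"
        using located by metis
      \<comment> \<open>The edge list has no repetitions, so an edge has only one number. Which of
        its ends lies in the class \<open>c\<close> is then settled by symmetry.\<close>
      have "j = ?i" using j(1,2) xy(1) i vs(1,3) unfolding N_def by (metis nth_eq_iff_index_eq)
      moreover have "cls x \<in> first_letters A" "cls y \<in> first_letters A"
        using xy(2) cls_in by (auto simp: sadj_def)
      ultimately have "cls x = c \<and> idx (cls y) = Suc (idx c) mod N \<or> cls y = c \<and> idx (cls x) = Suc (idx c) mod N"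
        using j(3) bij c by (metis bij_betw_imp_inj_on inj_onD)
      then show ?thesis using xy(2) sadj_sym by blast
    qed
    show "x = x' \<and> y = y'"
      if xy: "sadj x y" "sadj x' y'" "cls x = cls x'" "idx (cls y) = Suc (idx (cls x)) mod N"
        "idx (cls y') = Suc (idx (cls x')) mod N" for x y x' y'
    proof -
      \<comment> \<open>An edge going forwards from a class carries the number of this class, so two
        such edges from one class are the same list entry. The opposite reading is excluded since
        \<open>N\<close> is at least 3.\<close>
      have located': "es ! idx (cls a) = {a, b} \<and> cls a \<noteq> cls b"
        if "sadj a b" "idx (cls b) = Suc (idx (cls a)) mod N" for a b
      proof -
        have lt: "idx (cls a) < N" using that(1) cls_in idx by (auto simp: sadj_def)
        then have "Suc (idx (cls a)) mod N \<noteq> idx (cls a)" using N3 by (auto simp: mod_Suc)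
        then have ne: "cls a \<noteq> cls b" using that(2) by metis
        then show ?thesis using located[OF that(1) ne] that(2) Suc_Suc lt by metis
      qed
      have "{x, y} = {x', y'}" using located'[OF xy(1,4)] located'[OF xy(2,5)] xy(3) by metis
      then show ?thesis using located'[OF xy(1,4)] located'[OF xy(2,5)] xy(3) by (metis doubleton_eq_iff)
    qed
    show "take m y = take m x" if xy: "sadj x y" and "m + L \<le> length x" for m x y
    proof -
      obtain t where t: "t \<in> {s, inv\<^bsub>free_group A\<^esub> s}" "y = x \<otimes>\<^bsub>free_group A\<^esub> t" using sadj_right[OF xy] by metis
      have "m + length t \<le> length x" using t(1) that by (auto simp: L_def)
      moreover have "x \<in> F" "t \<in> F" using xy t(1) s_in by (auto simp: sadj_def)
      ultimately show ?thesis using take_mult t(2) by metis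
    qed
    show "length y \<le> length x + L" if xy: "sadj x y" for x y
    proof -
      obtain t where t: "t \<in> {s, inv\<^bsub>free_group A\<^esub> s}" "y = x \<otimes>\<^bsub>free_group A\<^esub> t" using sadj_right[OF xy] by metis
      have "length (lmult l w) \<le> Suc (length w)" for l and w :: "'a letter list" by (cases w) auto
      then have "length (foldr lmult x t) \<le> length x + length t"
        by (induction x) (auto intro: le_trans)
      then show ?thesis using t by (auto simp: L_def mult_free_group)
    qed
  qed
  have basis: "t \<in> free_basis A \<union> m_inv (free_group A) ` free_basis A \<longleftrightarrow> (\<exists>l\<in>A \<times> UNIV. t = [l])" for t
  proof -
    have "m_inv (free_group A) ` free_basis A = (\<lambda>a. [(a, False)]) ` A"
      by (auto simp: free_basis_def inv_singleton image_image)
    then have "t \<in> free_basis A \<union> m_inv (free_group A) ` free_basis A \<longleftrightarrow>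
        (\<exists>a\<in>A. t = [(a, True)] \<or> t = [(a, False)])"
      by (auto simp: free_basis_def)
    also have "\<dots> \<longleftrightarrow> (\<exists>l\<in>A \<times> UNIV. t = [l])" by (auto simp: all_bool_eq ex_bool_eq)
    finally show ?thesis .
  qed
  have "edges X = {{x, y} | x y. x \<in> F \<and> y \<in> F \<and> x \<noteq> y \<and> inv\<^bsub>free_group A\<^esub> x \<otimes>\<^bsub>free_group A\<^esub> y \<in>
      free_basis A \<union> m_inv (free_group A) ` free_basis A \<union> {s, inv\<^bsub>free_group A\<^esub> s}}" (is "_ = ?E")
  proof
    show "edges X \<subseteq> ?E"
    proof
      fix e assume "e \<in> edges X"
      then consider x y where "e = {x, y}" "sadj x y" | x l where "e = {x, x @ [l]}" "x @ [l] \<in> F"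
        unfolding X_def by auto
      then show "e \<in> ?E"
      proof cases
        case (1 x y)
        then show ?thesis unfolding sadj_def by blast
      next
        case (2 x l)
        have lx: "l \<in> A \<times> UNIV" "x \<in> F" using 2(2) by (auto simp: in_free_group reduced_append)
        have "[l] \<in> free_basis A \<union> m_inv (free_group A) ` free_basis A"
          unfolding basis using lx(1) by blast
        then have "inv\<^bsub>free_group A\<^esub> x \<otimes>\<^bsub>free_group A\<^esub> (x @ [l]) \<in>
            free_basis A \<union> m_inv (free_group A) ` free_basis A \<union> {s, inv\<^bsub>free_group A\<^esub> s}"
          unfolding inv_mult_snoc[OF 2(2)] by simp
        moreover have "x \<noteq> x @ [l]" by simp
        ultimately show ?thesis using 2 lx(2) by blast
      qed
    qed
    show "?E \<subseteq> edges X"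
    proof
      fix e assume "e \<in> ?E"
      then obtain x y where e: "e = {x, y}" "x \<in> F" "y \<in> F" "x \<noteq> y"
        "inv\<^bsub>free_group A\<^esub> x \<otimes>\<^bsub>free_group A\<^esub> y \<in>
          free_basis A \<union> m_inv (free_group A) ` free_basis A \<union> {s, inv\<^bsub>free_group A\<^esub> s}" by blast
      show "e \<in> edges X"
      proof (cases "sadj x y")
        case True
        then show ?thesis using adj_edge e(1) by blast
      next
        case False
        then obtain l where l: "l \<in> A \<times> UNIV" "inv\<^bsub>free_group A\<^esub> x \<otimes>\<^bsub>free_group A\<^esub> y = [l]"
          using e basis unfolding sadj_def by blast
        then have "y = x \<otimes>\<^bsub>free_group A\<^esub> [l]"
          using e G.inv_solve_left' by (metis singleton_in_free_group)
        then consider "y = x @ [l]" | "x = y @ [inv_letter l]"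
          using mult_singleton_cases[OF e(2) l(1)] by blast
        then show ?thesis
          using tree_edge e by cases (auto simp: insert_commute)
      qed
    qed
  qed
  then have "X = Cay (free_group A)
     (free_basis A \<union> m_inv (free_group A) ` free_basis A \<union> {s, inv\<^bsub>free_group A\<^esub> s})"
    unfolding Cay_def X_def by simp
  then show ?thesis using outerplanar_X by simp
qed

end

theorem theorem5p15:
  fixes A :: "'a set" and n :: nat and s :: "'a letter list"
  assumes "n \<ge> 2"
    and "finite A" and "card A = n"
    and "s \<in> carrier (free_group A)"
    and "is_cycle (quotient_graph (Cay (free_group A) {s, inv\<^bsub>free_group A\<^esub> s})
           (same_first_letter A))"
  shows "outerplanar (Cay (free_group A)
           (free_basis A \<union> m_inv (free_group A) ` free_basis A \<union> {s, inv\<^bsub>free_group A\<^esub> s}))"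
  using outerplanar_Cay[of A s] assms by simp

end
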